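(* Let $F=\alpha^{1+m}\beta^{-m}$ be a properly Finslerian $m$-Kropina metric of Berwald type on a manifold $M$ with $n=\dim M>2$ and suppose $|b|^2=a_{ij}b^ib^j=0$ on $M$. Then $F$ is locally metrizable if and only if around each point of $M$ there exist coordinates $(u,v,x^3,\dots,x^n)$ such that $$a=e^{2m\psi}\left(-2\,du\,dv+H\,du^2+2W_a\,du\,dx^a+h_{ab}\,dx^adx^b\right),\qquad b=e^{(1+m)\psi}\,du,$$ where $\psi$ is any smooth function and the functions $H,W_a,h_{ab}$ depend only on $u$ and $x^3,\dots,x^n$. In that case $F$ can be written as $$F=\left|-2\,du\,dv+H\,du^2+2W_a\,du\,dx^a+h_{ab}\,dx^adx^b\right|^{(1+m)/2}(du)^{-m},$$ and the metric $-2\,du\,dv+H\,du^2+2W_a\,du\,dx^a+h_{ab}\,dx^adx^b$ provides a local metrization of $F$.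
   Context: $M$ is a smooth manifold; coordinates $x^i$ induce coordinates $(x^i,y^i)$ on $TM$; $\partial_i=\partial/\partial x^i$, $\bar\partial_i=\partial/\partial y^i$. A conic subbundle $\mathcal A\subset TM$ is an open subset projecting onto $M$ and closed under $(x,y)\mapsto(x,\lambda y)$, $\lambda>0$. A Finsler metric on $\mathcal A$ is a smooth $F:\mathcal A\to\mathbb R$ with $F(x,\lambda y)=\lambda F(x,y)$ for $\lambda>0$ and $g_{ij}=\tfrac12\bar\partial_i\bar\partial_jF^2$ nondegenerate; put $L=F^2$. $F$ is properly Finslerian if there is no finite cover of $\mathcal A$ by sets on each of which $L$ is quadratic in $y$. The canonical nonlinear connection is $N^j_i=\tfrac14\bar\partial_i[g^{jk}(y^m\partial_m\bar\partial_kL-\partial_kL)]$; $F$ is of Berwald type if $N^k_i=\Gamma^k_{ij}(x)y^j$ on $\mathcal A$, and then $\Gamma^k_{ij}$ are the Christoffel symbols of a torsion-free affine connection on $M$, the affine connection of $F$. A Berwald space is locally metrizable if each point of $M$ has a neighborhood admitting a pseudo-Riemannian metric (a local metrization) whose Levi-Civita connection coincides with the affine connection restricted to that neighborhood. $a=a_{ij}dx^idx^j$ is a pseudo-Riemannian metric on $M$, $b=b_i\,dx^i$ a smooth 1-form, $\alpha=\sqrt{|a_{ij}y^iy^j|}$, $\beta=b_iy^i$; indices are raised and lowered with $a_{ij}$. An $m$-Kropina metric ($m\in\mathbb R$ constant) is a Finsler metric $F=\alpha^{1+m}\beta^{-m}$, with $\mathcal A$ contained in the set where $\alpha\neq0$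 and $\beta>0$ (so $b$ is nowhere vanishing). Indices $a,b$ on $x^a$, $W_a$, $h_{ab}$ run over $3,\dots,n$; $dx^idx^j$ is the symmetrized tensor product; in formulas for $F$, 1-forms are regarded as functions on $TM$ ($dx^i\mapsto y^i$). *)

theory Defs
  imports "HOL-Analysis.Analysis"
begin

section \<open>Smooth functions\<close>

text \<open>Meant for open sets in finite-dimensional spaces, where it is the usual notion of C^k.\<close>

fun Ck_on :: "nat \<Rightarrow> ('a::real_normed_vector \<Rightarrow> 'b::real_normed_vector) \<Rightarrow> 'a set \<Rightarrow> bool" where
  "Ck_on 0 f S \<longleftrightarrow> continuous_on S f"
| "Ck_on (Suc k) f S \<longleftrightarrow>
     (\<forall>x\<in>S. f differentiable (at x)) \<and> (\<forall>v. Ck_on k (\<lambda>x. frechet_derivative f (at x) v) S)"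

definition smooth_on :: "('a::real_normed_vector \<Rightarrow> 'b::real_normed_vector) \<Rightarrow> 'a set \<Rightarrow> bool" where
  "smooth_on f S \<longleftrightarrow> (\<forall>k. Ck_on k f S)"

text \<open>\<open>pd i\<close> is the i-th partial derivative; on functions of \<open>(x, y)\<close>, \<open>pdx i\<close> is the derivative
  with respect to \<open>x\<^sup>i\<close> and \<open>pdy i\<close> the one with respect to \<open>y\<^sup>i\<close>.\<close>

definition pd :: "'n::finite \<Rightarrow> (real^'n \<Rightarrow> real) \<Rightarrow> real^'n \<Rightarrow> real" where
  "pd i f x = frechet_derivative f (at x) (axis i 1)"

definition pdx :: "'n::finite \<Rightarrow> ((real^'n) \<times> (real^'n) \<Rightarrow> real) \<Rightarrow> (real^'n) \<times> (real^'n) \<Rightarrow> real" where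
  "pdx i f z = frechet_derivative f (at z) (axis i 1, 0)"

definition pdy :: "'n::finite \<Rightarrow> ((real^'n) \<times> (real^'n) \<Rightarrow> real) \<Rightarrow> (real^'n) \<times> (real^'n) \<Rightarrow> real" where
  "pdy i f z = frechet_derivative f (at z) (0, axis i 1)"

section \<open>Smooth manifolds and tangent vectors\<close>

text \<open>The points of the manifold are the elements of the type \<open>'m\<close>, its dimension is \<open>CARD('n)\<close>,
  and its smooth structure is a maximal smooth atlas \<open>M\<close>. A chart is a pair of a domain and a
  coordinate map; the values of the coordinate map outside the domain are irrelevant.\<close>

type_synonym ('m, 'n) chart = "'m set \<times> ('m \<Rightarrow> real^'n)"

definition is_chart :: "('m::topological_space, 'n::finite) chart \<Rightarrow> bool" where
  "is_chart c \<longleftrightarrow> open (fst c) \<and> open (snd c ` fst c) \<and>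
     (\<exists>g. homeomorphism (fst c) (snd c ` fst c) (snd c) g)"

definition chart_inv :: "('m, 'n::finite) chart \<Rightarrow> real^'n \<Rightarrow> 'm" where
  "chart_inv c = inv_into (fst c) (snd c)"

definition transition :: "('m, 'n::finite) chart \<Rightarrow> ('m, 'n) chart \<Rightarrow> real^'n \<Rightarrow> real^'n" where
  "transition c d = snd d \<circ> chart_inv c"

definition compatible :: "('m, 'n::finite) chart \<Rightarrow> ('m, 'n) chart \<Rightarrow> bool" where
  "compatible c d \<longleftrightarrow>
     smooth_on (transition c d) (snd c ` (fst c \<inter> fst d)) \<and>
     smooth_on (transition d c) (snd d ` (fst c \<inter> fst d))"

definition smooth_structure :: "('m::topological_space, 'n::finite) chart set \<Rightarrow> bool" where
  "smooth_structure M \<longleftrightarrow>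
     (\<forall>c\<in>M. is_chart c) \<and> (\<Union>c\<in>M. fst c) = UNIV \<and>
     (\<forall>c\<in>M. \<forall>d\<in>M. compatible c d) \<and>
     (\<forall>c. is_chart c \<and> (\<forall>d\<in>M. compatible c d) \<longrightarrow> c \<in> M)"

text \<open>A tangent vector at \<open>p\<close> assigns to each chart around \<open>p\<close> its components in that chart,
  subject to the contravariant transformation law (and, to make it unique, 0 to everything else).
  Thus \<open>w c\<close> is the vector of the components \<open>y\<^sup>i = dx\<^sup>i(w)\<close> in the chart \<open>c\<close>.\<close>

type_synonym ('m, 'n) tangent = "('m, 'n) chart \<Rightarrow> real^'n"

definition tangent_space :: "('m, 'n::finite) chart set \<Rightarrow> 'm \<Rightarrow> ('m, 'n) tangent set" where
  "tangent_space M p = {w.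
     (\<forall>c\<in>M. \<forall>d\<in>M. p \<in> fst c \<inter> fst d \<longrightarrow>
        w d = frechet_derivative (transition c d) (at (snd c p)) (w c)) \<and>
     (\<forall>c. c \<notin> M \<or> p \<notin> fst c \<longrightarrow> w c = 0)}"

definition tangent_bundle :: "('m, 'n::finite) chart set \<Rightarrow> ('m \<times> ('m, 'n) tangent) set" where
  "tangent_bundle M = {(p, w). w \<in> tangent_space M p}"

text \<open>The tangent vector at \<open>p\<close> with components \<open>y\<close> in the chart \<open>c\<close>.\<close>

definition tvec :: "('m, 'n::finite) chart set \<Rightarrow> ('m, 'n) chart \<Rightarrow> 'm \<Rightarrow> real^'n \<Rightarrow> ('m, 'n) tangent" where
  "tvec M c p y = (\<lambda>d. if d \<in> M \<and> p \<in> fst d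
     then frechet_derivative (transition c d) (at (snd c p)) y else 0)"

text \<open>The image of a subset of the tangent bundle, and a function on it, in the induced
  coordinates \<open>(x, y)\<close>.\<close>

definition TM_coords :: "('m, 'n::finite) chart \<Rightarrow> ('m \<times> ('m, 'n) tangent) set \<Rightarrow> ((real^'n) \<times> (real^'n)) set" where
  "TM_coords c A = {(snd c p, w c) | p w. (p, w) \<in> A \<and> p \<in> fst c}"

definition coord_rep :: "('m, 'n::finite) chart set \<Rightarrow> ('m, 'n) chart \<Rightarrow>
    ('m \<times> ('m, 'n) tangent \<Rightarrow> real) \<Rightarrow> (real^'n) \<times> (real^'n) \<Rightarrow> real" where
  "coord_rep M c f = (\<lambda>(x, y). f (chart_inv c x, tvec M c (chart_inv c x) y))"

section \<open>1-forms, metrics and the Levi-Civita connection\<close>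

definition form_comp :: "('m, 'n::finite) chart set \<Rightarrow> ('m \<Rightarrow> ('m, 'n) tangent \<Rightarrow> real) \<Rightarrow>
    ('m, 'n) chart \<Rightarrow> real^'n \<Rightarrow> real^'n" where
  "form_comp M b c x = (\<chi> i. b (chart_inv c x) (tvec M c (chart_inv c x) (axis i 1)))"

definition one_form :: "('m, 'n::finite) chart set \<Rightarrow> ('m \<Rightarrow> ('m, 'n) tangent \<Rightarrow> real) \<Rightarrow> bool" where
  "one_form M b \<longleftrightarrow> (\<forall>c\<in>M.
     smooth_on (form_comp M b c) (snd c ` fst c) \<and>
     (\<forall>p\<in>fst c. \<forall>w\<in>tangent_space M p. b p w = form_comp M b c (snd c p) \<bullet> w c))"

definition metric_comp :: "('m, 'n::finite) chart set \<Rightarrow>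
    ('m \<Rightarrow> ('m, 'n) tangent \<Rightarrow> ('m, 'n) tangent \<Rightarrow> real) \<Rightarrow> ('m, 'n) chart \<Rightarrow> real^'n \<Rightarrow> real^'n^'n" where
  "metric_comp M a c x = (\<chi> i j.
     a (chart_inv c x) (tvec M c (chart_inv c x) (axis i 1)) (tvec M c (chart_inv c x) (axis j 1)))"

definition pseudo_riemannian_on :: "('m::topological_space, 'n::finite) chart set \<Rightarrow> 'm set \<Rightarrow>
    ('m \<Rightarrow> ('m, 'n) tangent \<Rightarrow> ('m, 'n) tangent \<Rightarrow> real) \<Rightarrow> bool" where
  "pseudo_riemannian_on M U a \<longleftrightarrow> open U \<and> (\<forall>c\<in>M.
     smooth_on (metric_comp M a c) (snd c ` (U \<inter> fst c)) \<and>
     (\<forall>p\<in>U \<inter> fst c.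
        (\<forall>v\<in>tangent_space M p. \<forall>w\<in>tangent_space M p.
           a p v w = v c \<bullet> (metric_comp M a c (snd c p) *v w c)) \<and>
        transpose (metric_comp M a c (snd c p)) = metric_comp M a c (snd c p) \<and>
        invertible (metric_comp M a c (snd c p))))"

text \<open>\<open>b\<^sup>i = a\<^sup>i\<^sup>j b\<^sub>j\<close> and \<open>|b|\<^sup>2 = a\<^sub>i\<^sub>j b\<^sup>i b\<^sup>j\<close>, at coordinates \<open>x\<close> in the chart \<open>c\<close>.\<close>

definition form_raised where
  "form_raised M a b c x = matrix_inv (metric_comp M a c x) *v form_comp M b c x"

definition form_normsq where
  "form_normsq M a b c x =
     form_raised M a b c x \<bullet> (metric_comp M a c x *v form_raised M a b c x)"

text \<open>Affine connections are given by their Christoffel symbols in all charts: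
  \<open>\<Gamma> c x k i j\<close> is the symbol with upper index \<open>k\<close> and lower indices \<open>i j\<close>. The
  Levi-Civita connection is the torsion-free one for which the metric is parallel.\<close>

type_synonym ('m, 'n) christoffel = "('m, 'n) chart \<Rightarrow> real^'n \<Rightarrow> 'n \<Rightarrow> 'n \<Rightarrow> 'n \<Rightarrow> real"

definition levi_civita_on :: "('m, 'n::finite) chart set \<Rightarrow> 'm set \<Rightarrow>
    ('m \<Rightarrow> ('m, 'n) tangent \<Rightarrow> ('m, 'n) tangent \<Rightarrow> real) \<Rightarrow> ('m, 'n) christoffel \<Rightarrow> bool" where
  "levi_civita_on M U g \<Gamma> \<longleftrightarrow> (\<forall>c\<in>M. \<forall>x \<in> snd c ` (U \<inter> fst c). \<forall>i j k.
     \<Gamma> c x k i j = \<Gamma> c x k j i \<and>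
     pd k (\<lambda>x'. metric_comp M g c x' $ i $ j) x
       - (\<Sum>l\<in>UNIV. \<Gamma> c x l k i * metric_comp M g c x $ l $ j)
       - (\<Sum>l\<in>UNIV. \<Gamma> c x l k j * metric_comp M g c x $ i $ l) = 0)"

section \<open>Finsler metrics\<close>

definition conic_subbundle :: "('m, 'n::finite) chart set \<Rightarrow> ('m \<times> ('m, 'n) tangent) set \<Rightarrow> bool" where
  "conic_subbundle M A \<longleftrightarrow>
     A \<subseteq> tangent_bundle M \<and> (\<forall>c\<in>M. open (TM_coords c A)) \<and> fst ` A = UNIV \<and>
     (\<forall>p w. \<forall>t>0. (p, w) \<in> A \<longrightarrow> (p, \<lambda>c. t *\<^sub>R w c) \<in> A)"

definition fundamental_tensor :: "((real^'n::finite) \<times> (real^'n) \<Rightarrow> real) \<Rightarrow> (real^'n) \<times> (real^'n) \<Rightarrow> real^'n^'n" where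
  "fundamental_tensor L z = (\<chi> i j. 1/2 * pdy i (pdy j L) z)"

definition finsler_metric :: "('m, 'n::finite) chart set \<Rightarrow> ('m \<times> ('m, 'n) tangent) set \<Rightarrow>
    ('m \<times> ('m, 'n) tangent \<Rightarrow> real) \<Rightarrow> bool" where
  "finsler_metric M A F \<longleftrightarrow> conic_subbundle M A \<and>
     (\<forall>c\<in>M. smooth_on (coord_rep M c F) (TM_coords c A)) \<and>
     (\<forall>p w. \<forall>t>0. (p, w) \<in> A \<longrightarrow> F (p, \<lambda>c. t *\<^sub>R w c) = t * F (p, w)) \<and>
     (\<forall>c\<in>M. \<forall>z\<in>TM_coords c A. invertible (fundamental_tensor (coord_rep M c (\<lambda>z. (F z)\<^sup>2)) z))"

definition quadratic_on :: "('m, 'n::finite) chart set \<Rightarrow> ('m \<times> ('m, 'n) tangent) set \<Rightarrow>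
    ('m \<times> ('m, 'n) tangent \<Rightarrow> real) \<Rightarrow> bool" where
  "quadratic_on M S L \<longleftrightarrow> (\<forall>c\<in>M. \<forall>p\<in>fst c. \<exists>Q :: real^'n^'n. \<forall>w.
     (p, w) \<in> S \<longrightarrow> L (p, w) = w c \<bullet> (Q *v w c))"

definition properly_finslerian :: "('m, 'n::finite) chart set \<Rightarrow> ('m \<times> ('m, 'n) tangent) set \<Rightarrow>
    ('m \<times> ('m, 'n) tangent \<Rightarrow> real) \<Rightarrow> bool" where
  "properly_finslerian M A F \<longleftrightarrow>
     \<not> (\<exists>\<S>. finite \<S> \<and> \<Union>\<S> = A \<and> (\<forall>S\<in>\<S>. quadratic_on M S (\<lambda>z. (F z)\<^sup>2)))"

text \<open>\<open>nonlinear_conn L j i\<close> is the coefficient with upper index \<open>j\<close> and lower index \<open>i\<close> of the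
  canonical nonlinear connection.\<close>

definition nonlinear_conn :: "((real^'n::finite) \<times> (real^'n) \<Rightarrow> real) \<Rightarrow> 'n \<Rightarrow> 'n \<Rightarrow>
    (real^'n) \<times> (real^'n) \<Rightarrow> real" where
  "nonlinear_conn L j i z = 1/4 * pdy i (\<lambda>z'. \<Sum>k\<in>UNIV.
     matrix_inv (fundamental_tensor L z') $ j $ k *
       ((\<Sum>l\<in>UNIV. snd z' $ l * pdx l (pdy k L) z') - pdx k L z')) z"

text \<open>\<open>affine_connection_of M A F \<Gamma>\<close> determines \<open>\<Gamma> c x\<close> uniquely for all \<open>x\<close> in the image of the
  chart \<open>c\<close>, since the fibres of \<open>A\<close> are open and nonempty.\<close>

definition affine_connection_of :: "('m, 'n::finite) chart set \<Rightarrow> ('m \<times> ('m, 'n) tangent) set \<Rightarrow>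
    ('m \<times> ('m, 'n) tangent \<Rightarrow> real) \<Rightarrow> ('m, 'n) christoffel \<Rightarrow> bool" where
  "affine_connection_of M A F \<Gamma> \<longleftrightarrow> (\<forall>c\<in>M. \<forall>(x, y)\<in>TM_coords c A. \<forall>k i.
     nonlinear_conn (coord_rep M c (\<lambda>z. (F z)\<^sup>2)) k i (x, y) = (\<Sum>j\<in>UNIV. \<Gamma> c x k i j * y $ j))"

definition berwald :: "('m, 'n::finite) chart set \<Rightarrow> ('m \<times> ('m, 'n) tangent) set \<Rightarrow>
    ('m \<times> ('m, 'n) tangent \<Rightarrow> real) \<Rightarrow> bool" where
  "berwald M A F \<longleftrightarrow> (\<exists>\<Gamma>. affine_connection_of M A F \<Gamma>)"

definition local_metrization :: "('m::topological_space, 'n::finite) chart set \<Rightarrow> ('m \<times> ('m, 'n) tangent) set \<Rightarrow>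
    ('m \<times> ('m, 'n) tangent \<Rightarrow> real) \<Rightarrow> 'm set \<Rightarrow>
    ('m \<Rightarrow> ('m, 'n) tangent \<Rightarrow> ('m, 'n) tangent \<Rightarrow> real) \<Rightarrow> bool" where
  "local_metrization M A F U g \<longleftrightarrow> pseudo_riemannian_on M U g \<and>
     (\<exists>\<Gamma>. affine_connection_of M A F \<Gamma> \<and> levi_civita_on M U g \<Gamma>)"

definition locally_metrizable :: "('m::topological_space, 'n::finite) chart set \<Rightarrow> ('m \<times> ('m, 'n) tangent) set \<Rightarrow>
    ('m \<times> ('m, 'n) tangent \<Rightarrow> real) \<Rightarrow> bool" where
  "locally_metrizable M A F \<longleftrightarrow> (\<forall>p. \<exists>U g. p \<in> U \<and> local_metrization M A F U g)"

definition m_kropina :: "('m, 'n::finite) chart set \<Rightarrow> ('m \<times> ('m, 'n) tangent) set \<Rightarrow>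
    ('m \<Rightarrow> ('m, 'n) tangent \<Rightarrow> ('m, 'n) tangent \<Rightarrow> real) \<Rightarrow> ('m \<Rightarrow> ('m, 'n) tangent \<Rightarrow> real) \<Rightarrow>
    real \<Rightarrow> ('m \<times> ('m, 'n) tangent \<Rightarrow> real) \<Rightarrow> bool" where
  "m_kropina M A a b m F \<longleftrightarrow> finsler_metric M A F \<and>
     (\<forall>(p, w)\<in>A. sqrt \<bar>a p w w\<bar> \<noteq> 0 \<and> b p w > 0 \<and>
        F (p, w) = sqrt \<bar>a p w w\<bar> powr (1 + m) * b p w powr (- m))"

section \<open>The adapted coordinate form\<close>

text \<open>\<open>dx2 i j\<close> is the symmetrized product \<open>dx\<^sup>i dx\<^sup>j\<close>. The coordinates \<open>u\<close> and \<open>v\<close> occupy two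
  distinct slots \<open>iu\<close> and \<open>iv\<close> of the index type; the other slots are the coordinates \<open>x\<^sup>a\<close>.\<close>

definition dx2 :: "'n::finite \<Rightarrow> 'n \<Rightarrow> real^'n \<Rightarrow> real^'n \<Rightarrow> real" where
  "dx2 i j y z = (y $ i * z $ j + y $ j * z $ i) / 2"

definition wave_metric :: "'n::finite \<Rightarrow> 'n \<Rightarrow> (real^'n \<Rightarrow> real) \<Rightarrow> (real^'n \<Rightarrow> 'n \<Rightarrow> real) \<Rightarrow>
    (real^'n \<Rightarrow> 'n \<Rightarrow> 'n \<Rightarrow> real) \<Rightarrow> real^'n \<Rightarrow> real^'n \<Rightarrow> real^'n \<Rightarrow> real" where
  "wave_metric iu iv H W h x y z =
     - 2 * dx2 iu iv y z + H x * dx2 iu iu y z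
     + 2 * (\<Sum>a\<in>-{iu, iv}. W x a * dx2 iu a y z)
     + (\<Sum>a\<in>-{iu, iv}. \<Sum>b\<in>-{iu, iv}. h x a b * dx2 a b y z)"

definition independent_of_on :: "'n::finite \<Rightarrow> (real^'n) set \<Rightarrow> (real^'n \<Rightarrow> real) \<Rightarrow> bool" where
  "independent_of_on i S f \<longleftrightarrow>
     (\<forall>x\<in>S. \<forall>x'\<in>S. (\<forall>j. j \<noteq> i \<longrightarrow> x $ j = x' $ j) \<longrightarrow> f x = f x')"

definition adapted_coordinates :: "('m, 'n::finite) chart set \<Rightarrow>
    ('m \<Rightarrow> ('m, 'n) tangent \<Rightarrow> ('m, 'n) tangent \<Rightarrow> real) \<Rightarrow> ('m \<Rightarrow> ('m, 'n) tangent \<Rightarrow> real) \<Rightarrow>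
    real \<Rightarrow> 'n \<Rightarrow> 'n \<Rightarrow> ('m, 'n) chart \<Rightarrow> (real^'n \<Rightarrow> real) \<Rightarrow>
    (real^'n \<Rightarrow> real) \<Rightarrow> (real^'n \<Rightarrow> 'n \<Rightarrow> real) \<Rightarrow> (real^'n \<Rightarrow> 'n \<Rightarrow> 'n \<Rightarrow> real) \<Rightarrow> bool" where
  "adapted_coordinates M a b m iu iv c \<psi> H W h \<longleftrightarrow> c \<in> M \<and>
     smooth_on \<psi> (snd c ` fst c) \<and>
     smooth_on H (snd c ` fst c) \<and> independent_of_on iv (snd c ` fst c) H \<and>
     (\<forall>i\<in>-{iu, iv}. smooth_on (\<lambda>x. W x i) (snd c ` fst c) \<and>
        independent_of_on iv (snd c ` fst c) (\<lambda>x. W x i)) \<and>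
     (\<forall>i\<in>-{iu, iv}. \<forall>j\<in>-{iu, iv}. smooth_on (\<lambda>x. h x i j) (snd c ` fst c) \<and>
        independent_of_on iv (snd c ` fst c) (\<lambda>x. h x i j) \<and>
        (\<forall>x \<in> snd c ` fst c. h x i j = h x j i)) \<and>
     (\<forall>p\<in>fst c. \<forall>v\<in>tangent_space M p. \<forall>w\<in>tangent_space M p.
        a p v w = exp (2 * m * \<psi> (snd c p)) * wave_metric iu iv H W h (snd c p) (v c) (w c)) \<and>
     (\<forall>p\<in>fst c. \<forall>w\<in>tangent_space M p.
        b p w = exp ((1 + m) * \<psi> (snd c p)) * w c $ iu)"

end

theory Submission
  imports Defs
begin

text \<open>Since \<open>F\<close> is of Berwald type, \<open>L = F\<^sup>2 = |a(y, y)|\<^sup>1\<^sup>+\<^sup>m b(y)\<^sup>-\<^sup>2\<^sup>m\<close> is constant along the horizontal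
  lift of its torsion-free affine connection \<open>\<nabla>\<close>, and \<open>\<nabla>\<close> is the only torsion-free connection with
  this property. Comparing polynomials in \<open>y\<close>, this constancy says \<open>\<nabla>a = 2m f \<otimes> a\<close> and
  \<open>\<nabla>b = (1 + m) f \<otimes> b\<close> for some 1-form \<open>f\<close>. If also \<open>\<nabla>g = 0\<close> for a metric \<open>g\<close>, taking traces gives
  \<open>f = d\<psi>\<close> with \<open>\<psi> = ln |det a / det g| / (2mn)\<close>, so \<open>e\<^sup>-\<^sup>2\<^sup>m\<^sup>\<psi> a\<close> and \<open>e\<^sup>-\<^sup>(\<^sup>1\<^sup>+\<^sup>m\<^sup>)\<^sup>\<psi> b\<close> are parallel. The
  latter is then closed, locally \<open>du\<close>, and its dual vector field \<open>V\<close> with respect to the former is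
  parallel and null. Straightening \<open>-V\<close> to \<open>\<partial>/\<partial>v\<close>, with \<open>u\<close> kept as a coordinate, yields the adapted
  coordinates; the coefficients do not depend on \<open>v\<close> because \<open>V\<close> is a Killing field. Conversely, in adapted
  coordinates the Levi-Civita connection of the wave metric preserves the wave metric and \<open>du\<close>,
  hence \<open>L\<close>, so by uniqueness it is \<open>\<nabla>\<close>.\<close>

section \<open>Calculus of smooth functions\<close>

text \<open>Constancy of \<open>L\<close> along the horizontal lift reads (1 + m) (\<nabla>a)(y, y)
  b(y) = 2m a(y, y) (\<nabla>b)(y), known at first only for y in the open fibres of
  \<open>A\<close>. The left side vanishes on the hyperplane b(y) = 0; if \<nabla>b did not, that
  hyperplane would be totally isotropic for a, which for a nondegenerate a forces n - 1 \<le> 1.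
  This is where n > 2 enters. Proper Finslerianness enters through m \<noteq> 0 and m \<noteq> -1,
  the exponents for which \<open>L\<close> is |a(y, y)| or the square of b(y). Nullness of b says
  that V(u) = 0, so u is constant on the integral curves of V and can stay a coordinate while V is
  straightened. Straightening needs a flow that depends smoothly on its initial point; this accounts
  for the long analytic part. The transformation law of the nonlinear connection is never computed:
  uniqueness of a torsion-free connection preserving \<open>L\<close> also yields how its symbols
  change between charts.\<close>

lemma frechet_derivative_eqI: "(f has_derivative f') (at x) \<Longrightarrow> frechet_derivative f (at x) = f'"
  by (rule frechet_derivative_at[symmetric])

text \<open>No differentiability is assumed: the two functions have the same derivatives at
  \<open>x\<close>, so the choice operator inside \<open>frechet_derivative\<close> returns the same
  value even where there is none.\<close>

lemma frechet_derivative_cong_open: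
  assumes "open S" "x \<in> S" "\<And>y. y \<in> S \<Longrightarrow> f y = g y"
  shows "frechet_derivative f (at x) = frechet_derivative g (at x)"
proof -
  have "(f has_derivative D) (at x) \<longleftrightarrow> (g has_derivative D) (at x)" for D
    using assms has_derivative_transform_within_open[of f D x UNIV S g]
      has_derivative_transform_within_open[of g D x UNIV S f] by auto
  then show ?thesis by (simp add: frechet_derivative_def)
qed

lemma differentiable_cong_open:
  assumes "open S" "x \<in> S" "\<And>y. y \<in> S \<Longrightarrow> f y = g y" "f differentiable (at x)"
  shows "g differentiable (at x)"
  using assms has_derivative_transform_within_open[of f _ x UNIV S g]
  by (auto simp: differentiable_def)

lemma differentiable_frechetD:
  "f differentiable (at x) \<Longrightarrow> (f has_derivative frechet_derivative f (at x)) (at x)"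
  by (simp add: frechet_derivative_works)

lemma Ck_on_cong:
  assumes "open S" "\<And>x. x \<in> S \<Longrightarrow> f x = g x" "Ck_on k f S"
  shows "Ck_on k g S"
  using assms(2,3)
proof (induction k arbitrary: f g)
  case 0
  then show ?case by (simp cong: continuous_on_cong)
next
  case (Suc k)
  have "g differentiable (at x)" if "x \<in> S" for x
    using Suc.prems that differentiable_cong_open[OF assms(1) that, of f g] by simp
  moreover have "Ck_on k (\<lambda>x. frechet_derivative g (at x) v) S" for v
  proof (rule Suc.IH)
    show "frechet_derivative f (at x) v = frechet_derivative g (at x) v" if "x \<in> S" for x
      using frechet_derivative_cong_open[OF assms(1) that Suc.prems(1)] by simp
    show "Ck_on k (\<lambda>x. frechet_derivative f (at x) v) S" using Suc.prems(2) by simp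
  qed
  ultimately show ?case by simp
qed

text \<open>The recursion of \<open>Ck_on\<close> speaks of \<open>frechet_derivative\<close>; this
  rule lets a proof supply an explicit formula for the derivative instead.\<close>

lemma Ck_on_SucI:
  assumes "open S" "\<And>x. x \<in> S \<Longrightarrow> (f has_derivative f' x) (at x)"
    and "\<And>v. Ck_on k (\<lambda>x. f' x v) S"
  shows "Ck_on (Suc k) f S"
proof -
  have "Ck_on k (\<lambda>x. frechet_derivative f (at x) v) S" for v
    by (rule Ck_on_cong[OF assms(1) _ assms(3)[of v]])
      (metis assms(2) frechet_derivative_eqI)
  then show ?thesis using assms(2) by (auto simp: differentiable_def)
qed

lemma Ck_on_subset: "Ck_on k f S \<Longrightarrow> T \<subseteq> S \<Longrightarrow> Ck_on k f T"
  by (induction k arbitrary: f) (auto intro: continuous_on_subset)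

lemma Ck_on_Suc_imp: "Ck_on (Suc k) f S \<Longrightarrow> Ck_on k f S"
proof (induction k arbitrary: f)
  case 0
  then show ?case
    by (auto intro!: continuous_at_imp_continuous_on differentiable_imp_continuous_within)
next
  case (Suc k)
  then show ?case by simp
qed

lemma Ck_on_le: "Ck_on k f S \<Longrightarrow> j \<le> k \<Longrightarrow> Ck_on j f S"
  by (induction k) (auto simp: le_Suc_eq simp del: Ck_on.simps dest: Ck_on_Suc_imp)

lemma Ck_on_continuous: "Ck_on k f S \<Longrightarrow> continuous_on S f"
  using Ck_on_le[of k f S 0] by simp

text \<open>Locality of \<open>Ck_on\<close>. It turns the continuity of parameter derivatives,
  obtained only near each point, into continuity on the whole domain.\<close>

lemma Ck_on_open_cover:
  assumes "\<And>x. x \<in> S \<Longrightarrow> \<exists>T. open T \<and> x \<in> T \<and> Ck_on k f (S \<inter> T)"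
  shows "Ck_on k f S"
  using assms
proof (induction k arbitrary: f)
  case 0
  show ?case unfolding Ck_on.simps continuous_on_eq_continuous_within
  proof
    fix x assume "x \<in> S"
    then obtain T where "open T" "x \<in> T" "continuous_on (S \<inter> T) f" using 0[of x] by auto
    then show "continuous (at x within S) f"
      using at_within_nhd[of x T S "S \<inter> T"] \<open>x \<in> S\<close>
      by (auto simp: continuous_on_eq_continuous_within)
  qed
next
  case (Suc k)
  have "f differentiable (at x)" if "x \<in> S" for x
    using Suc.prems[OF that] that by auto
  moreover have "Ck_on k (\<lambda>x. frechet_derivative f (at x) v) S" for v
  proof (rule Suc.IH)
    fix x assume "x \<in> S"
    from Suc.prems[OF this] show "\<exists>T. open T \<and> x \<in> T \<and> Ck_on k (\<lambda>x. frechet_derivative f (at x) v) (S \<inter> T)"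
      by auto
  qed
  ultimately show ?case by simp
qed

lemma Ck_on_const [simp]: "Ck_on k (\<lambda>x. c) S"
  by (induction k arbitrary: c) (auto simp: frechet_derivative_const)

lemma Ck_on_bounded_linear_compose:
  assumes "open S" "bounded_linear h" "Ck_on k f S"
  shows "Ck_on k (\<lambda>x. h (f x)) S"
  using assms(3)
proof (induction k arbitrary: f)
  case 0
  then show ?case using assms(2) by (simp add: bounded_linear.continuous_on)
next
  case (Suc k)
  show ?case
  proof (rule Ck_on_SucI[OF assms(1)])
    show "((\<lambda>x. h (f x)) has_derivative (\<lambda>v. h (frechet_derivative f (at x) v))) (at x)" if "x \<in> S" for x
      using Suc.prems that bounded_linear.has_derivative[OF assms(2) differentiable_frechetD] by auto
    show "Ck_on k (\<lambda>x. h (frechet_derivative f (at x) v)) S" for v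
      using Suc by simp
  qed
qed

lemma Ck_on_ident [simp]: "open S \<Longrightarrow> Ck_on k (\<lambda>x. x) S"
  by (cases k) (auto intro!: Ck_on_SucI[where f' = "\<lambda>x v. v"] simp del: Ck_on.simps(2) simp: continuous_on_id)

lemma Ck_on_bounded_linear: "open S \<Longrightarrow> bounded_linear h \<Longrightarrow> Ck_on k h S"
  using Ck_on_bounded_linear_compose[of S h k "\<lambda>x. x"] by simp

lemma Ck_on_add:
  assumes "open S" "Ck_on k f S" "Ck_on k g S"
  shows "Ck_on k (\<lambda>x. f x + g x) S"
  using assms(2,3)
proof (induction k arbitrary: f g)
  case 0
  then show ?case by (simp add: continuous_on_add)
next
  case (Suc k)
  show ?case
  proof (rule Ck_on_SucI[OF assms(1)])
    show "((\<lambda>x. f x + g x) has_derivative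
       (\<lambda>v. frechet_derivative f (at x) v + frechet_derivative g (at x) v)) (at x)" if "x \<in> S" for x
      using Suc.prems that by (auto intro!: has_derivative_add differentiable_frechetD)
  qed (use Suc in simp)
qed

text \<open>The product rule returns a sum of two products of the same kind, so one induction covers
  multiplication, scaling and inner products.\<close>

lemma Ck_on_bounded_bilinear:
  assumes "open S" "bounded_bilinear pr" "Ck_on k f S" "Ck_on k g S"
  shows "Ck_on k (\<lambda>x. pr (f x) (g x)) S"
  using assms(3,4)
proof (induction k arbitrary: f g)
  case 0
  then show ?case using assms(2) by (simp add: bounded_bilinear.continuous_on)
next
  case (Suc k)
  show ?case
  proof (rule Ck_on_SucI[OF assms(1)])
    show "((\<lambda>x. pr (f x) (g x)) has_derivative
       (\<lambda>v. pr (f x) (frechet_derivative g (at x) v) + pr (frechet_derivative f (at x) v) (g x))) (at x)"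
      if "x \<in> S" for x
      using Suc.prems that
      by (auto intro!: bounded_bilinear.FDERIV[OF assms(2)] differentiable_frechetD)
    show "Ck_on k (\<lambda>x. pr (f x) (frechet_derivative g (at x) v) + pr (frechet_derivative f (at x) v) (g x)) S" for v
      using Suc.prems by (intro Ck_on_add assms Suc.IH) (auto dest: Ck_on_Suc_imp simp del: Ck_on.simps(2), auto)
  qed
qed

lemma Ck_on_sum:
  assumes "open S" "\<And>i. i \<in> I \<Longrightarrow> Ck_on k (f i) S"
  shows "Ck_on k (\<lambda>x. \<Sum>i\<in>I. f i x) S"
  using assms by (induction I rule: infinite_finite_induct) (auto intro: Ck_on_add)

text \<open>The chain rule gives the derivative \<open>?Df (?Dg v)\<close>, whose direction varies
  with \<open>x\<close>. Expanding in a basis leaves sums of products of a component of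
  \<open>?Dg v\<close> with \<open>?Df b\<close> for fixed \<open>b\<close>, to which the induction
  hypothesis and the product rule apply.\<close>

lemma Ck_on_compose:
  fixes f :: "'b::euclidean_space \<Rightarrow> 'c::real_normed_vector"
  assumes "open S" "Ck_on k g S" "Ck_on k f T" "g ` S \<subseteq> T"
  shows "Ck_on k (\<lambda>x. f (g x)) S"
  using assms(2,3)
proof (induction k arbitrary: f)
  case 0
  then show ?case using assms(4) by (auto intro: continuous_on_compose2)
next
  case (Suc k)
  show ?case
  proof (rule Ck_on_SucI[OF assms(1)])
    fix x assume x: "x \<in> S"
    let ?Df = "frechet_derivative f (at (g x))" and ?Dg = "frechet_derivative g (at x)"
    have Df: "(f has_derivative ?Df) (at (g x))" and Dg: "(g has_derivative ?Dg) (at x)"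
      using Suc.prems x assms(4) by (auto intro!: differentiable_frechetD)
    have "?Df (?Dg v) = (\<Sum>b\<in>Basis. (?Dg v \<bullet> b) *\<^sub>R ?Df b)" for v
    proof -
      have "?Df (?Dg v) = ?Df (\<Sum>b\<in>Basis. (?Dg v \<bullet> b) *\<^sub>R b)" by (simp add: euclidean_representation)
      also have "\<dots> = (\<Sum>b\<in>Basis. (?Dg v \<bullet> b) *\<^sub>R ?Df b)"
        using has_derivative_linear[OF Df] by (simp add: linear_sum linear_scale)
      finally show ?thesis .
    qed
    moreover have "((\<lambda>x. f (g x)) has_derivative (\<lambda>v. ?Df (?Dg v))) (at x)"
      by (rule has_derivative_compose[OF Dg Df])
    ultimately show "((\<lambda>x. f (g x)) has_derivative (\<lambda>v. \<Sum>b\<in>Basis. (?Dg v \<bullet> b) *\<^sub>R ?Df b)) (at x)"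
      by simp
  next
    fix v
    have "Ck_on k (\<lambda>x. frechet_derivative g (at x) v \<bullet> b) S" for b
      using Suc.prems(1) by (intro Ck_on_bounded_linear_compose[OF assms(1) bounded_linear_inner_left]) simp
    moreover have "Ck_on k (\<lambda>x. frechet_derivative f (at (g x)) b) S" for b
      using Suc.IH[of "\<lambda>y. frechet_derivative f (at y) b"] Suc.prems Ck_on_Suc_imp by auto
    ultimately show "Ck_on k (\<lambda>x. \<Sum>b\<in>Basis. (frechet_derivative g (at x) v \<bullet> b) *\<^sub>R frechet_derivative f (at (g x)) b) S"
      by (intro Ck_on_sum Ck_on_bounded_bilinear[OF assms(1) bounded_bilinear_scaleR] assms(1))
  qed
qed

lemma Ck_on_Pair:
  assumes "open S" "Ck_on k f S" "Ck_on k g S"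
  shows "Ck_on k (\<lambda>x. (f x, g x)) S"
proof -
  have "Ck_on k (\<lambda>x. (f x, 0) + (0, g x)) S"
    by (intro Ck_on_add assms(1) Ck_on_bounded_linear_compose[OF assms(1) bounded_linear_Pair[OF bounded_linear_ident bounded_linear_zero]]
       Ck_on_bounded_linear_compose[OF assms(1) bounded_linear_Pair[OF bounded_linear_zero bounded_linear_ident]] assms(2,3))
  then show ?thesis by simp
qed

lemma Ck_on_componentwise:
  fixes f :: "'a::real_normed_vector \<Rightarrow> 'b::euclidean_space"
  assumes "open S" "\<And>b. b \<in> Basis \<Longrightarrow> Ck_on k (\<lambda>x. f x \<bullet> b) S"
  shows "Ck_on k f S"
proof -
  have "Ck_on k (\<lambda>x. \<Sum>b\<in>Basis. (f x \<bullet> b) *\<^sub>R b) S"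
    by (intro Ck_on_sum Ck_on_bounded_linear_compose[OF assms(1) bounded_linear_scaleR_left] assms)
  then show ?thesis by (simp add: euclidean_representation)
qed

subsection \<open>Smoothness\<close>

lemma smooth_onD: "smooth_on f S \<Longrightarrow> Ck_on k f S" by (simp add: smooth_on_def)

lemma smooth_on_differentiable: "smooth_on f S \<Longrightarrow> x \<in> S \<Longrightarrow> f differentiable (at x)"
  by (metis Ck_on.simps(2) smooth_on_def)

lemma smooth_on_has_derivative:
  "smooth_on f S \<Longrightarrow> x \<in> S \<Longrightarrow> (f has_derivative frechet_derivative f (at x)) (at x)"
  by (intro differentiable_frechetD smooth_on_differentiable)

lemma smooth_on_frechet: "smooth_on f S \<Longrightarrow> smooth_on (\<lambda>x. frechet_derivative f (at x) v) S"
  by (metis Ck_on.simps(2) smooth_on_def)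

lemma smooth_on_continuous: "smooth_on f S \<Longrightarrow> continuous_on S f"
  using smooth_onD[of f S 0] by simp

lemma smooth_on_cong: "open S \<Longrightarrow> (\<And>x. x \<in> S \<Longrightarrow> f x = g x) \<Longrightarrow> smooth_on f S \<Longrightarrow> smooth_on g S"
  unfolding smooth_on_def using Ck_on_cong by blast

lemma smooth_on_subset: "smooth_on f S \<Longrightarrow> T \<subseteq> S \<Longrightarrow> smooth_on f T"
  unfolding smooth_on_def using Ck_on_subset by blast

lemma smooth_on_derivI:
  assumes "open S" "\<And>x. x \<in> S \<Longrightarrow> (f has_derivative f' x) (at x)" "\<And>v. smooth_on (\<lambda>x. f' x v) S"
  shows "smooth_on f S"
  unfolding smooth_on_def
proof
  fix k show "Ck_on k f S"
    by (rule Ck_on_Suc_imp, rule Ck_on_SucI[OF assms(1,2)]) (use assms(3) in \<open>auto simp: smooth_on_def\<close>)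
qed

lemma smooth_on_const [simp]: "smooth_on (\<lambda>x. c) S" by (simp add: smooth_on_def)
lemma smooth_on_add: "open S \<Longrightarrow> smooth_on f S \<Longrightarrow> smooth_on g S \<Longrightarrow> smooth_on (\<lambda>x. f x + g x) S"
  by (simp add: smooth_on_def Ck_on_add)
lemma smooth_on_bounded_linear_compose:
  "open S \<Longrightarrow> bounded_linear h \<Longrightarrow> smooth_on f S \<Longrightarrow> smooth_on (\<lambda>x. h (f x)) S"
  by (simp add: smooth_on_def Ck_on_bounded_linear_compose)
lemma smooth_on_bounded_linear: "open S \<Longrightarrow> bounded_linear h \<Longrightarrow> smooth_on h S"
  by (simp add: smooth_on_def Ck_on_bounded_linear)
lemma smooth_on_bounded_bilinear:
  "open S \<Longrightarrow> bounded_bilinear pr \<Longrightarrow> smooth_on f S \<Longrightarrow> smooth_on g S \<Longrightarrow> smooth_on (\<lambda>x. pr (f x) (g x)) S"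
  by (simp add: smooth_on_def Ck_on_bounded_bilinear)
lemmas smooth_on_mult = smooth_on_bounded_bilinear[OF _ bounded_bilinear_mult]
lemmas smooth_on_scaleR = smooth_on_bounded_bilinear[OF _ bounded_bilinear_scaleR]
lemmas smooth_on_inner = smooth_on_bounded_bilinear[OF _ bounded_bilinear_inner]
lemma smooth_on_minus: "open S \<Longrightarrow> smooth_on f S \<Longrightarrow> smooth_on (\<lambda>x. - f x) S"
  by (rule smooth_on_bounded_linear_compose[OF _ bounded_linear_minus[OF bounded_linear_ident]])
lemma smooth_on_diff: "open S \<Longrightarrow> smooth_on f S \<Longrightarrow> smooth_on g S \<Longrightarrow> smooth_on (\<lambda>x. f x - g x) S"
  using smooth_on_add[OF _ _ smooth_on_minus, of S f g] by simp
lemma smooth_on_sum: "open S \<Longrightarrow> (\<And>i. i \<in> I \<Longrightarrow> smooth_on (f i) S) \<Longrightarrow> smooth_on (\<lambda>x. \<Sum>i\<in>I. f i x) S"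
  by (simp add: smooth_on_def Ck_on_sum)
lemma smooth_on_compose:
  fixes f :: "'b::euclidean_space \<Rightarrow> 'c::real_normed_vector"
  shows "open S \<Longrightarrow> smooth_on g S \<Longrightarrow> smooth_on f T \<Longrightarrow> g ` S \<subseteq> T \<Longrightarrow> smooth_on (\<lambda>x. f (g x)) S"
  unfolding smooth_on_def using Ck_on_compose by blast
lemma smooth_on_Pair: "open S \<Longrightarrow> smooth_on f S \<Longrightarrow> smooth_on g S \<Longrightarrow> smooth_on (\<lambda>x. (f x, g x)) S"
  by (simp add: smooth_on_def Ck_on_Pair)
lemma smooth_on_prod:
  fixes f :: "'i \<Rightarrow> 'a::real_normed_vector \<Rightarrow> real"
  shows "open S \<Longrightarrow> (\<And>i. i \<in> I \<Longrightarrow> smooth_on (f i) S) \<Longrightarrow> smooth_on (\<lambda>x. \<Prod>i\<in>I. f i x) S"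
  by (induction I rule: infinite_finite_induct) (auto intro: smooth_on_mult)
lemma smooth_on_componentwise:
  fixes f :: "'a::real_normed_vector \<Rightarrow> 'b::euclidean_space"
  shows "open S \<Longrightarrow> (\<And>b. b \<in> Basis \<Longrightarrow> smooth_on (\<lambda>x. f x \<bullet> b) S) \<Longrightarrow> smooth_on f S"
  unfolding smooth_on_def using Ck_on_componentwise by blast
lemma smooth_on_vec:
  fixes f :: "'a::real_normed_vector \<Rightarrow> real^'n::finite"
  shows "open S \<Longrightarrow> (\<And>i. smooth_on (\<lambda>x. f x $ i) S) \<Longrightarrow> smooth_on f S"
  by (rule smooth_on_componentwise) (auto simp: Basis_vec_def inner_axis)
lemma smooth_on_mat:
  fixes f :: "'a::real_normed_vector \<Rightarrow> real^'n::finite^'k::finite"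
  shows "open S \<Longrightarrow> (\<And>i j. smooth_on (\<lambda>x. f x $ i $ j) S) \<Longrightarrow> smooth_on f S"
  by (rule smooth_on_componentwise) (auto simp: Basis_vec_def inner_axis)
lemma smooth_on_vec_nth: "open S \<Longrightarrow> smooth_on f S \<Longrightarrow> smooth_on (\<lambda>x. f x $ i) S"
  by (rule smooth_on_bounded_linear_compose[OF _ bounded_linear_vec_nth])

section \<open>Smoothness of elementary functions, determinants and inverse matrices\<close>

lemma smooth_on_exp: "smooth_on (exp :: real \<Rightarrow> real) UNIV"
proof -
  \<comment> \<open>The factor \<open>c\<close> absorbs the direction \<open>v\<close> on
    differentiation, which closes the induction.\<close>
  have "Ck_on k (\<lambda>x::real. c * exp x) UNIV" for k and c :: real
  proof (induction k arbitrary: c)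
    case 0 then show ?case by (auto intro!: continuous_intros)
  next
    case (Suc k)
    have *: "(\<lambda>x. exp x * v * c) = (\<lambda>x::real. (c * v) * exp x)" for v by auto
    show ?case
      by (rule Ck_on_SucI[where f' = "\<lambda>x v. exp x * v * c"])
        (auto intro!: derivative_eq_intros, subst *, rule Suc.IH)
  qed
  from this[of _ 1] show ?thesis by (simp add: smooth_on_def)
qed

lemma smooth_on_inverse_real: "smooth_on (inverse :: real \<Rightarrow> real) (- {0})"
proof -
  have "Ck_on k (inverse :: real \<Rightarrow> real) (- {0})" for k
  proof (induction k)
    case 0 then show ?case by (auto intro!: continuous_intros)
  next
    case (Suc k)
    show ?case
    \<comment> \<open>The derivative is a product of copies of \<open>inverse\<close> itself and of
      the constant \<open>v\<close>, so the induction hypothesis covers it.\<close>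
    proof (rule Ck_on_SucI[where f' = "\<lambda>x v. - (inverse x * v * inverse x)"])
      show "Ck_on k (\<lambda>x. - (inverse x * v * inverse x)) (- {0})" for v :: real
        by (intro Ck_on_bounded_linear_compose[OF _ bounded_linear_minus[OF bounded_linear_ident]] open_Compl
              Ck_on_bounded_bilinear[OF _ bounded_bilinear_mult] Suc.IH) auto
    qed (auto intro!: has_derivative_inverse' open_Compl)
  qed
  then show ?thesis by (simp add: smooth_on_def)
qed

lemma smooth_on_inverse:
  fixes f :: "'a::real_normed_vector \<Rightarrow> real"
  shows "open S \<Longrightarrow> smooth_on f S \<Longrightarrow> (\<And>x. x \<in> S \<Longrightarrow> f x \<noteq> 0) \<Longrightarrow> smooth_on (\<lambda>x. inverse (f x)) S"
  by (rule smooth_on_compose[OF _ _ smooth_on_inverse_real]) auto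

lemma smooth_on_divide:
  fixes f :: "'a::real_normed_vector \<Rightarrow> real"
  shows "open S \<Longrightarrow> smooth_on f S \<Longrightarrow> smooth_on g S \<Longrightarrow> (\<And>x. x \<in> S \<Longrightarrow> g x \<noteq> 0) \<Longrightarrow> smooth_on (\<lambda>x. f x / g x) S"
  by (auto simp: divide_inverse intro!: smooth_on_mult smooth_on_inverse)

lemma has_derivative_ln_abs:
  fixes f :: "'a::real_normed_vector \<Rightarrow> real"
  assumes "(f has_derivative f') (at x)" "f x \<noteq> 0"
  shows "((\<lambda>x. ln \<bar>f x\<bar>) has_derivative (\<lambda>v. f' v / f x)) (at x)"
proof -
  \<comment> \<open>Halving ln (f f) avoids differentiating the absolute value. The result agrees
    with ln |f| also at zeros of \<open>f\<close>, since ln 0 = 0.\<close>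
  have "((\<lambda>x. ln (f x * f x) / 2) has_derivative (\<lambda>v. f' v / f x)) (at x)"
    using assms by (auto intro!: derivative_eq_intros simp: divide_simps) (auto simp: zero_less_mult_iff)
  moreover have "ln (f x * f x) / 2 = ln \<bar>f x\<bar>" for x
    using ln_mult[of "\<bar>f x\<bar>" "\<bar>f x\<bar>"] by (cases "f x = 0") (auto simp: abs_mult_self_eq)
  ultimately show ?thesis by simp
qed

lemma smooth_on_ln_abs:
  fixes f :: "'a::real_normed_vector \<Rightarrow> real"
  assumes "open S" "smooth_on f S" "\<And>x. x \<in> S \<Longrightarrow> f x \<noteq> 0"
  shows "smooth_on (\<lambda>x. ln \<bar>f x\<bar>) S"
proof (rule smooth_on_derivI[OF assms(1)])
  show "((\<lambda>x. ln \<bar>f x\<bar>) has_derivative (\<lambda>v. frechet_derivative f (at x) v / f x)) (at x)" if "x \<in> S" for x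
    using that assms by (intro has_derivative_ln_abs smooth_on_has_derivative)
  show "smooth_on (\<lambda>x. frechet_derivative f (at x) v / f x) S" for v
    using assms by (intro smooth_on_divide smooth_on_frechet)
qed

lemma smooth_on_exp_compose:
  fixes f :: "'a::real_normed_vector \<Rightarrow> real"
  shows "open S \<Longrightarrow> smooth_on f S \<Longrightarrow> smooth_on (\<lambda>x. exp (f x)) S"
  by (rule smooth_on_compose[OF _ _ smooth_on_exp]) auto

lemma smooth_on_matrix_vector_mult:
  fixes f :: "'a::real_normed_vector \<Rightarrow> real^'n^'k"
  assumes "open S" "smooth_on f S" "smooth_on g S"
  shows "smooth_on (\<lambda>x. f x *v g x) S"
proof (rule smooth_on_vec[OF assms(1)])
  fix i
  have "smooth_on (\<lambda>x. \<Sum>j\<in>UNIV. f x $ i $ j * g x $ j) S"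
    by (intro smooth_on_sum smooth_on_mult smooth_on_vec_nth[OF assms(1) smooth_on_vec_nth[OF assms(1)]]
        smooth_on_vec_nth[OF assms(1) assms(3)] assms)
  then show "smooth_on (\<lambda>x. (f x *v g x) $ i) S" by (simp add: matrix_vector_mult_def)
qed

lemma smooth_on_det:
  fixes f :: "'a::real_normed_vector \<Rightarrow> real^'n::finite^'n"
  assumes "open S" "\<And>i j. smooth_on (\<lambda>x. f x $ i $ j) S"
  shows "smooth_on (\<lambda>x. det (f x)) S"
  unfolding det_def using assms by (intro smooth_on_sum smooth_on_mult smooth_on_prod) auto

lemma matrix_inv_mult:
  fixes A :: "real^'n::finite^'n"
  assumes "invertible A"
  shows matrix_inv_right: "A ** matrix_inv A = mat 1" and matrix_inv_left: "matrix_inv A ** A = mat 1"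
proof -
  have "A ** matrix_inv A = mat 1 \<and> matrix_inv A ** A = mat 1"
    using assms unfolding matrix_inv_def invertible_def by (rule someI_ex)
  then show "A ** matrix_inv A = mat 1" "matrix_inv A ** A = mat 1" by auto
qed

text \<open>Cramer's rule writes each entry of the inverse as a quotient of two determinants whose
  denominator has no zero in \<open>S\<close>.\<close>

lemma smooth_on_matrix_inv:
  fixes f :: "'a::real_normed_vector \<Rightarrow> real^'n::finite^'n"
  assumes S: "open S" and f: "\<And>i j. smooth_on (\<lambda>x. f x $ i $ j) S" and inv: "\<And>x. x \<in> S \<Longrightarrow> invertible (f x)"
  shows "smooth_on (\<lambda>x. matrix_inv (f x)) S"
proof (rule smooth_on_mat[OF S])
  fix i j
  have det: "det (f x) \<noteq> 0" if "x \<in> S" for x using inv[OF that] by (simp add: invertible_det_nz)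
  have "smooth_on (\<lambda>x. det (\<chi> r k. if k = i then axis j 1 $ r else f x $ r $ k) / det (f x)) S"
  proof (intro smooth_on_divide smooth_on_det S f det)
    show "smooth_on (\<lambda>x. (\<chi> r k. if k = i then axis j 1 $ r else f x $ r $ k) $ r $ k) S" for r k
      by (cases "k = i") (simp_all add: f)
  qed
  moreover have "matrix_inv (f x) $ i $ j = det (\<chi> r k. if k = i then axis j 1 $ r else f x $ r $ k) / det (f x)"
    if "x \<in> S" for x
  proof -
    have "f x *v (matrix_inv (f x) *v axis j 1) = axis j 1"
      using inv[OF that] by (simp add: matrix_vector_mul_assoc matrix_inv_right)
    then have "matrix_inv (f x) *v axis j 1 =
       (\<chi> k. det (\<chi> r l. if l = k then axis j 1 $ r else f x $ r $ l) / det (f x))"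
      using cramer[OF det[OF that]] by blast
    then have "(matrix_inv (f x) *v axis j 1) $ i = det (\<chi> r k. if k = i then axis j 1 $ r else f x $ r $ k) / det (f x)"
      by simp
    then show ?thesis by (simp add: matrix_vector_mult_basis column_def)
  qed
  ultimately show "smooth_on (\<lambda>x. matrix_inv (f x) $ i $ j) S"
    using smooth_on_cong[OF S, of "\<lambda>x. det (\<chi> r k. if k = i then axis j 1 $ r else f x $ r $ k) / det (f x)"
      "\<lambda>x. matrix_inv (f x) $ i $ j"] by simp
qed

subsection \<open>Second derivatives\<close>

text \<open>Two applications of the mean value theorem: along \<open>v\<close> to the increment in
  direction \<open>w\<close>, then along \<open>w\<close> to the derivative in direction
  \<open>v\<close>.\<close>

lemma second_difference_mvt:
  fixes f :: "'a::real_normed_vector \<Rightarrow> real"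
  assumes f: "\<And>s t. 0 \<le> s \<Longrightarrow> s \<le> h \<Longrightarrow> 0 \<le> t \<Longrightarrow> t \<le> h \<Longrightarrow> f differentiable (at (x + s *\<^sub>R v + t *\<^sub>R w))"
    and f': "\<And>s t. 0 \<le> s \<Longrightarrow> s \<le> h \<Longrightarrow> 0 \<le> t \<Longrightarrow> t \<le> h \<Longrightarrow>
      (\<lambda>z. frechet_derivative f (at z) v) differentiable (at (x + s *\<^sub>R v + t *\<^sub>R w))"
    and h: "0 < h"
  shows "\<exists>s t. 0 < s \<and> s < h \<and> 0 < t \<and> t < h \<and>
    f (x + h *\<^sub>R v + h *\<^sub>R w) - f (x + h *\<^sub>R v) - f (x + h *\<^sub>R w) + f x =
    h * h * frechet_derivative (\<lambda>z. frechet_derivative f (at z) v) (at (x + s *\<^sub>R v + t *\<^sub>R w)) w"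
proof -
  let ?p = "\<lambda>s. f (x + s *\<^sub>R v + h *\<^sub>R w) - f (x + s *\<^sub>R v)"
  let ?f' = "\<lambda>z. frechet_derivative f (at z)"
  let ?f'' = "\<lambda>z. frechet_derivative (\<lambda>z. frechet_derivative f (at z) v) (at z) w"
  have dline: "((\<lambda>s. f (y + s *\<^sub>R v)) has_real_derivative ?f' (y + s *\<^sub>R v) v) (at s)"
    if "f differentiable (at (y + s *\<^sub>R v))" for y s
  proof -
    have "((\<lambda>s. y + s *\<^sub>R v) has_derivative (\<lambda>r. r *\<^sub>R v)) (at s)"
      by (auto intro!: derivative_eq_intros)
    from has_derivative_compose[OF this differentiable_frechetD[OF that]]
    show ?thesis
      by (simp add: has_field_derivative_def linear_scale[OF has_derivative_linear[OF differentiable_frechetD[OF that]]]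
        mult_commute_abs)
  qed
  have "((\<lambda>s. f (x + s *\<^sub>R v + h *\<^sub>R w) - f (x + s *\<^sub>R v)) has_real_derivative
      ?f' (x + s *\<^sub>R v + h *\<^sub>R w) v - ?f' (x + s *\<^sub>R v) v) (at s)" if "0 \<le> s" "s \<le> h" for s
    using dline[of "x + h *\<^sub>R w" s] dline[of x s] f[OF that, of h] f[OF that, of 0] h
    by (auto intro!: DERIV_diff simp: algebra_simps)
  then obtain s where s: "0 < s" "s < h" "?p h - ?p 0 = (h - 0) * (?f' (x + s *\<^sub>R v + h *\<^sub>R w) v - ?f' (x + s *\<^sub>R v) v)"
    using MVT2[OF h, of ?p "\<lambda>s. ?f' (x + s *\<^sub>R v + h *\<^sub>R w) v - ?f' (x + s *\<^sub>R v) v"] by blast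
  have "((\<lambda>t. ?f' (x + s *\<^sub>R v + t *\<^sub>R w) v) has_real_derivative ?f'' (x + s *\<^sub>R v + t *\<^sub>R w)) (at t)"
    if "0 \<le> t" "t \<le> h" for t
  proof -
    have d: "(\<lambda>z. ?f' z v) differentiable (at (x + s *\<^sub>R v + t *\<^sub>R w))"
      using f' s that by simp
    have "((\<lambda>t. x + s *\<^sub>R v + t *\<^sub>R w) has_derivative (\<lambda>r. r *\<^sub>R w)) (at t)"
      by (auto intro!: derivative_eq_intros)
    from has_derivative_compose[OF this differentiable_frechetD[OF d]]
    show ?thesis
      by (simp add: has_field_derivative_def linear_scale[OF has_derivative_linear[OF differentiable_frechetD[OF d]]]
        mult_commute_abs)
  qed
  then obtain t where "0 < t" "t < h"
    "?f' (x + s *\<^sub>R v + h *\<^sub>R w) v - ?f' (x + s *\<^sub>R v + 0 *\<^sub>R w) v = (h - 0) * ?f'' (x + s *\<^sub>R v + t *\<^sub>R w)"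
    using MVT2[OF h, of "\<lambda>t. ?f' (x + s *\<^sub>R v + t *\<^sub>R w) v" "\<lambda>t. ?f'' (x + s *\<^sub>R v + t *\<^sub>R w)"] by blast
  with s show ?thesis
    by (intro exI[of _ s] exI[of _ t]) (simp add: algebra_simps)
qed

text \<open>The second difference is symmetric in \<open>v\<close> and \<open>w\<close>, and
  \<open>second_difference_mvt\<close> expresses it by either mixed derivative at some nearby point.
  Both mixed derivatives are continuous at \<open>x\<close>, so their values there differ by less
  than any \<open>e\<close>.\<close>

lemma second_derivative_symmetric_real:
  fixes f :: "'a::real_normed_vector \<Rightarrow> real"
  assumes "open S" "x \<in> S" "Ck_on 2 f S"
  shows "frechet_derivative (\<lambda>z. frechet_derivative f (at z) v) (at x) w
       = frechet_derivative (\<lambda>z. frechet_derivative f (at z) w) (at x) v"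
proof -
  let ?F = "\<lambda>v w z. frechet_derivative (\<lambda>z. frechet_derivative f (at z) v) (at z) w"
  have C: "Ck_on (Suc (Suc 0)) f S" using assms(3) by (simp add: numeral_2_eq_2)
  have d1: "f differentiable (at z)" and d2: "(\<lambda>z. frechet_derivative f (at z) v) differentiable (at z)" if "z \<in> S" for z v
    using C that by auto
  have cont: "isCont (?F v w) x" for v w
    using C assms(1,2) by (auto simp: continuous_on_eq_continuous_at)
  have "\<bar>?F v w x - ?F w v x\<bar> \<le> e" if e: "e > 0" for e
  proof -
    obtain r1 where r1: "r1 > 0" "\<And>z. dist z x < r1 \<Longrightarrow> dist (?F v w z) (?F v w x) < e / 2"
      using cont[of v w, unfolded continuous_at_eps_delta] e by (metis half_gt_zero)
    obtain r2 where r2: "r2 > 0" "\<And>z. dist z x < r2 \<Longrightarrow> dist (?F w v z) (?F w v x) < e / 2"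
      using cont[of w v, unfolded continuous_at_eps_delta] e by (metis half_gt_zero)
    obtain r3 where r3: "r3 > 0" "ball x r3 \<subseteq> S" using assms(1,2) open_contains_ball by blast
    define r where "r = min r1 (min r2 r3)"
    \<comment> \<open>The parallelogram spanned by h v and h w stays within \<open>r\<close> of
      \<open>x\<close>; the 1 keeps the denominator positive when both vectors vanish.\<close>
    define h where "h = r / (2 * (norm v + norm w + 1))"
    have r: "r > 0" using r1 r2 r3 by (simp add: r_def)
    have h: "h > 0" using r by (auto simp: h_def intro!: divide_pos_pos add_nonneg_pos)
    have near: "dist (x + s *\<^sub>R v + t *\<^sub>R w) x < r" if "0 \<le> s" "s \<le> h" "0 \<le> t" "t \<le> h" for s t
    proof -
      have "dist (x + s *\<^sub>R v + t *\<^sub>R w) x = norm (s *\<^sub>R v + t *\<^sub>R w)"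
        by (simp add: dist_norm add.assoc)
      also have "\<dots> \<le> s * norm v + t * norm w"
        using norm_triangle_ineq[of "s *\<^sub>R v" "t *\<^sub>R w"] that by simp
      also have "\<dots> \<le> h * norm v + h * norm w" using that by (intro add_mono mult_right_mono) auto
      also have "\<dots> < h * (2 * (norm v + norm w + 1))"
        using h by (simp add: algebra_simps add_nonneg_pos)
      also have "\<dots> = r" unfolding h_def by (simp add: add_nonneg_pos less_imp_neq[symmetric])
      finally show ?thesis .
    qed
    have near': "dist (x + s *\<^sub>R w + t *\<^sub>R v) x < r" if "0 \<le> s" "s \<le> h" "0 \<le> t" "t \<le> h" for s t
      using near[of t s] that by (simp add: algebra_simps)
    have inS: "z \<in> S" if "dist z x < r" for z
      using r3 that by (auto simp: r_def dist_commute)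
    obtain s t where 1: "0 < s" "s < h" "0 < t" "t < h"
      "f (x + h *\<^sub>R v + h *\<^sub>R w) - f (x + h *\<^sub>R v) - f (x + h *\<^sub>R w) + f x = h * h * ?F v w (x + s *\<^sub>R v + t *\<^sub>R w)"
      using second_difference_mvt[of h f x v w] d1 d2 inS near h by blast
    obtain s' t' where 2: "0 < s'" "s' < h" "0 < t'" "t' < h"
      "f (x + h *\<^sub>R w + h *\<^sub>R v) - f (x + h *\<^sub>R w) - f (x + h *\<^sub>R v) + f x = h * h * ?F w v (x + s' *\<^sub>R w + t' *\<^sub>R v)"
      using second_difference_mvt[of h f x w v] d1 d2 inS near' h by blast
    have "h * h * ?F v w (x + s *\<^sub>R v + t *\<^sub>R w) = h * h * ?F w v (x + s' *\<^sub>R w + t' *\<^sub>R v)"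
      using 1(5) 2(5) by (simp add: algebra_simps)
    then have eq: "?F v w (x + s *\<^sub>R v + t *\<^sub>R w) = ?F w v (x + s' *\<^sub>R w + t' *\<^sub>R v)" using h by simp
    have "dist (?F v w (x + s *\<^sub>R v + t *\<^sub>R w)) (?F v w x) < e / 2"
      using r1(2) near[of s t] 1 by (simp add: r_def)
    moreover have "dist (?F w v (x + s' *\<^sub>R w + t' *\<^sub>R v)) (?F w v x) < e / 2"
      using r2(2) near'[of s' t'] 2 by (simp add: r_def)
    ultimately show ?thesis using eq unfolding dist_real_def by linarith
  qed
  then have "\<bar>?F v w x - ?F w v x\<bar> \<le> 0" by (rule field_le_epsilon) simp
  then show ?thesis by simp
qed

lemma frechet_derivative_bounded_linear_compose:
  assumes "bounded_linear h" "f differentiable (at x)"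
  shows "frechet_derivative (\<lambda>x. h (f x)) (at x) v = h (frechet_derivative f (at x) v)"
  using frechet_derivative_eqI[OF bounded_linear.has_derivative[OF assms(1) differentiable_frechetD[OF assms(2)]]] by simp

lemma second_derivative_symmetric:
  fixes f :: "'a::real_normed_vector \<Rightarrow> 'b::euclidean_space"
  assumes S: "open S" "x \<in> S" and f: "smooth_on f S"
  shows "frechet_derivative (\<lambda>z. frechet_derivative f (at z) v) (at x) w
       = frechet_derivative (\<lambda>z. frechet_derivative f (at z) w) (at x) v"
proof (rule euclidean_eqI)
  fix b :: 'b assume "b \<in> Basis"
  have *: "frechet_derivative (\<lambda>z. frechet_derivative f (at z) v) (at x) w \<bullet> b
      = frechet_derivative (\<lambda>z. frechet_derivative (\<lambda>z. f z \<bullet> b) (at z) v) (at x) w" for v w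
  proof -
    have "frechet_derivative (\<lambda>z. frechet_derivative f (at z) v) (at x) w \<bullet> b
        = frechet_derivative (\<lambda>z. frechet_derivative f (at z) v \<bullet> b) (at x) w"
      using frechet_derivative_bounded_linear_compose[OF bounded_linear_inner_left smooth_on_differentiable[OF smooth_on_frechet[OF f] S(2)]]
      by simp
    also have "\<dots> = frechet_derivative (\<lambda>z. frechet_derivative (\<lambda>z. f z \<bullet> b) (at z) v) (at x) w"
      by (intro fun_cong[OF frechet_derivative_cong_open[OF S]])
        (rule frechet_derivative_bounded_linear_compose[OF bounded_linear_inner_left smooth_on_differentiable[OF f], symmetric])
    finally show ?thesis .
  qed
  show "frechet_derivative (\<lambda>z. frechet_derivative f (at z) v) (at x) w \<bullet> b
      = frechet_derivative (\<lambda>z. frechet_derivative f (at z) w) (at x) v \<bullet> b"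
    unfolding * using second_derivative_symmetric_real[OF S smooth_onD[OF
        smooth_on_bounded_linear_compose[OF S(1) bounded_linear_inner_left f]]] .
qed

subsection \<open>Local inverses\<close>

lemma frechet_matrix:
  assumes "(f :: real^'n::finite \<Rightarrow> real^'k::finite) differentiable (at x)"
  shows "frechet_derivative f (at x) v = matrix (frechet_derivative f (at x)) *v v"
  using matrix_works[of "frechet_derivative f (at x)"] has_derivative_linear[OF differentiable_frechetD[OF assms]]
  by (simp add: linear_matrix_vector_mul_eq[symmetric])

text \<open>The inverse function theorem yields an inverse \<open>g\<close> that is differentiable
  once. Smoothness is bootstrapped: the derivative of \<open>g\<close> at \<open>y\<close> is the
  inverse Jacobian at \<open>g y\<close>, and matrix inversion is smooth, so \<open>g\<close> of
  class k has a derivative of class k.\<close>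

lemma smooth_local_inverse:
  fixes f :: "real^'n::finite \<Rightarrow> real^'n"
  assumes S: "open S" "x0 \<in> S" and f: "smooth_on f S" and inj: "inj (frechet_derivative f (at x0))"
  obtains U g where "open U" "x0 \<in> U" "U \<subseteq> S" "open (f ` U)" "homeomorphism U (f ` U) f g"
    "smooth_on g (f ` U)" "\<And>x. x \<in> U \<Longrightarrow> bij (frechet_derivative f (at x))"
proof -
  let ?D = "\<lambda>x. frechet_derivative f (at x)"
  define f' where "f' x = Blinfun (?D x)" for x
  have bl: "bounded_linear (?D x)" if "x \<in> S" for x
    using smooth_on_has_derivative[OF f that] has_derivative_bounded_linear by blast
  have f'[simp]: "blinfun_apply (f' x) = ?D x" if "x \<in> S" for x
    using bl[OF that] by (simp add: f'_def bounded_linear_Blinfun_apply)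
  have contf: "continuous_on S f'"
  proof (rule continuous_on_blinfun_componentwise)
    show "continuous_on S (\<lambda>x. blinfun_apply (f' x) i)" for i
      using smooth_on_continuous[OF smooth_on_frechet[OF f, of i]] by (simp cong: continuous_on_cong)
  qed
  obtain h where h: "linear h" "h \<circ> ?D x0 = id"
    using linear_injective_left_inverse[OF bounded_linear.linear[OF bl[OF S(2)]] inj] by blast
  have invf: "Blinfun h o\<^sub>L f' x0 = id_blinfun"
    using h(1) S(2) fun_cong[OF h(2)]
    by (intro blinfun_eqI) (simp add: bounded_linear_Blinfun_apply linear_conv_bounded_linear)
  have der: "(f has_derivative blinfun_apply (f' x)) (at x)" if "x \<in> S" for x
    using smooth_on_has_derivative[OF f that] that by simp
  obtain U V g g' where U: "open U" "U \<subseteq> S" "x0 \<in> U" and V: "open V" "f x0 \<in> V" and hom: "homeomorphism U V f g"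
    and dg: "\<And>y. y \<in> V \<Longrightarrow> (g has_derivative (g' y)) (at y)"
    and g': "\<And>y. y \<in> V \<Longrightarrow> g' y = inv (blinfun_apply (f'(g y)))"
    and bij: "\<And>y. y \<in> V \<Longrightarrow> bij (blinfun_apply (f'(g y)))"
    using inverse_function_theorem[OF S(1) der contf S(2) invf] by blast
  have V_eq: "V = f ` U" and gU: "g y \<in> U" if "y \<in> V" for y
    using hom that by (auto simp: homeomorphism_def)
  have fUV: "f ` U = V" using hom by (simp add: homeomorphism_def)
  have bijU: "bij (?D x)" if "x \<in> U" for x
  proof -
    have "f x \<in> V" "g (f x) = x" using hom that by (auto simp: homeomorphism_def)
    then show ?thesis using bij[of "f x"] U(2) that by auto
  qed
  let ?J = "\<lambda>x. matrix (?D x)"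
  have Jinv: "invertible (?J x)" if "x \<in> U" for x
    using bijU[OF that] bl[of x] U(2) that
    by (metis bounded_linear.linear invertible_eq_bij matrix_vector_mul(2) matrix_works subsetD linear_matrix_vector_mul_eq)
  have Jsm: "smooth_on (\<lambda>x. ?J x $ i $ j) U" for i j
    using smooth_on_subset[OF smooth_on_vec_nth[OF S(1) smooth_on_frechet[OF f]] U(2)] by (simp add: matrix_def)
  have Ism: "smooth_on (\<lambda>x. matrix_inv (?J x)) U"
    by (rule smooth_on_matrix_inv[OF U(1) Jsm Jinv])
  have g'_eq: "g' y v = matrix_inv (?J (g y)) *v v" if "y \<in> V" for y v
  proof -
    have x: "g y \<in> U" "g y \<in> S" using gU[OF that] U(2) by auto
    have "?D (g y) (matrix_inv (?J (g y)) *v v) = ?J (g y) *v (matrix_inv (?J (g y)) *v v)"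
      by (rule frechet_matrix[OF smooth_on_differentiable[OF f x(2)]])
    also have "\<dots> = v" using Jinv[OF x(1)] by (simp add: matrix_vector_mul_assoc matrix_inv_right)
    finally show ?thesis using g'[OF that] bijU[OF x(1)] x(2) by (metis bij_inv_eq_iff f')
  qed
  have "Ck_on k g V" for k
  proof (induction k)
    case 0
    then show ?case using hom by (simp add: homeomorphism_def)
  next
    case (Suc k)
    show ?case
    proof (rule Ck_on_SucI[OF V(1)])
      show "(g has_derivative (\<lambda>v. matrix_inv (?J (g y)) *v v)) (at y)" if "y \<in> V" for y
        using dg[OF that] ext[of "g' y", OF g'_eq[OF that]] by simp
      fix v
      have "smooth_on (\<lambda>x. matrix_inv (?J x) *v v) U"
        by (intro smooth_on_matrix_vector_mult U Ism smooth_on_const)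
      then show "Ck_on k (\<lambda>y. matrix_inv (?J (g y)) *v v) V"
        using Ck_on_compose[OF V(1) Suc.IH smooth_onD[of "\<lambda>x. matrix_inv (?J x) *v v" U k]] gU by auto
    qed
  qed
  then have "smooth_on g V" by (simp add: smooth_on_def)
  then show thesis using that[OF U(1,3,2)] fUV V hom bijU by auto
qed

subsection \<open>The derivative of a determinant\<close>

text \<open>A permutation other than the identity moves at least two points. Omitting one factor
  therefore still leaves an off-diagonal entry of the identity matrix, which is zero.\<close>

lemma prod_delta_permutation:
  fixes X :: "real^'n::finite^'n"
  assumes "p permutes UNIV"
  shows "(\<Sum>i\<in>UNIV. X $ i $ p i * (\<Prod>j\<in>UNIV - {i}. mat 1 $ j $ p j)) = (if p = id then trace X else 0)"
proof (cases "p = id")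
  case True
  then show ?thesis by (simp add: trace_def mat_def)
next
  case False
  have "(\<Prod>j\<in>UNIV - {i}. (mat 1 :: real^'n^'n) $ j $ p j) = 0" for i
  proof -
    obtain j where "j \<noteq> i" "p j \<noteq> j"
    proof (cases "p i = i")
      case True
      then show ?thesis using False that by (metis eq_id_iff ext)
    next
      case neq: False
      then have "p (p i) \<noteq> p i" using permutes_inj[OF assms] by (meson injD)
      then show ?thesis using that[of "p i"] neq by auto
    qed
    then show ?thesis by (intro prod_zero bexI[of _ j]) (auto simp: mat_def)
  qed
  then have "(\<Sum>i\<in>UNIV. X $ i $ p i * (\<Prod>j\<in>UNIV - {i}. mat 1 $ j $ p j)) = (\<Sum>i\<in>(UNIV::'n set). X $ i $ p i * 0)"
    by (intro sum.cong refl arg_cong2[of _ _ _ _ "(*)"])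
  then show ?thesis using False by simp
qed

lemma has_derivative_det_at_1:
  fixes B :: "'a::real_normed_vector \<Rightarrow> real^'n::finite^'n"
  assumes B: "\<And>i j. ((\<lambda>x. B x $ i $ j) has_derivative (\<lambda>v. B' v $ i $ j)) (at x)" and 1: "B x = mat 1"
  shows "((\<lambda>x. det (B x)) has_derivative (\<lambda>v. trace (B' v))) (at x)"
proof -
  have "((\<lambda>x. det (B x)) has_derivative (\<lambda>v. \<Sum>p\<in>{p. p permutes UNIV}.
      of_int (sign p) * (\<Sum>i\<in>UNIV. B' v $ i $ p i * (\<Prod>j\<in>UNIV - {i}. B x $ j $ p j)))) (at x)"
    unfolding det_def by (intro has_derivative_sum has_derivative_mult_right has_derivative_prod B)
  moreover have "(\<Sum>p\<in>{p. p permutes UNIV}.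
      of_int (sign p) * (\<Sum>i\<in>UNIV. B' v $ i $ p i * (\<Prod>j\<in>UNIV - {i}. B x $ j $ p j))) = trace (B' v)" for v
  proof -
    have "(\<Sum>p\<in>{p. p permutes (UNIV::'n set)}.
      of_int (sign p) * (\<Sum>i\<in>UNIV. B' v $ i $ p i * (\<Prod>j\<in>UNIV - {i}. B x $ j $ p j)))
      = (\<Sum>p\<in>{p. p permutes (UNIV::'n set)}. if p = id then trace (B' v) else 0)"
      unfolding 1 by (intro sum.cong) (auto simp: prod_delta_permutation)
    then show ?thesis by (simp add: permutes_id finite_permutations)
  qed
  ultimately show ?thesis by simp
qed

text \<open>Jacobi's formula, reduced to the derivative at the identity by multiplicativity.\<close>

lemma has_derivative_ln_abs_det:
  fixes B :: "'a::real_normed_vector \<Rightarrow> real^'n::finite^'n"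
  assumes B: "\<And>i j. ((\<lambda>x. B x $ i $ j) has_derivative (\<lambda>v. B' v $ i $ j)) (at x)" and inv: "invertible (B x)"
  shows "((\<lambda>x. ln \<bar>det (B x)\<bar>) has_derivative (\<lambda>v. trace (matrix_inv (B x) ** B' v))) (at x)"
proof -
  let ?C = "matrix_inv (B x)"
  have "((\<lambda>x. det (?C ** B x)) has_derivative (\<lambda>v. trace (?C ** B' v))) (at x)"
  proof (rule has_derivative_det_at_1)
    show "((\<lambda>x. (?C ** B x) $ i $ j) has_derivative (\<lambda>v. (?C ** B' v) $ i $ j)) (at x)" for i j
      unfolding matrix_matrix_mult_def by (simp, intro has_derivative_sum has_derivative_mult_right B)
    show "?C ** B x = mat 1" using inv by (simp add: matrix_inv_left)
  qed
  from has_derivative_mult_right[OF this, of "det (B x)"]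
  have "((\<lambda>y. det (B x) * det (?C ** B y)) has_derivative (\<lambda>v. det (B x) * trace (?C ** B' v))) (at x)" .
  moreover have "det (B x) * det (?C ** B y) = det (B y)" for y
    using inv by (simp add: det_mul[symmetric] matrix_mul_assoc matrix_inv_right)
  ultimately have "((\<lambda>y. det (B y)) has_derivative (\<lambda>v. det (B x) * trace (?C ** B' v))) (at x)" by simp
  from has_derivative_ln_abs[OF this] show ?thesis using inv by (simp add: invertible_det_nz)
qed

section \<open>Flows of smooth vector fields\<close>

lemma scaled_time_in:
  fixes s t T :: real
  assumes "0 \<le> s" "s \<le> 1"
  shows "t \<in> {-T..T} \<Longrightarrow> s * t \<in> {-T..T}" and "t \<in> {-T<..<T} \<Longrightarrow> s * t \<in> {-T<..<T}"
proof -
  have *: "\<bar>s * t\<bar> \<le> \<bar>t\<bar>" using assms by (simp add: abs_mult mult_left_le_one_le)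
  show "t \<in> {-T..T} \<Longrightarrow> s * t \<in> {-T..T}" using * by (auto simp: abs_le_iff)
  show "t \<in> {-T<..<T} \<Longrightarrow> s * t \<in> {-T<..<T}" using * by (auto simp: abs_le_iff)
qed

text \<open>The integral of \<open>g\<close> from 0 to t, rescaled to the unit interval. In this
  form the domain of integration does not depend on t, and negative t needs no oriented integral;
  all integral equations below are written this way.\<close>

lemma scaled_integral_has_derivative:
  fixes g :: "real \<Rightarrow> 'b::banach"
  assumes g: "continuous_on {-T<..<T} g" and t: "t \<in> {-T<..<T}"
  shows "((\<lambda>t. integral {0..1} (\<lambda>s. t *\<^sub>R g (s * t))) has_vector_derivative g t) (at t)"
proof -
  obtain T' where T': "\<bar>t\<bar> < T'" "T' < T" using t by (metis abs_less_iff dense greaterThanLessThan_iff minus_less_iff)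
  have "continuous_on {-T'..T'} g" by (rule continuous_on_subset[OF g]) (use T' in auto)
  then obtain G where G: "\<And>x. x \<in> {-T'..T'} \<Longrightarrow> (G has_vector_derivative g x) (at x within {-T'..T'})"
    using antiderivative_continuous by blast
  have eq: "integral {0..1} (\<lambda>s. u *\<^sub>R g (s * u)) = G u - G 0" if u: "u \<in> {-T'..T'}" for u
  proof -
    have "((\<lambda>s. G (s * u)) has_vector_derivative u *\<^sub>R g (s * u)) (at s within {0..1})" if s: "s \<in> {0..1}" for s
    proof -
      have sub: "(\<lambda>s. s * u) ` {0..1} \<subseteq> {-T'..T'}" using scaled_time_in(1)[OF _ _ u] by auto
      have "(G has_vector_derivative g (s * u)) (at (s * u) within (\<lambda>s. s * u) ` {0..1})"
        using G[of "s * u"] sub s has_vector_derivative_within_subset by blast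
      moreover have "((\<lambda>s. s * u) has_vector_derivative u) (at s within {0..1})"
        by (auto intro!: derivative_eq_intros simp: has_vector_derivative_def)
      ultimately show ?thesis using vector_diff_chain_within[of "\<lambda>s. s * u" u s "{0..1}" G] by (simp add: o_def)
    qed
    from fundamental_theorem_of_calculus[OF _ this] show ?thesis
      by (intro integral_unique) auto
  qed
  have "(G has_vector_derivative g t) (at t)"
    using G[of t] T' by (auto simp: at_within_Icc_at abs_le_iff abs_less_iff)
  then have "((\<lambda>u. G u - G 0) has_vector_derivative g t) (at t)"
    by (auto intro!: derivative_eq_intros)
  then show ?thesis
    by (rule has_vector_derivative_transform_within_open[of _ _ _ "{-T'<..<T'}"]) (use T' eq in auto)
qed

lemma continuous_integrand:
  fixes G :: "('p::real_normed_vector \<times> real) \<times> 'w::real_normed_vector \<Rightarrow> 'w"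
  assumes "continuous_on D G" "continuous_on Z w" "\<And>z. z \<in> Z \<Longrightarrow> (z, w z) \<in> D" "\<And>s. s \<in> {0..1} \<Longrightarrow> (x, s * t) \<in> Z"
  shows "continuous_on {0..1} (\<lambda>s. t *\<^sub>R G ((x, s * t), w (x, s * t)))"
  using assms
  by (intro continuous_on_scaleR continuous_on_const continuous_on_compose2[OF assms(1)] continuous_on_Pair
      continuous_on_compose2[OF assms(2)] continuous_intros) auto

text \<open>With K T \<le> 1/2 the integral operator contracts the supremum distance by 1/2. The
  parameter x is an argument of the unknown function, so joint continuity in x and t comes with the
  fixed point.\<close>

lemma picard_solution:
  fixes G :: "('p::euclidean_space \<times> real) \<times> 'w::euclidean_space \<Rightarrow> 'w"
  assumes X: "compact X" "convex X" "X \<noteq> {}" and T: "0 \<le> T"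
    and cont: "continuous_on ((X \<times> {-T..T}) \<times> UNIV) G"
    and lip: "\<And>p v w. p \<in> X \<times> {-T..T} \<Longrightarrow> norm (G (p, v) - G (p, w)) \<le> K * norm (v - w)"
    and K: "0 \<le> K" "K * T \<le> 1/2" and w0: "continuous_on X w0"
  obtains w where "continuous_on (X \<times> {-T..T}) w"
    "\<And>x t. x \<in> X \<Longrightarrow> t \<in> {-T..T} \<Longrightarrow> w (x, t) = w0 x + integral {0..1} (\<lambda>s. t *\<^sub>R G ((x, s * t), w (x, s * t)))"
proof -
  let ?Z = "X \<times> {-T..T}"
  have Z: "compact ?Z" "convex ?Z" "?Z \<noteq> {}" "closed ?Z"
    using X T by (auto intro: compact_Times convex_Times compact_imp_closed)
  \<comment> \<open>Precomposing with the projection onto the compact convex set \<open>?Z\<close>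
    extends functions to the whole space, where the bounded continuous functions form a complete
    metric space.\<close>
  define P where "P = closest_point ?Z"
  have P_in: "P z \<in> ?Z" for z unfolding P_def by (rule closest_point_in_set[OF Z(4,3)])
  have P_cont: "continuous_on UNIV P" unfolding P_def by (rule continuous_on_closest_point[OF Z(2,4,3)])
  have P_id: "P z = z" if "z \<in> ?Z" for z unfolding P_def by (rule closest_point_self[OF that])
  define \<Phi> where "\<Phi> f y = w0 (fst y) + integral {0..1} (\<lambda>s. snd y *\<^sub>R G ((fst y, s * snd y), apply_bcontfun f (fst y, s * snd y)))"
    for f and y :: "'p \<times> real"
  have in_Z: "(fst y, s * snd y) \<in> ?Z" if "y \<in> ?Z" "s \<in> {0..1}" for y s
    using that scaled_time_in(1)[of s "snd y" T] by (auto simp: mem_Times_iff)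
  have bcontfun_cont: "continuous_on UNIV (apply_bcontfun f)" for f :: "('p \<times> real) \<Rightarrow>\<^sub>C 'w"
    using apply_bcontfun[of f] by (simp add: bcontfun_def)
  have \<Phi>_cont: "continuous_on ?Z (\<Phi> f)" for f
  proof -
    have "continuous_on (?Z \<times> cbox 0 1) (\<lambda>(y, s). snd y *\<^sub>R G ((fst y, s * snd y), apply_bcontfun f (fst y, s * snd y)))"
      unfolding case_prod_beta
      by (intro continuous_on_scaleR continuous_on_compose2[OF cont] continuous_on_Pair
          continuous_on_compose2[OF bcontfun_cont] continuous_intros)
        (use in_Z in \<open>auto simp: mem_Times_iff\<close>)
    from integral_continuous_on_param[OF this] show ?thesis unfolding \<Phi>_def
      by (intro continuous_on_add continuous_on_compose2[OF w0] continuous_intros) (auto simp: cbox_interval)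
  qed
  have \<Phi>_b: "(\<lambda>z. \<Phi> f (P z)) \<in> bcontfun" for f
  proof -
    have "bounded (\<Phi> f ` ?Z)" by (intro compact_imp_bounded compact_continuous_image \<Phi>_cont Z)
    then obtain B where "\<And>y. y \<in> ?Z \<Longrightarrow> norm (\<Phi> f y) \<le> B" by (auto simp: bounded_iff)
    then show ?thesis
      using P_in by (intro bcontfun_normI[of _ B] continuous_on_compose2[OF \<Phi>_cont P_cont]) blast+
  qed
  define \<Psi> where "\<Psi> f = Bcontfun (\<lambda>z. \<Phi> f (P z))" for f
  have \<Psi>_apply: "apply_bcontfun (\<Psi> f) z = \<Phi> f (P z)" for f z
    unfolding \<Psi>_def using Bcontfun_inverse[OF \<Phi>_b] by simp
  have int: "continuous_on {0..1} (\<lambda>s. snd y *\<^sub>R G ((fst y, s * snd y), apply_bcontfun f (fst y, s * snd y)))"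
    if "y \<in> ?Z" for f y
    by (rule continuous_integrand[OF cont continuous_on_subset[OF bcontfun_cont subset_UNIV], of ?Z])
      (use in_Z[OF that] in auto)
  have "dist (\<Psi> f) (\<Psi> g) \<le> 1/2 * dist f g" for f g
  proof (rule dist_bound)
    fix z
    define y where "y = P z"
    have y: "y \<in> ?Z" using P_in by (simp add: y_def)
    then have y2: "\<bar>snd y\<bar> \<le> T" by (auto simp: mem_Times_iff)
    let ?I = "\<lambda>f s. snd y *\<^sub>R G ((fst y, s * snd y), apply_bcontfun f (fst y, s * snd y))"
    have "norm (integral {0..1} (\<lambda>s. ?I f s - ?I g s)) \<le> (1/2 * dist f g) * (1 - 0)"
    proof (rule integral_bound)
      show "continuous_on {0..1} (\<lambda>s. ?I f s - ?I g s)" by (intro continuous_on_diff int y)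
      fix s :: real assume s: "s \<in> {0..1}"
      let ?p = "(fst y, s * snd y)"
      have "norm (?I f s - ?I g s) = \<bar>snd y\<bar> * norm (G (?p, apply_bcontfun f ?p) - G (?p, apply_bcontfun g ?p))"
        by (simp add: scaleR_diff_right[symmetric])
      also have "\<dots> \<le> T * (K * dist f g)"
        using y2 T K(1) dist_bounded[of f ?p g] order_trans[OF lip[OF in_Z[OF y s]] mult_left_mono[OF _ K(1)]]
        by (intro mult_mono) (auto simp: dist_norm)
      also have "\<dots> = (K * T) * dist f g" by simp
      also have "\<dots> \<le> 1/2 * dist f g" by (intro mult_right_mono K) auto
      finally show "norm (?I f s - ?I g s) \<le> 1/2 * dist f g" .
    qed simp
    then show "dist (\<Psi> f z) (\<Psi> g z) \<le> 1/2 * dist f g"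
      using int[OF y, of f] int[OF y, of g]
      by (simp add: \<Psi>_apply y_def[symmetric] \<Phi>_def dist_norm integral_diff integrable_continuous_interval)
  qed
  then obtain f where f: "\<Psi> f = f" using banach_fix_type[of "1/2" \<Psi>] by auto
  show thesis
  proof (rule that[of "apply_bcontfun f"])
    show "continuous_on ?Z (apply_bcontfun f)"
      using apply_bcontfun[of f] by (auto simp: bcontfun_def intro: continuous_on_subset)
    fix x t assume "x \<in> X" "t \<in> {-T..T}"
    then have "apply_bcontfun f (x, t) = \<Phi> f (x, t)" using \<Psi>_apply[of f "(x, t)"] f P_id by simp
    then show "apply_bcontfun f (x, t) = w0 x + integral {0..1} (\<lambda>s. t *\<^sub>R G ((x, s * t), apply_bcontfun f (x, s * t)))"
      by (simp add: \<Phi>_def)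
  qed
qed

section \<open>Smooth dependence of solutions on parameters\<close>

lemma Ck_on_1:
  assumes "Ck_on 1 f S"
  shows Ck_on_1_has_derivative: "x \<in> S \<Longrightarrow> (f has_derivative frechet_derivative f (at x)) (at x)"
    and Ck_on_1_continuous: "continuous_on S (\<lambda>x. frechet_derivative f (at x) v)"
  using assms by (auto intro!: differentiable_frechetD)

lemma derivative_bounded_on_compact:
  fixes G :: "'a::euclidean_space \<Rightarrow> 'b::real_normed_vector"
  assumes G: "Ck_on 1 G D" and C: "compact C" "C \<subseteq> D"
  obtains K where "0 \<le> K" "\<And>P k. P \<in> C \<Longrightarrow> norm (frechet_derivative G (at P) k) \<le> K * norm k"
proof -
  let ?D = "\<lambda>P. frechet_derivative G (at P)"
  have "\<exists>B. \<forall>P\<in>C. norm (?D P b) \<le> B" for b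
  proof -
    have "continuous_on C (\<lambda>P. ?D P b)" using G C by (auto intro: continuous_on_subset)
    then have "bounded ((\<lambda>P. ?D P b) ` C)" using C by (intro compact_imp_bounded compact_continuous_image)
    then show ?thesis by (auto simp: bounded_iff)
  qed
  then obtain B where B: "\<And>b P. P \<in> C \<Longrightarrow> norm (?D P b) \<le> B b" by metis
  have "norm (?D P k) \<le> (\<Sum>b\<in>Basis. \<bar>B b\<bar>) * norm k" if P: "P \<in> C" for P k
  proof -
    have lin: "linear (?D P)"
      using G P C by (auto intro!: has_derivative_linear differentiable_frechetD)
    have "norm (?D P k) = norm (\<Sum>b\<in>Basis. (k \<bullet> b) *\<^sub>R ?D P b)"
      by (subst euclidean_representation[of k, symmetric], simp only: linear_sum[OF lin] linear_scale[OF lin])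
    also have "\<dots> \<le> (\<Sum>b\<in>Basis. norm k * \<bar>B b\<bar>)"
      using B[OF P] by (intro sum_norm_le) (auto intro!: mult_mono simp: Basis_le_norm order_trans[OF B[OF P] abs_ge_self])
    finally show ?thesis by (simp add: sum_distrib_left mult.commute)
  qed
  then show thesis using that[of "\<Sum>b\<in>Basis. \<bar>B b\<bar>"] by (simp add: sum_nonneg)
qed

text \<open>The derivative is uniformly continuous on a compact neighbourhood of \<open>C\<close>.
  The mean value inequality on the segment from \<open>P\<close> to \<open>P + k\<close> then bounds
  the remainder uniformly in \<open>P\<close>.\<close>

lemma uniformly_differentiable_on_compact:
  fixes G :: "'a::euclidean_space \<Rightarrow> 'b::real_normed_vector"
  assumes D: "open D" and G: "Ck_on 1 G D" and C: "compact C" "C \<subseteq> D" and e: "0 < e"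
  obtains d where "0 < d" "\<And>P k. P \<in> C \<Longrightarrow> norm k < d \<Longrightarrow>
    norm (G (P + k) - G P - frechet_derivative G (at P) k) \<le> e * norm k"
proof -
  let ?D = "\<lambda>P. frechet_derivative G (at P)"
  obtain r where r: "r > 0" "(\<Union>x\<in>C. cball x r) \<subseteq> D"
    using compact_subset_open_imp_cball_epsilon_subset[OF C(1) D C(2)] by blast
  \<comment> \<open>Enlarging \<open>C\<close> by \<open>r\<close> keeps these segments inside a
    compact subset of \<open>D\<close>.\<close>
  define C' where "C' = {x + y | x y. x \<in> C \<and> y \<in> cball 0 r}"
  have C': "compact C'" unfolding C'_def by (intro compact_sums C compact_cball)
  have C'D: "C' \<subseteq> D" using r(2) by (force simp: C'_def dist_norm)
  have mem: "P + k \<in> C'" if "P \<in> C" "norm k \<le> r" for P k using that by (auto simp: C'_def)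
  have lin: "bounded_linear (?D P)" if "P \<in> D" for P
    using G that by (auto intro!: has_derivative_bounded_linear differentiable_frechetD)
  \<comment> \<open>The estimate is proved on each basis vector and summed over the basis, which
    costs the factor DIM('a).\<close>
  define e' where "e' = e / real DIM('a)"
  have e': "e' > 0" using e by (simp add: e'_def)
  have "\<exists>d>0. \<forall>P\<in>C'. \<forall>Q\<in>C'. dist Q P < d \<longrightarrow> dist (?D Q b) (?D P b) < e'" for b
  proof -
    have "continuous_on C' (\<lambda>P. ?D P b)" using G C'D by (auto intro: continuous_on_subset)
    from compact_uniformly_continuous[OF this C'] show ?thesis using e' by (auto simp: uniformly_continuous_on_def)
  qed
  then obtain d where d: "\<And>b. d b > 0" "\<And>b P Q. P \<in> C' \<Longrightarrow> Q \<in> C' \<Longrightarrow> dist Q P < d b \<Longrightarrow> dist (?D Q b) (?D P b) < e'"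
    by metis
  define \<delta> where "\<delta> = min r (Min (d ` Basis))"
  have \<delta>: "\<delta> > 0" "\<delta> \<le> r" "\<And>b. b \<in> Basis \<Longrightarrow> \<delta> \<le> d b"
    using r(1) d(1) by (auto simp: \<delta>_def min.coboundedI2)
  have est: "norm (?D Q v - ?D P v) \<le> e * norm v" if "P \<in> C'" "Q \<in> C'" "dist Q P < \<delta>" for P Q v
  proof -
    have lin': "linear (\<lambda>v. ?D Q v - ?D P v)"
      using that C'D lin by (intro linear_compose_sub bounded_linear.linear) auto
    have "norm (?D Q v - ?D P v) = norm (\<Sum>b\<in>Basis. (v \<bullet> b) *\<^sub>R (?D Q b - ?D P b))"
      by (subst (1 2) euclidean_representation[of v, symmetric], simp only: linear_sum[OF lin'] linear_scale[OF lin'])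
    also have "\<dots> \<le> (\<Sum>b\<in>(Basis::'a set). norm v * e')"
    proof (rule sum_norm_le)
      fix b :: 'a assume b: "b \<in> Basis"
      have "norm (?D Q b - ?D P b) \<le> e'"
        using d(2)[OF that(1,2), of b] \<delta>(3)[OF b] that(3) by (simp add: dist_norm)
      then show "norm ((v \<bullet> b) *\<^sub>R (?D Q b - ?D P b)) \<le> norm v * e'"
        using Basis_le_norm[OF b] by (auto intro!: mult_mono)
    qed
    finally show ?thesis by (simp add: e'_def mult.commute)
  qed
  show thesis
  proof (rule that[OF \<delta>(1)])
    fix P k :: 'a assume P: "P \<in> C" and k: "norm k < \<delta>"
    let ?S = "closed_segment P (P + k)"
    have seg: "x \<in> C'" "dist x P < \<delta>" if "x \<in> ?S" for x
    proof -
      obtain u where u01: "0 \<le> u" "u \<le> 1" and ux: "x = (1 - u) *\<^sub>R P + u *\<^sub>R (P + k)"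
        using \<open>x \<in> ?S\<close> by (auto simp: closed_segment_def)
      have u: "x = P + u *\<^sub>R k" unfolding ux by (simp add: algebra_simps)
      have "norm (u *\<^sub>R k) \<le> norm k" using u01 by (simp add: mult_left_le_one_le)
      then show "x \<in> C'" "dist x P < \<delta>" using u k \<delta>(2) mem[OF P, of "u *\<^sub>R k"] by (auto simp: dist_norm)
    qed
    have "norm (G (P + k) - G P - ?D P ((P + k) - P)) \<le> norm ((P + k) - P) * e"
    proof (rule differentiable_bound_linearization[where S = ?S])
      show "P + t *\<^sub>R (P + k - P) \<in> ?S" if "t \<in> {0..1}" for t
        using that by (auto simp: closed_segment_def algebra_simps intro!: exI[of _ t])
      show "(G has_derivative ?D x) (at x within ?S)" if "x \<in> ?S" for x
        using G seg(1)[OF that] C'D by (auto intro!: has_derivative_at_withinI differentiable_frechetD)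
      show "onorm (?D x - ?D P) \<le> e" if "x \<in> ?S" for x
        using est[of P x] seg[OF that] mem[OF P, of 0] r(1) by (intro onorm_le) (simp add: fun_diff_def)
    qed auto
    then show "norm (G (P + k) - G P - ?D P k) \<le> e * norm k" by (simp add: mult.commute)
  qed
qed

text \<open>The derivative of a solution with respect to the parameter solves the linearized equation,
  which has the same form; this drives the induction in \<open>ode_Ck\<close>.\<close>

lemma ode_variation:
  fixes G :: "('p::euclidean_space \<times> real) \<times> 'w::euclidean_space \<Rightarrow> 'w"
  assumes Om: "open Om" "cball x0 r \<subseteq> Om" "0 < r" and T': "0 \<le> T'" "T' < T"
    and K: "0 \<le> K" "K * T \<le> 1/2" and D: "open D" and G: "Ck_on 1 G D"
    and w_cont: "continuous_on (Om \<times> {-T<..<T}) w" and w_D: "\<And>p. p \<in> Om \<times> {-T<..<T} \<Longrightarrow> (p, w p) \<in> D"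
    and w: "\<And>x t. x \<in> Om \<Longrightarrow> t \<in> {-T<..<T} \<Longrightarrow> w (x, t) = w0 x + integral {0..1} (\<lambda>s. t *\<^sub>R G ((x, s * t), w (x, s * t)))"
    and bound: "\<And>p v. p \<in> Om \<times> {-T<..<T} \<Longrightarrow> norm (frechet_derivative G (at (p, w p)) (0, v)) \<le> K * norm v"
    and w0: "Ck_on 1 w0 Om"
  obtains Z where "\<And>h. continuous_on (cball x0 r \<times> {-T'..T'}) (Z h)"
    "\<And>h x t. x \<in> cball x0 r \<Longrightarrow> t \<in> {-T'..T'} \<Longrightarrow> Z h (x, t) = frechet_derivative w0 (at x) h +
       integral {0..1} (\<lambda>s. t *\<^sub>R frechet_derivative G (at ((x, s * t), w (x, s * t))) ((h, 0), Z h (x, s * t)))"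
    "\<And>x t. x \<in> ball x0 r \<Longrightarrow> t \<in> {-T'..T'} \<Longrightarrow> ((\<lambda>x. w (x, t)) has_derivative (\<lambda>h. Z h (x, t))) (at x)"
proof -
  let ?X = "cball x0 r" and ?I = "{-T'..T'}"
  let ?DG = "\<lambda>p. frechet_derivative G (at (p, w p))"
  have sub: "?X \<times> ?I \<subseteq> Om \<times> {-T<..<T}" using Om(2) T' by auto
  have KT': "K * T' \<le> 1/2" using K T' mult_left_mono[of T' T K] by simp
  have DG: "(G has_derivative ?DG p) (at (p, w p))" if "p \<in> Om \<times> {-T<..<T}" for p
    using G w_D[OF that] by (auto intro!: differentiable_frechetD)
  have DGlin: "linear (?DG p)" if "p \<in> Om \<times> {-T<..<T}" for p
    using DG[OF that] has_derivative_linear by blast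
  have DGcont: "continuous_on (?X \<times> ?I) (\<lambda>p. ?DG p k)" for k
  proof -
    have "continuous_on D (\<lambda>P. frechet_derivative G (at P) k)" by (rule Ck_on_1_continuous[OF G])
    then show ?thesis
      by (rule continuous_on_compose2)
        (use sub w_D in \<open>auto intro!: continuous_on_Pair continuous_on_id continuous_on_subset[OF w_cont]\<close>)
  qed
  define H where "H h q = ?DG (fst q) ((h, 0), snd q)" for h :: 'p and q
  \<comment> \<open>Splitting off the unknown along a basis reduces joint continuity of
    \<open>H\<close> to continuity of the derivative of \<open>G\<close> in fixed
    directions.\<close>
  have H_split: "?DG p ((h, 0), \<zeta>) = ?DG p ((h, 0), 0) + (\<Sum>b\<in>Basis. (\<zeta> \<bullet> b) *\<^sub>R ?DG p (0, b))"
    if "p \<in> Om \<times> {-T<..<T}" for p h \<zeta>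
  proof -
    have "?DG p ((h, 0), \<zeta>) = ?DG p ((h, 0), 0) + ?DG p (0, \<zeta>)"
      using linear_add[OF DGlin[OF that], of "((h, 0), 0)" "(0, \<zeta>)"] by simp
    also have "(0, \<zeta>) = (\<Sum>b\<in>Basis. (\<zeta> \<bullet> b) *\<^sub>R ((0, 0) :: 'p \<times> real, b))"
      by (simp add: prod_eq_iff fst_sum snd_sum euclidean_representation zero_prod_def[symmetric])
    also have "?DG p \<dots> = (\<Sum>b\<in>Basis. (\<zeta> \<bullet> b) *\<^sub>R ?DG p (0, b))"
      by (simp only: linear_sum[OF DGlin[OF that]] linear_scale[OF DGlin[OF that]] zero_prod_def[symmetric])
    finally show ?thesis .
  qed
  have H_cont: "continuous_on ((?X \<times> ?I) \<times> UNIV) (H h)" for h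
  proof -
    have "continuous_on ((?X \<times> ?I) \<times> UNIV) (\<lambda>q. ?DG (fst q) ((h, 0), 0) + (\<Sum>b\<in>Basis. (snd q \<bullet> b) *\<^sub>R ?DG (fst q) (0, b)))"
      by (intro continuous_on_add continuous_on_sum continuous_on_scaleR continuous_on_inner
          continuous_on_compose2[OF DGcont] continuous_on_fst continuous_on_snd continuous_on_id continuous_on_const) auto
    moreover have "H h q = ?DG (fst q) ((h, 0), 0) + (\<Sum>b\<in>Basis. (snd q \<bullet> b) *\<^sub>R ?DG (fst q) (0, b))"
      if "q \<in> (?X \<times> ?I) \<times> UNIV" for q
      unfolding H_def by (rule H_split) (use that sub in auto)
    ultimately show ?thesis by (simp cong: continuous_on_cong)
  qed
  have H_diff: "H h (p, v) - H h (p, v') = ?DG p (0, v - v')" if "p \<in> ?X \<times> ?I" for h p v v'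
    using linear_diff[OF DGlin, of p "((h, 0), v)" "((h, 0), v')"] sub that
    by (auto simp: H_def zero_prod_def)
  define Q where "Q e z \<longleftrightarrow> continuous_on (?X \<times> ?I) z \<and> (\<forall>x\<in>?X. \<forall>t\<in>?I. z (x, t) = frechet_derivative w0 (at x) e +
       integral {0..1} (\<lambda>s. t *\<^sub>R H e ((x, s * t), z (x, s * t))))" for e :: 'p and z
  have "\<exists>z. Q e z" for e
  proof -
    have w0c: "continuous_on ?X (\<lambda>x. frechet_derivative w0 (at x) e)"
      using w0 Om(2) by (auto intro: continuous_on_subset)
    have lip: "norm (H e (p, v) - H e (p, v')) \<le> K * norm (v - v')" if "p \<in> ?X \<times> ?I" for p v v'
      unfolding H_diff[OF that] using bound that sub by blast
    have ne: "?X \<noteq> {}" using Om(3) by simp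
    from picard_solution[OF compact_cball convex_cball ne T'(1) H_cont lip K(1) KT' w0c]
    obtain z where "continuous_on (?X \<times> ?I) z" "\<And>x t. x \<in> ?X \<Longrightarrow> t \<in> ?I \<Longrightarrow> z (x, t) = frechet_derivative w0 (at x) e +
       integral {0..1} (\<lambda>s. t *\<^sub>R H e ((x, s * t), z (x, s * t)))" by blast
    then show ?thesis unfolding Q_def by blast
  qed
  then obtain z where "\<And>e. Q e (z e)" by metis
  then have z_cont: "\<And>e. continuous_on (?X \<times> ?I) (z e)"
    and z: "\<And>e x t. x \<in> ?X \<Longrightarrow> t \<in> ?I \<Longrightarrow> z e (x, t) = frechet_derivative w0 (at x) e +
       integral {0..1} (\<lambda>s. t *\<^sub>R H e ((x, s * t), z e (x, s * t)))" unfolding Q_def by blast+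
  \<comment> \<open>Solving for basis directions only and combining makes \<open>Z\<close> linear in
    \<open>h\<close> by construction. The combination is again a solution because the equation is
    linear.\<close>
  define Z where "Z h p = (\<Sum>b\<in>Basis. (h \<bullet> b) *\<^sub>R z b p)" for h :: 'p and p
  have Z_cont: "continuous_on (?X \<times> ?I) (Z h)" for h
    unfolding Z_def by (intro continuous_on_sum continuous_on_scaleR continuous_on_const z_cont)
  have in_XI: "(x, s * t) \<in> ?X \<times> ?I" if "x \<in> ?X" "t \<in> ?I" "s \<in> {0..1}" for x s t
    using that scaled_time_in(1)[of s t T'] by auto
  have int: "continuous_on {0..1} (\<lambda>s. t *\<^sub>R H e ((x, s * t), y (x, s * t)))"
    if "x \<in> ?X" "t \<in> ?I" "continuous_on (?X \<times> ?I) y" for x t e y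
    by (rule continuous_integrand[OF H_cont, of "?X \<times> ?I"]) (use that in_XI in auto)
  have Z: "Z h (x, t) = frechet_derivative w0 (at x) h + integral {0..1} (\<lambda>s. t *\<^sub>R H h ((x, s * t), Z h (x, s * t)))"
    if x: "x \<in> ?X" and t: "t \<in> ?I" for h x t
  proof -
    have lin0: "linear (frechet_derivative w0 (at x))"
      using x Om(2) by (intro has_derivative_linear[OF Ck_on_1_has_derivative[OF w0]]) blast
    have "H h ((x, s * t), Z h (x, s * t)) = (\<Sum>b\<in>Basis. (h \<bullet> b) *\<^sub>R H b ((x, s * t), z b (x, s * t)))" if "s \<in> {0..1}" for s
    proof -
      have "((h, 0), Z h (x, s * t)) = (\<Sum>b\<in>Basis. (h \<bullet> b) *\<^sub>R ((b, 0 :: real), z b (x, s * t)))"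
        by (simp add: prod_eq_iff fst_sum snd_sum Z_def euclidean_representation)
      moreover have "(x, s * t) \<in> Om \<times> {-T<..<T}" using in_XI[OF x t that] sub by blast
      ultimately show ?thesis
        unfolding H_def by (simp only: fst_conv snd_conv linear_sum[OF DGlin] linear_scale[OF DGlin])
    qed
    then have "integral {0..1} (\<lambda>s. t *\<^sub>R H h ((x, s * t), Z h (x, s * t)))
        = integral {0..1} (\<lambda>s. \<Sum>b\<in>Basis. (h \<bullet> b) *\<^sub>R (t *\<^sub>R H b ((x, s * t), z b (x, s * t))))"
      by (intro integral_cong) (simp add: scaleR_sum_right mult.commute)
    also have "\<dots> = (\<Sum>b\<in>Basis. (h \<bullet> b) *\<^sub>R integral {0..1} (\<lambda>s. t *\<^sub>R H b ((x, s * t), z b (x, s * t))))"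
      by (subst integral_sum)
        (intro ballI integrable_continuous_interval continuous_on_scaleR[OF continuous_on_const] int[OF x t z_cont]
          finite_Basis integral_cmul sum.cong refl)+
    finally have I: "integral {0..1} (\<lambda>s. t *\<^sub>R H h ((x, s * t), Z h (x, s * t)))
        = (\<Sum>b\<in>Basis. (h \<bullet> b) *\<^sub>R integral {0..1} (\<lambda>s. t *\<^sub>R H b ((x, s * t), z b (x, s * t))))" .
    have "frechet_derivative w0 (at x) h = (\<Sum>b\<in>Basis. (h \<bullet> b) *\<^sub>R frechet_derivative w0 (at x) b)"
      by (subst euclidean_representation[of h, symmetric], simp only: linear_sum[OF lin0] linear_scale[OF lin0])
    then show ?thesis unfolding Z_def[of h "(x, t)"] I
      by (simp only: z[OF x t] scaleR_add_right sum.distrib)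
  qed
  have deriv: "((\<lambda>x. w (x, t)) has_derivative (\<lambda>h. Z h (x, t))) (at x)" if x: "x \<in> ball x0 r" and t: "t \<in> ?I" for x t
    unfolding has_derivative_at_alt
  proof (intro conjI allI impI)
    show "bounded_linear (\<lambda>h. Z h (x, t))"
      unfolding Z_def linear_conv_bounded_linear[symmetric]
      by (intro linearI) (simp_all add: inner_add_left scaleR_add_left sum.distrib scaleR_sum_right)
    have xX: "x \<in> ?X" using x by simp
    have "\<exists>B. \<forall>\<tau>\<in>?I. norm (z b (x, \<tau>)) \<le> B" for b
    proof -
      have "continuous_on ?I (\<lambda>\<tau>. z b (x, \<tau>))"
        by (rule continuous_on_compose2[OF z_cont]) (use xX in \<open>auto intro!: continuous_intros\<close>)
      then have "bounded ((\<lambda>\<tau>. z b (x, \<tau>)) ` ?I)" by (intro compact_imp_bounded compact_continuous_image) auto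
      then show ?thesis by (auto simp: bounded_iff)
    qed
    then obtain B where B: "\<And>b \<tau>. \<tau> \<in> ?I \<Longrightarrow> norm (z b (x, \<tau>)) \<le> B b" by metis
    define C where "C = (\<Sum>b\<in>(Basis::'p set). \<bar>B b\<bar>)"
    have C0: "C \<ge> 0" by (simp add: C_def sum_nonneg)
    have C: "norm (Z h (x, \<tau>)) \<le> C * norm h" if "\<tau> \<in> ?I" for h \<tau>
    proof -
      have "norm (Z h (x, \<tau>)) \<le> (\<Sum>b\<in>(Basis::'p set). norm h * \<bar>B b\<bar>)"
        unfolding Z_def using Basis_le_norm order_trans[OF B[OF that] abs_ge_self]
        by (intro sum_norm_le) (auto intro!: mult_mono)
      then show ?thesis by (simp add: C_def sum_distrib_left mult.commute)
    qed
    fix e :: real assume e: "e > 0"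
    \<comment> \<open>The second bound gives e1 T' \<le> 1/4, so that together with K T' \<le> 1/2 a
      quarter of the error \<open>m\<close> survives on the left of the final inequality. The first
      bound makes four times the remaining terms at most e times the norm of
      \<open>h\<close>.\<close>
    define e1 where "e1 = min (e / (4 * (1 + T' * (1 + C)))) (1 / (4 * (T' + 1)))"
    have pos: "1 + T' * (1 + C) > 0" using T' C0 by (intro add_pos_nonneg mult_nonneg_nonneg) auto
    have e1: "e1 > 0" using e pos T' by (simp add: e1_def)
    have e1a: "4 * e1 * (1 + T' * (1 + C)) \<le> e"
    proof -
      have "e1 \<le> e / (4 * (1 + T' * (1 + C)))" by (simp add: e1_def)
      then have "e1 * (4 * (1 + T' * (1 + C))) \<le> e" using pos by (simp add: pos_le_divide_eq)
      then show ?thesis by (simp add: mult_ac)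
    qed
    have e1b: "e1 * T' \<le> 1/4"
    proof -
      have "e1 \<le> 1 / (4 * (T' + 1))" by (simp add: e1_def)
      then have "e1 * (4 * (T' + 1)) \<le> 1" using T' by (simp add: pos_le_divide_eq)
      then show ?thesis using e1 by (simp add: algebra_simps)
    qed
    define Cu where "Cu = (\<lambda>\<tau>. ((x, \<tau>), w (x, \<tau>))) ` ?I"
    have Cu: "compact Cu" "Cu \<subseteq> D"
    proof -
      have "(x, \<tau>) \<in> Om \<times> {-T<..<T}" if "\<tau> \<in> ?I" for \<tau> using sub xX that by blast
      then show "compact Cu" "Cu \<subseteq> D"
        unfolding Cu_def using w_D
        by (auto intro!: compact_continuous_image continuous_on_Pair continuous_on_id continuous_on_const
          continuous_on_compose2[OF w_cont])
    qed
    obtain d where d: "d > 0" "\<And>P k. P \<in> Cu \<Longrightarrow> norm k < d \<Longrightarrow>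
        norm (G (P + k) - G P - frechet_derivative G (at P) k) \<le> e1 * norm k"
      using uniformly_differentiable_on_compact[OF D G Cu e1] by blast
    obtain d0 where d0: "d0 > 0" "\<And>y. norm (y - x) < d0 \<Longrightarrow>
        norm (w0 y - w0 x - frechet_derivative w0 (at x) (y - x)) \<le> e1 * norm (y - x)"
      using xX Om(2) e1 Ck_on_1_has_derivative[OF w0, of x] unfolding has_derivative_at_alt by blast
    have "uniformly_continuous_on (?X \<times> ?I) w"
      by (intro compact_uniformly_continuous continuous_on_subset[OF w_cont sub] compact_Times) auto
    then obtain d1 where d1: "d1 > 0" "\<And>p q. p \<in> ?X \<times> ?I \<Longrightarrow> q \<in> ?X \<times> ?I \<Longrightarrow> dist q p < d1 \<Longrightarrow> dist (w q) (w p) < d / 2"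
      unfolding uniformly_continuous_on_def using d(1) by (metis half_gt_zero)
    obtain d2 where d2: "d2 > 0" "ball x d2 \<subseteq> ball x0 r" using x open_contains_ball[of "ball x0 r"] open_ball by blast
    show "\<exists>\<eta>>0. \<forall>y. norm (y - x) < \<eta> \<longrightarrow> norm (w (y, t) - w (x, t) - Z (y - x) (x, t)) \<le> e * norm (y - x)"
    proof (intro exI[of _ "min (min d0 d1) (min d2 (d / 2))"] conjI allI impI)
      show "0 < min (min d0 d1) (min d2 (d / 2))" using d0(1) d1(1) d2(1) d(1) by simp
      fix y assume y: "norm (y - x) < min (min d0 d1) (min d2 (d / 2))"
      define h where "h = y - x"
      have "y \<in> ball x d2" using y by (simp add: dist_norm norm_minus_commute)
      then have yX: "y \<in> ?X" using d2(2) ball_subset_cball by blast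
      let ?\<Delta> = "\<lambda>\<tau>. w (y, \<tau>) - w (x, \<tau>)"
      let ?\<delta> = "\<lambda>\<tau>. ?\<Delta> \<tau> - Z h (x, \<tau>)"
      have \<delta>_cont: "continuous_on ?I ?\<delta>"
        using xX yX
        by (intro continuous_on_diff continuous_on_compose2[OF continuous_on_subset[OF w_cont sub]]
            continuous_on_compose2[OF Z_cont] continuous_on_Pair continuous_on_id continuous_on_const) auto
      \<comment> \<open>The time of largest error. Its size \<open>m\<close> bounds the error at
        every time, so the integral inequality becomes an inequality for the number \<open>m\<close>
        alone.\<close>
      obtain \<tau>0 where \<tau>0: "\<tau>0 \<in> ?I" "\<And>\<tau>. \<tau> \<in> ?I \<Longrightarrow> norm (?\<delta> \<tau>) \<le> norm (?\<delta> \<tau>0)"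
        using continuous_attains_sup[OF compact_Icc _ continuous_on_norm[OF \<delta>_cont]] T'(1) by auto
      define m where "m = norm (?\<delta> \<tau>0)"
      have R: "norm (G ((y, \<tau>), w (y, \<tau>)) - G ((x, \<tau>), w (x, \<tau>)) - H h ((x, \<tau>), Z h (x, \<tau>)))
          \<le> e1 * ((1 + C) * norm h + m) + K * m" if \<tau>: "\<tau> \<in> ?I" for \<tau>
      proof -
        let ?P = "((x, \<tau>), w (x, \<tau>))" and ?k = "((h, 0::real), ?\<Delta> \<tau>)"
        have P: "?P \<in> Cu" using \<tau> by (auto simp: Cu_def)
        have "norm (?\<Delta> \<tau>) < d / 2"
          using d1(2)[of "(x, \<tau>)" "(y, \<tau>)"] xX yX \<tau> y by (simp add: dist_Pair_Pair dist_norm)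
        moreover have "norm ?k \<le> norm h + norm (?\<Delta> \<tau>)" using norm_Pair_le[of "(h, 0::real)" "?\<Delta> \<tau>"] by simp
        ultimately have "norm ?k < d" using y by (simp add: h_def)
        from d(2)[OF P this] have 1: "norm (G ((y, \<tau>), w (y, \<tau>)) - G ?P - frechet_derivative G (at ?P) ?k) \<le> e1 * norm ?k"
          by (simp add: h_def)
        have "norm (?\<Delta> \<tau>) \<le> norm (Z h (x, \<tau>)) + norm (?\<delta> \<tau>)"
          using norm_triangle_ineq[of "Z h (x, \<tau>)" "?\<delta> \<tau>"] by simp
        also have "\<dots> \<le> C * norm h + m" using C[OF \<tau>] \<tau>0(2)[OF \<tau>] by (intro add_mono) (auto simp: m_def)
        finally have "norm ?k \<le> (1 + C) * norm h + m"
          using \<open>norm ?k \<le> norm h + norm (?\<Delta> \<tau>)\<close> by (simp add: algebra_simps)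
        then have 2: "e1 * norm ?k \<le> e1 * ((1 + C) * norm h + m)" using e1 by (intro mult_left_mono) auto
        have pXI: "(x, \<tau>) \<in> ?X \<times> ?I" using xX \<tau> by simp
        have "H h ((x, \<tau>), ?\<Delta> \<tau>) - H h ((x, \<tau>), Z h (x, \<tau>)) = ?DG (x, \<tau>) (0, ?\<delta> \<tau>)"
          by (rule H_diff[OF pXI])
        then have "norm (H h ((x, \<tau>), ?\<Delta> \<tau>) - H h ((x, \<tau>), Z h (x, \<tau>))) \<le> K * norm (?\<delta> \<tau>)"
          using bound[of "(x, \<tau>)"] pXI sub by fastforce
        also have "\<dots> \<le> K * m" using \<tau>0(2)[OF \<tau>] K by (intro mult_left_mono) (auto simp: m_def)
        finally have 3: "norm (frechet_derivative G (at ?P) ?k - H h ((x, \<tau>), Z h (x, \<tau>))) \<le> K * m"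
          by (simp add: H_def)
        have "norm (G ((y, \<tau>), w (y, \<tau>)) - G ?P - H h ((x, \<tau>), Z h (x, \<tau>)))
           \<le> norm (G ((y, \<tau>), w (y, \<tau>)) - G ?P - frechet_derivative G (at ?P) ?k)
            + norm (frechet_derivative G (at ?P) ?k - H h ((x, \<tau>), Z h (x, \<tau>)))"
          by (rule order_trans[OF _ norm_triangle_ineq]) simp
        then show ?thesis using 1 2 3 by linarith
      qed
      let ?i1 = "\<lambda>s. \<tau>0 *\<^sub>R G ((y, s * \<tau>0), w (y, s * \<tau>0))" and ?i2 = "\<lambda>s. \<tau>0 *\<^sub>R G ((x, s * \<tau>0), w (x, s * \<tau>0))"
        and ?i3 = "\<lambda>s. \<tau>0 *\<^sub>R H h ((x, s * \<tau>0), Z h (x, s * \<tau>0))"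
      have Gc: "continuous_on D G" using G Ck_on_continuous by blast
      have wc: "continuous_on (?X \<times> ?I) w" by (rule continuous_on_subset[OF w_cont sub])
      have i1: "continuous_on {0..1} ?i1" and i2: "continuous_on {0..1} ?i2"
        using sub w_D in_XI[OF _ \<tau>0(1)] xX yX by (auto intro!: continuous_integrand[OF Gc wc])
      have i3: "continuous_on {0..1} ?i3" by (rule int[OF xX \<tau>0(1) Z_cont])
      have \<tau>0': "\<tau>0 \<in> {-T<..<T}" and xy: "x \<in> Om" "y \<in> Om" using \<tau>0(1) T' xX yX Om(2) by auto
      have "?\<delta> \<tau>0 = (w0 y - w0 x - frechet_derivative w0 (at x) h) + integral {0..1} (\<lambda>s. ?i1 s - ?i2 s - ?i3 s)"
        using i1 i2 i3 w[OF xy(1) \<tau>0'] w[OF xy(2) \<tau>0'] Z[OF xX \<tau>0(1), of h]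
        by (simp add: integral_diff integrable_continuous_interval integrable_diff)
      moreover have "norm (integral {0..1} (\<lambda>s. ?i1 s - ?i2 s - ?i3 s)) \<le> T' * (e1 * ((1 + C) * norm h + m) + K * m) * (1 - 0)"
      proof (rule integral_bound)
        show "continuous_on {0..1} (\<lambda>s. ?i1 s - ?i2 s - ?i3 s)" by (intro continuous_on_diff i1 i2 i3)
        fix s :: real assume s: "s \<in> {0..1}"
        have "?i1 s - ?i2 s - ?i3 s = \<tau>0 *\<^sub>R (G ((y, s * \<tau>0), w (y, s * \<tau>0)) - G ((x, s * \<tau>0), w (x, s * \<tau>0)) - H h ((x, s * \<tau>0), Z h (x, s * \<tau>0)))"
          by (simp add: scaleR_diff_right)
        moreover have "s * \<tau>0 \<in> ?I" using in_XI[OF xX \<tau>0(1) s] by simp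
        ultimately show "norm (?i1 s - ?i2 s - ?i3 s) \<le> T' * (e1 * ((1 + C) * norm h + m) + K * m)"
          using R[of "s * \<tau>0"] \<tau>0(1) T'(1) by (auto intro!: mult_mono simp: abs_le_iff)
      qed simp
      moreover have "norm (w0 y - w0 x - frechet_derivative w0 (at x) h) \<le> e1 * norm h"
        using d0(2)[of y] y by (simp add: h_def)
      ultimately have "m \<le> e1 * norm h + T' * (e1 * ((1 + C) * norm h + m) + K * m)"
        unfolding m_def by (smt (verit) norm_triangle_ineq mult_cancel_left1)
      also have "\<dots> = e1 * (1 + T' * (1 + C)) * norm h + (e1 * T') * m + (K * T') * m" by (simp add: algebra_simps)
      also have "\<dots> \<le> e1 * (1 + T' * (1 + C)) * norm h + (1/4) * m + (1/2) * m"
        using e1b KT' by (intro add_mono mult_right_mono order_refl) (auto simp: m_def)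
      finally have "m \<le> 4 * e1 * (1 + T' * (1 + C)) * norm h" by (simp add: algebra_simps)
      also have "\<dots> \<le> e * norm h" using e1a by (intro mult_right_mono) auto
      finally show "norm (w (y, t) - w (x, t) - Z (y - x) (x, t)) \<le> e * norm (y - x)"
        using \<tau>0(2)[OF t] by (simp add: m_def h_def)
    qed
  qed
  show thesis
    by (rule that[of Z, OF Z_cont _ deriv]) (use Z in \<open>simp add: H_def\<close>)
qed

text \<open>Computes a derivative from values on one line through \<open>x\<close>. It serves the
  linearized equation, which is affine in the unknown, the symbols of a Berwald connection, which
  enter linearly in y, and functions independent of a coordinate.\<close>

lemma affine_directional_derivative:
  assumes "f differentiable (at x)" "open S" "x \<in> S"
    and "\<And>t::real. x + t *\<^sub>R v \<in> S \<Longrightarrow> f (x + t *\<^sub>R v) = f x + t *\<^sub>R c"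
  shows "frechet_derivative f (at x) v = c"
proof -
  have "((\<lambda>t. x + t *\<^sub>R v) has_derivative (\<lambda>r. r *\<^sub>R v)) (at 0)"
    by (auto intro!: derivative_eq_intros)
  moreover have "(f has_derivative frechet_derivative f (at x)) (at (x + 0 *\<^sub>R v))"
    using differentiable_frechetD[OF assms(1)] by simp
  ultimately have "((\<lambda>t. f (x + t *\<^sub>R v)) has_derivative (\<lambda>r. frechet_derivative f (at x) (r *\<^sub>R v))) (at 0)"
    by (rule has_derivative_compose)
  moreover have "open ((\<lambda>t. x + t *\<^sub>R v) -` S)"
    by (intro open_vimage assms(2) continuous_intros)
  ultimately have "((\<lambda>t. f x + t *\<^sub>R c) has_derivative (\<lambda>r. frechet_derivative f (at x) (r *\<^sub>R v))) (at 0)"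
    by (rule has_derivative_transform_within_open) (use assms(3,4) in auto)
  moreover have "((\<lambda>t. f x + t *\<^sub>R c) has_derivative (\<lambda>r. r *\<^sub>R c)) (at 0)"
    by (auto intro!: derivative_eq_intros)
  ultimately have "(\<lambda>r. frechet_derivative f (at x) (r *\<^sub>R v)) = (\<lambda>r. r *\<^sub>R c)"
    by (rule has_derivative_unique)
  from fun_cong[OF this, of 1] show ?thesis by simp
qed

text \<open>Induction on the order. The derivative of \<open>w\<close> in t is \<open>G\<close>
  along \<open>w\<close>; its derivative in x solves the linearized equation, which satisfies the
  same hypotheses with the same \<open>K\<close> and one order less. The bound is assumed only where
  \<open>G\<close> is differentiable because the last linearized right-hand side is merely
  continuous.\<close>

lemma ode_Ck:
  fixes G :: "('p::euclidean_space \<times> real) \<times> 'w::euclidean_space \<Rightarrow> 'w"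
  assumes Om: "open Om" and T: "0 < T" and K: "0 \<le> K" "K * T \<le> 1/2"
    and D: "open D" and G: "Ck_on k G D"
    and w_cont: "continuous_on (Om \<times> {-T<..<T}) w" and w_D: "\<And>p. p \<in> Om \<times> {-T<..<T} \<Longrightarrow> (p, w p) \<in> D"
    and w: "\<And>x t. x \<in> Om \<Longrightarrow> t \<in> {-T<..<T} \<Longrightarrow> w (x, t) = w0 x + integral {0..1} (\<lambda>s. t *\<^sub>R G ((x, s * t), w (x, s * t)))"
    and bound: "\<And>p v. p \<in> Om \<times> {-T<..<T} \<Longrightarrow> G differentiable (at (p, w p)) \<Longrightarrow>
      norm (frechet_derivative G (at (p, w p)) (0, v)) \<le> K * norm v"
    and w0: "Ck_on k w0 Om"
  shows "Ck_on k w (Om \<times> {-T<..<T})"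
  using D G w_cont w_D w bound w0
proof (induction k arbitrary: D G w w0)
  case 0
  then show ?case by simp
next
  case (Suc k D G w w0)
  let ?Om = "Om \<times> {-T<..<T}"
  let ?DG = "\<lambda>p. frechet_derivative G (at (p, w p))"
  have opn: "open ?Om" using Om by (intro open_Times) auto
  have G1: "Ck_on 1 G D" using Ck_on_le[OF Suc.prems(2), of 1] by simp
  have w01: "Ck_on 1 w0 Om" using Ck_on_le[OF Suc.prems(7), of 1] by simp
  have Gd: "(G has_derivative ?DG p) (at (p, w p))" if "p \<in> ?Om" for p
    using Ck_on_1_has_derivative[OF G1 Suc.prems(4)[OF that]] .
  then have Gdiff: "G differentiable (at (p, w p))" if "p \<in> ?Om" for p using that by (auto simp: differentiable_def)
  have bnd: "norm (?DG p (0, v)) \<le> K * norm v" if "p \<in> ?Om" for p v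
    using Suc.prems(6)[OF that Gdiff[OF that]] .
  have Gc: "continuous_on D G" using Suc.prems(2) Ck_on_continuous by blast
  have wk: "Ck_on k w ?Om"
    by (rule Suc.IH[OF Suc.prems(1) Ck_on_Suc_imp[OF Suc.prems(2)] Suc.prems(3-6) Ck_on_Suc_imp[OF Suc.prems(7)]])
  \<comment> \<open>Defined as the parameter derivative itself, not as a solution: the solutions
    found on compact pieces coincide with it, which makes them agree on overlaps.\<close>
  define z where "z e p = frechet_derivative (\<lambda>x. w (x, snd p)) (at (fst p)) e" for e p
  have local: "\<exists>r T' Z. 0 < r \<and> \<bar>t\<bar> < T' \<and> T' < T \<and> cball x r \<subseteq> Om \<and>
      (\<forall>h. continuous_on (cball x r \<times> {-T'..T'}) (Z h)) \<and>
      (\<forall>h. \<forall>t'\<in>{-T'..T'}. Z h (x, t') = frechet_derivative w0 (at x) h +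
        integral {0..1} (\<lambda>s. t' *\<^sub>R ?DG (x, s * t') ((h, 0), Z h (x, s * t')))) \<and>
      (\<forall>x'\<in>ball x r. \<forall>t'\<in>{-T'..T'}. ((\<lambda>x. w (x, t')) has_derivative (\<lambda>h. Z h (x', t'))) (at x'))"
    if x: "x \<in> Om" and t: "t \<in> {-T<..<T}" for x t
  proof -
    obtain r where r: "r > 0" "cball x r \<subseteq> Om" using Om x open_contains_cball by blast
    obtain T' where T': "\<bar>t\<bar> < T'" "T' < T" using t by (metis abs_less_iff dense greaterThanLessThan_iff minus_less_iff)
    have T'0: "0 \<le> T'" using T' by linarith
    obtain Z where Z1: "\<And>h. continuous_on (cball x r \<times> {-T'..T'}) (Z h)"
      and Z2: "\<And>h x' t. x' \<in> cball x r \<Longrightarrow> t \<in> {-T'..T'} \<Longrightarrow> Z h (x', t) = frechet_derivative w0 (at x') h +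
       integral {0..1} (\<lambda>s. t *\<^sub>R frechet_derivative G (at ((x', s * t), w (x', s * t))) ((h, 0), Z h (x', s * t)))"
      and Z3: "\<And>x' t. x' \<in> ball x r \<Longrightarrow> t \<in> {-T'..T'} \<Longrightarrow> ((\<lambda>x. w (x, t)) has_derivative (\<lambda>h. Z h (x', t))) (at x')"
      using ode_variation[OF Om r(2,1) T'0 T'(2) K Suc.prems(1) G1 Suc.prems(3,4,5) bnd w01] by blast
    have "x \<in> cball x r" using r(1) by simp
    with r T' Z1 Z2[OF this] Z3 show ?thesis by blast
  qed
  have z_eqZ: "z h p = c" if "((\<lambda>x. w (x, snd p)) has_derivative f') (at (fst p))" "f' h = c" for h p c f'
    unfolding z_def using frechet_derivative_eqI[OF that(1)] that(2) by simp
  have z_props: "z h (x, t) = frechet_derivative w0 (at x) h +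
        integral {0..1} (\<lambda>s. t *\<^sub>R ?DG (x, s * t) ((h, 0), z h (x, s * t)))" (is ?eq)
      "((\<lambda>x. w (x, t)) has_derivative (\<lambda>h. z h (x, t))) (at x)" (is ?der)
      "\<exists>W. open W \<and> (x, t) \<in> W \<and> Ck_on 0 (z h) (?Om \<inter> W)" (is ?cont)
    if x: "x \<in> Om" and t: "t \<in> {-T<..<T}" for x t h
  proof -
    obtain r T' Z where r: "0 < r" "\<bar>t\<bar> < T'" "T' < T" "cball x r \<subseteq> Om"
      and Z1: "\<And>h. continuous_on (cball x r \<times> {-T'..T'}) (Z h)"
      and Z2: "\<And>h t'. t' \<in> {-T'..T'} \<Longrightarrow> Z h (x, t') = frechet_derivative w0 (at x) h +
        integral {0..1} (\<lambda>s. t' *\<^sub>R ?DG (x, s * t') ((h, 0), Z h (x, s * t')))"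
      and Z3: "\<And>x' t'. x' \<in> ball x r \<Longrightarrow> t' \<in> {-T'..T'} \<Longrightarrow> ((\<lambda>x. w (x, t')) has_derivative (\<lambda>h. Z h (x', t'))) (at x')"
      using local[OF x t] by blast
    have zZ: "z h (x', t') = Z h (x', t')" if "x' \<in> ball x r" "t' \<in> {-T'..T'}" for h x' t'
      using z_eqZ[of "(x', t')" "\<lambda>h. Z h (x', t')"] Z3[OF that] by simp
    have xr: "x \<in> ball x r" and tT: "t \<in> {-T'..T'}" using r by (auto simp: abs_less_iff)
    have "integral {0..1} (\<lambda>s. t *\<^sub>R ?DG (x, s * t) ((h, 0), Z h (x, s * t)))
        = integral {0..1} (\<lambda>s. t *\<^sub>R ?DG (x, s * t) ((h, 0), z h (x, s * t)))"
      using zZ[OF xr] scaled_time_in(1)[OF _ _ tT] by (intro integral_cong) auto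
    then show ?eq using Z2[OF tT] zZ[OF xr tT] by simp
    show ?der using Z3[OF xr tT] zZ[OF xr tT] by simp
    show ?cont
    proof (intro exI conjI)
      show "open (ball x r \<times> {-T'<..<T'})" by (intro open_Times) auto
      show "(x, t) \<in> ball x r \<times> {-T'<..<T'}" using r by (auto simp: abs_less_iff)
      have "continuous_on (ball x r \<times> {-T'<..<T'}) (Z h)"
        by (rule continuous_on_subset[OF Z1]) auto
      then have "continuous_on (ball x r \<times> {-T'<..<T'}) (z h)"
        by (rule continuous_on_eq) (auto simp: zZ)
      then show "Ck_on 0 (z h) (?Om \<inter> ball x r \<times> {-T'<..<T'})"
        by (auto intro: continuous_on_subset)
    qed
  qed
  have z_cont: "continuous_on ?Om (z h)" for h
  proof -
    have "Ck_on 0 (z h) ?Om"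
      by (rule Ck_on_open_cover) (use z_props(3) in \<open>auto simp del: Ck_on.simps\<close>)
    then show ?thesis by simp
  qed
  have z_Ck: "Ck_on k (z e) ?Om" for e
  proof (rule Suc.IH[where D = "?Om \<times> UNIV" and G = "\<lambda>q. ?DG (fst q) ((e, 0), snd q)"
        and ?w0.0 = "\<lambda>x. frechet_derivative w0 (at x) e"])
    let ?S = "?Om \<times> (UNIV :: 'w set)"
    show S: "open ?S" by (rule open_Times[OF opn open_UNIV])
    have DGk: "Ck_on k (\<lambda>q. ?DG (fst q) c) ?S" for c
    proof (rule Ck_on_compose[where g = "\<lambda>q. (fst q, w (fst q))"])
      show "Ck_on k (\<lambda>q. (fst q, w (fst q))) ?S"
        by (rule Ck_on_Pair[OF S Ck_on_bounded_linear[OF S bounded_linear_fst]],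
            rule Ck_on_compose[OF S Ck_on_bounded_linear[OF S bounded_linear_fst] wk]) auto
      show "Ck_on k (\<lambda>P. frechet_derivative G (at P) c) D"
        using Suc.prems(2) unfolding Ck_on.simps by blast
    qed (use S Suc.prems(4) in auto)
    have Ck: "Ck_on k (\<lambda>q. ?DG (fst q) ((e, 0), 0) + (\<Sum>b\<in>Basis. (snd q \<bullet> b) *\<^sub>R ?DG (fst q) (0, b))) ?S"
      by (intro Ck_on_add Ck_on_sum S DGk Ck_on_bounded_bilinear[OF S bounded_bilinear_scaleR]
          Ck_on_bounded_linear bounded_linear_compose[OF bounded_linear_inner_left bounded_linear_snd])
    have split: "?DG p ((e, 0), \<zeta>) = ?DG p ((e, 0), 0) + (\<Sum>b\<in>Basis. (\<zeta> \<bullet> b) *\<^sub>R ?DG p (0, b))"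
      if "p \<in> ?Om" for p \<zeta>
    proof -
      note lin = has_derivative_linear[OF Gd[OF that]]
      have "?DG p ((e, 0), \<zeta>) = ?DG p ((e, 0), 0) + ?DG p (0, \<zeta>)"
        using linear_add[OF lin, of "((e, 0), 0)" "(0, \<zeta>)"] by simp
      also have "(0, \<zeta>) = (\<Sum>b\<in>Basis. (\<zeta> \<bullet> b) *\<^sub>R ((0, 0) :: 'p \<times> real, b))"
        by (simp add: prod_eq_iff fst_sum snd_sum euclidean_representation zero_prod_def[symmetric])
      also have "?DG p \<dots> = (\<Sum>b\<in>Basis. (\<zeta> \<bullet> b) *\<^sub>R ?DG p (0, b))"
        by (simp only: linear_sum[OF lin] linear_scale[OF lin] zero_prod_def[symmetric])
      finally show ?thesis .
    qed
    have eq: "?DG (fst q) ((e, 0), 0) + (\<Sum>b\<in>Basis. (snd q \<bullet> b) *\<^sub>R ?DG (fst q) (0, b)) = ?DG (fst q) ((e, 0), snd q)"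
      if "q \<in> ?S" for q
      by (rule split[symmetric]) (use that in auto)
    show "Ck_on k (\<lambda>q. ?DG (fst q) ((e, 0), snd q)) ?S"
      by (rule Ck_on_cong[OF S eq Ck])
    show "continuous_on ?Om (z e)" by (rule z_cont)
    show "(p, z e p) \<in> ?S" if "p \<in> ?Om" for p using that by simp
    show "z e (x, t) = frechet_derivative w0 (at x) e +
        integral {0..1} (\<lambda>s. t *\<^sub>R ?DG (fst ((x, s * t), z e (x, s * t))) ((e, 0), snd ((x, s * t), z e (x, s * t))))"
      if "x \<in> Om" "t \<in> {-T<..<T}" for x t
      using z_props(1)[OF that] by simp
    show "Ck_on k (\<lambda>x. frechet_derivative w0 (at x) e) Om" using Suc.prems(7) by simp
    fix p v assume p: "p \<in> ?Om" and d: "(\<lambda>q. ?DG (fst q) ((e, 0), snd q)) differentiable (at (p, z e p))"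
    \<comment> \<open>The linearized right-hand side is affine in the unknown with slope
      \<open>?DG p (0, v)\<close>. Hence its derivative in that direction is bounded by the old
      constant \<open>K\<close>, and the time interval does not shrink in the induction.\<close>
    have "?DG p ((e, 0), \<zeta> + t *\<^sub>R v) = ?DG p ((e, 0), \<zeta>) + t *\<^sub>R ?DG p (0, v)" for \<zeta> t
    proof -
      note lin = has_derivative_linear[OF Gd[OF p]]
      have "?DG p (((e, 0), \<zeta>) + t *\<^sub>R (0, v)) = ?DG p ((e, 0), \<zeta>) + t *\<^sub>R ?DG p (0, v)"
        by (simp only: linear_add[OF lin] linear_scale[OF lin])
      then show ?thesis by simp
    qed
    then have "frechet_derivative (\<lambda>q. ?DG (fst q) ((e, 0), snd q)) (at (p, z e p)) (0, v) = ?DG p (0, v)"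
      by (intro affine_directional_derivative[OF d open_UNIV]) simp_all
    then show "norm (frechet_derivative (\<lambda>q. ?DG (fst q) ((e, 0), snd q)) (at (p, z e p)) (0, v)) \<le> K * norm v"
      using bnd[OF p] by simp
  qed
  show ?case
  proof (rule Ck_on_SucI[OF opn])
    fix p assume p: "p \<in> ?Om"
    obtain x t where pxt: "p = (x, t)" "x \<in> Om" "t \<in> {-T<..<T}" using p by auto
    have gc: "continuous_on ?Om (\<lambda>p. G (p, w p))"
      by (rule continuous_on_compose2[OF Gc]) (use Suc.prems(3,4) in \<open>auto intro!: continuous_intros\<close>)
    have wt: "((\<lambda>t. w (x, t)) has_derivative blinfun_apply (blinfun_scaleR_left (G ((x, t), w (x, t))))) (at t within {-T<..<T})"
      if "x \<in> Om" "t \<in> {-T<..<T}" for x t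
    proof -
      have "continuous_on {-T<..<T} (\<lambda>t. G ((x, t), w (x, t)))"
        by (rule continuous_on_compose2[OF gc]) (use that in \<open>auto intro!: continuous_intros\<close>)
      from scaled_integral_has_derivative[OF this that(2)]
      have "((\<lambda>t. w0 x + integral {0..1} (\<lambda>s. t *\<^sub>R G ((x, s * t), w (x, s * t)))) has_vector_derivative G ((x, t), w (x, t))) (at t)"
        by (rule has_vector_derivative_add[OF has_vector_derivative_const, of _ _ _ "w0 x", unfolded add_0_left])
      then have "((\<lambda>t. w (x, t)) has_vector_derivative G ((x, t), w (x, t))) (at t)"
        by (rule has_vector_derivative_transform_within_open[of _ _ _ "{-T<..<T}"])
          (use that Suc.prems(5) in auto)
      then show ?thesis using has_derivative_at_withinI by (auto simp: has_vector_derivative_def)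
    qed
    \<comment> \<open>Partial derivatives give the total derivative as soon as one of them, here the
      one in time, is continuous.\<close>
    have "((\<lambda>(x, t). w (x, t)) has_derivative (\<lambda>(h, \<tau>). z h (x, t) + blinfun_apply (blinfun_scaleR_left (G ((x, t), w (x, t)))) \<tau>)) (at (x, t) within ?Om)"
    proof (rule has_derivative_partialsI[where fy = "\<lambda>x t. blinfun_scaleR_left (G ((x, t), w (x, t)))"])
      show "((\<lambda>x. w (x, t)) has_derivative (\<lambda>h. z h (x, t))) (at x within Om)"
        by (rule has_derivative_at_withinI[OF z_props(2)[OF pxt(2,3)]])
      show "continuous (at (x, t) within ?Om) (\<lambda>(x, t). blinfun_scaleR_left (G ((x, t), w (x, t))))"
      proof -
        have "continuous_on ?Om (\<lambda>p. blinfun_scaleR_left (G (p, w p)))"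
          by (rule bounded_linear.continuous_on[OF bounded_linear_blinfun_scaleR_left gc])
        then have "continuous (at (x, t) within ?Om) (\<lambda>p. blinfun_scaleR_left (G (p, w p)))"
          using pxt by (auto simp: continuous_on_eq_continuous_within)
        then show ?thesis by (simp add: case_prod_unfold)
      qed
    qed (use wt pxt in auto)
    then show "(w has_derivative (\<lambda>v. z (fst v) p + snd v *\<^sub>R G (p, w p))) (at p)"
      unfolding at_within_open[OF p[unfolded pxt(1)] opn] by (simp add: case_prod_unfold pxt(1))
  next
    fix v
    show "Ck_on k (\<lambda>p. z (fst v) p + snd v *\<^sub>R G (p, w p)) ?Om"
    proof (intro Ck_on_add opn z_Ck Ck_on_bounded_bilinear[OF opn bounded_bilinear_scaleR] Ck_on_const)
      show "Ck_on k (\<lambda>p. G (p, w p)) ?Om"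
        by (rule Ck_on_compose[OF opn _ Ck_on_Suc_imp[OF Suc.prems(2)]])
          (use Suc.prems(4) in \<open>auto intro!: Ck_on_Pair opn wk Ck_on_ident\<close>)
    qed
  qed
qed

text \<open>Picard iteration wants a globally Lipschitz field, so \<open>V\<close> is composed with
  the projection \<open>P\<close> onto a closed ball. For short times solutions that start near the
  centre stay in the ball, where \<open>P\<close> is the identity; they then solve the original
  equation and \<open>ode_Ck\<close> applies.\<close>

lemma local_flow:
  fixes V :: "'a::euclidean_space \<Rightarrow> 'a"
  assumes N: "open N" "q \<in> N" and V: "smooth_on V N"
  obtains r T w where "0 < r" "0 < T" "smooth_on w (ball q r \<times> {-T<..<T})"
    "\<And>x t. x \<in> ball q r \<Longrightarrow> t \<in> {-T<..<T} \<Longrightarrow> w (x, t) \<in> N"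
    "\<And>x. x \<in> ball q r \<Longrightarrow> w (x, 0) = x"
    "\<And>x t. x \<in> ball q r \<Longrightarrow> t \<in> {-T<..<T} \<Longrightarrow> ((\<lambda>t. w (x, t)) has_vector_derivative V (w (x, t))) (at t)"
proof -
  obtain R where R: "R > 0" "cball q R \<subseteq> N" using N open_contains_cball by blast
  define r where "r = R / 2"
  have r: "r > 0" using R by (simp add: r_def)
  let ?B = "cball q R"
  have V1: "Ck_on 1 V N" by (rule smooth_onD[OF V])
  obtain K where K: "0 \<le> K" "\<And>P k. P \<in> ?B \<Longrightarrow> norm (frechet_derivative V (at P) k) \<le> K * norm k"
    using derivative_bounded_on_compact[OF V1 compact_cball R(2)] by blast
  have Vc: "continuous_on ?B V" by (rule continuous_on_subset[OF smooth_on_continuous[OF V] R(2)])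
  have "bounded (V ` ?B)" by (intro compact_imp_bounded compact_continuous_image Vc compact_cball)
  then obtain B where B: "B > 0" "\<And>x. x \<in> ?B \<Longrightarrow> norm (V x) \<le> B" by (auto simp: bounded_pos)
  \<comment> \<open>The first bound gives the contraction constant K T \<le> 1/2. The second gives B
    T < r = R/2, so a solution starting within R/2 of \<open>q\<close> moves less than R/2.\<close>
  define T where "T = min (1 / (2 * (K + 1))) (r / (2 * B))"
  have T: "T > 0" using K B r by (auto simp: T_def)
  have KT: "K * T \<le> 1/2"
  proof -
    have "T \<le> 1 / (2 * (K + 1))" by (simp add: T_def)
    then have "T * (2 * (K + 1)) \<le> 1" using K by (simp add: pos_le_divide_eq)
    then show ?thesis using T by (simp add: algebra_simps)
  qed
  have BT: "B * T < r"
  proof -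
    have "T \<le> r / (2 * B)" by (simp add: T_def)
    then have "T * (2 * B) \<le> r" using B by (simp add: pos_le_divide_eq)
    then show ?thesis using T B r by (simp add: algebra_simps)
  qed
  have lipV: "norm (V x - V y) \<le> K * norm (x - y)" if "x \<in> ?B" "y \<in> ?B" for x y
  proof (rule differentiable_bound[OF convex_cball _ _ that])
    show "(V has_derivative frechet_derivative V (at x)) (at x within ?B)" if "x \<in> ?B" for x
      using that R(2) by (blast intro: has_derivative_at_withinI[OF smooth_on_has_derivative[OF V]])
    show "onorm (frechet_derivative V (at x)) \<le> K" if "x \<in> ?B" for x
      using K(2)[OF that] by (intro onorm_le)
  qed
  define P where "P = closest_point ?B"
  have Pc: "continuous_on UNIV P" unfolding P_def using R by (intro continuous_on_closest_point) auto
  have P_in: "P x \<in> ?B" for x unfolding P_def using R by (intro closest_point_in_set) auto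
  have P_lip: "norm (P x - P y) \<le> norm (x - y)" for x y
    unfolding P_def dist_norm[symmetric] using R by (intro closest_point_lipschitz) auto
  have P_id: "P x = x" if "x \<in> ?B" for x unfolding P_def by (rule closest_point_self[OF that])
  let ?X = "cball q r"
  obtain w where wc: "continuous_on (?X \<times> {-T..T}) w"
    and w: "\<And>x t. x \<in> ?X \<Longrightarrow> t \<in> {-T..T} \<Longrightarrow> w (x, t) = x + integral {0..1} (\<lambda>s. t *\<^sub>R V (P (w (x, s * t))))"
  proof (rule picard_solution[where X = ?X and T = T and G = "\<lambda>p. V (P (snd p))" and K = K and ?w0.0 = "\<lambda>x. x"])
    show "continuous_on ((?X \<times> {-T..T}) \<times> UNIV) (\<lambda>p. V (P (snd p)))"
      using P_in by (intro continuous_on_compose2[OF Vc] continuous_on_compose2[OF Pc] continuous_on_snd continuous_on_id) auto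
    show "norm (V (P (snd (p, v))) - V (P (snd (p, v')))) \<le> K * norm (v - v')" for p :: "'a \<times> real" and v v'
      using order_trans[OF lipV[OF P_in P_in] mult_left_mono[OF P_lip K(1)]] by simp
  qed (use r T K KT in \<open>auto intro!: continuous_on_id\<close>)
  have near: "norm (w (x, t) - x) \<le> B * T" if "x \<in> ?X" "t \<in> {-T..T}" for x t
  proof -
    have "norm (integral {0..1} (\<lambda>s. t *\<^sub>R V (P (w (x, s * t))))) \<le> (B * T) * (1 - 0)"
    proof (rule integral_bound)
      show "continuous_on {0..1} (\<lambda>s. t *\<^sub>R V (P (w (x, s * t))))"
        using that P_in scaled_time_in(1)[OF _ _ that(2)]
        by (intro continuous_on_scaleR continuous_on_const continuous_on_compose2[OF Vc]
            continuous_on_compose2[OF Pc] continuous_on_compose2[OF wc] continuous_on_Pair continuous_intros) auto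
      show "norm (t *\<^sub>R V (P (w (x, s * t)))) \<le> B * T" for s
        using that B(2)[OF P_in, of "w (x, s * t)"] B(1) by (simp add: mult.commute[of B] abs_le_iff mult_mono)
    qed simp
    then show ?thesis using w[OF that] by simp
  qed
  have inB: "w (x, t) \<in> ball q R" if "x \<in> ?X" "t \<in> {-T..T}" for x t
  proof -
    have "dist q (w (x, t)) \<le> dist q x + norm (w (x, t) - x)"
      using dist_triangle[of q "w (x, t)" x] by (simp add: dist_norm norm_minus_commute)
    also have "\<dots> < r + r" using near[OF that] BT that(1) by simp
    finally show ?thesis by (simp add: r_def)
  qed
  have sub: "ball q r \<times> {-T<..<T} \<subseteq> ?X \<times> {-T..T}" by auto
  have weq: "w (x, t) = x + integral {0..1} (\<lambda>s. t *\<^sub>R V (w (x, s * t)))" if "x \<in> ball q r" "t \<in> {-T<..<T}" for x t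
  proof -
    have xt: "x \<in> ?X" "t \<in> {-T..T}" using that by auto
    have "integral {0..1} (\<lambda>s. t *\<^sub>R V (P (w (x, s * t)))) = integral {0..1} (\<lambda>s. t *\<^sub>R V (w (x, s * t)))"
      using P_id inB[OF xt(1)] scaled_time_in(1)[OF _ _ xt(2)] by (intro integral_cong) (metis atLeastAtMost_iff ball_subset_cball subsetD)
    then show ?thesis using w[OF xt] by simp
  qed
  have wc': "continuous_on (ball q r \<times> {-T<..<T}) w" by (rule continuous_on_subset[OF wc sub])
  have "Ck_on k w (ball q r \<times> {-T<..<T})" for k
  proof (rule ode_Ck[where G = "\<lambda>p. V (snd p)" and D = "UNIV \<times> ball q R" and K = K and ?w0.0 = "\<lambda>x. x"])
    have D: "open ((UNIV :: ('a \<times> real) set) \<times> ball q R)" by (intro open_Times) auto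
    then show "open ((UNIV :: ('a \<times> real) set) \<times> ball q R)" .
    show "Ck_on k (\<lambda>p. V (snd p)) ((UNIV :: ('a \<times> real) set) \<times> ball q R)"
      by (rule Ck_on_compose[OF D Ck_on_bounded_linear[OF D bounded_linear_snd] smooth_onD[OF V]])
        (use R ball_subset_cball in fastforce)
    show "norm (frechet_derivative (\<lambda>p. V (snd p)) (at (p, w p)) (0, v)) \<le> K * norm v"
      if p: "p \<in> ball q r \<times> {-T<..<T}" for p v
    proof -
      have wB: "w p \<in> ?B" using inB[of "fst p" "snd p"] p sub by (auto simp: mem_Times_iff)
      have "((\<lambda>p. V (snd p)) has_derivative (\<lambda>k. frechet_derivative V (at (w p)) (snd k))) (at (p, w p))"
        by (rule has_derivative_compose[OF bounded_linear_imp_has_derivative[OF bounded_linear_snd], unfolded snd_conv])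
          (use smooth_on_has_derivative[OF V] wB R(2) in auto)
      from frechet_derivative_eqI[OF this] show ?thesis using K(2)[OF wB] by simp
    qed
    show "(p, w p) \<in> UNIV \<times> ball q R" if "p \<in> ball q r \<times> {-T<..<T}" for p
      using inB[of "fst p" "snd p"] that sub by (auto simp: mem_Times_iff)
    show "w (x, t) = x + integral {0..1} (\<lambda>s. t *\<^sub>R V (snd ((x, s * t), w (x, s * t))))"
      if "x \<in> ball q r" "t \<in> {-T<..<T}" for x t using weq[OF that] by simp
  qed (use T K KT wc' in auto)
  then have sm: "smooth_on w (ball q r \<times> {-T<..<T})" by (simp add: smooth_on_def)
  show thesis
  proof (rule that[OF r T sm])
    show "w (x, t) \<in> N" if "x \<in> ball q r" "t \<in> {-T<..<T}" for x t
      using inB[of x t] that R(2) ball_subset_cball by fastforce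
    show "w (x, 0) = x" if "x \<in> ball q r" for x using weq[OF that, of 0] T by simp
    show "((\<lambda>t. w (x, t)) has_vector_derivative V (w (x, t))) (at t)" if xt: "x \<in> ball q r" "t \<in> {-T<..<T}" for x t
    proof -
      have "continuous_on {-T<..<T} (\<lambda>t. V (w (x, t)))"
      proof (rule continuous_on_compose2[OF Vc])
        show "continuous_on {-T<..<T} (\<lambda>t. w (x, t))"
          by (rule continuous_on_compose2[OF wc']) (use xt in \<open>auto intro!: continuous_intros\<close>)
        show "(\<lambda>t. w (x, t)) ` {-T<..<T} \<subseteq> ?B"
        proof
          fix y assume "y \<in> (\<lambda>t. w (x, t)) ` {-T<..<T}"
          then obtain t where "y = w (x, t)" "t \<in> {-T..T}" by auto
          moreover have "x \<in> ?X" using xt by simp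
          ultimately show "y \<in> ?B" using inB ball_subset_cball by blast
        qed
      qed
      from scaled_integral_has_derivative[OF this xt(2)]
      have "((\<lambda>t. x + integral {0..1} (\<lambda>s. t *\<^sub>R V (w (x, s * t)))) has_vector_derivative V (w (x, t))) (at t)"
        by (rule has_vector_derivative_add[OF has_vector_derivative_const, of _ _ _ x, unfolded add_0_left])
      then show ?thesis
        by (rule has_vector_derivative_transform_within_open[of _ _ _ "{-T<..<T}"]) (use xt weq in auto)
    qed
  qed
qed

section \<open>Potentials and straightening\<close>

text \<open>The Poincare lemma on a ball: \<open>B\<close> is integrated along rays from the centre
  and differentiated under the integral sign.\<close>

lemma closed_form_has_potential:
  fixes B :: "'a::euclidean_space \<Rightarrow> 'a"
  assumes B: "smooth_on B (ball q r)"
    and sym: "\<And>x v w. x \<in> ball q r \<Longrightarrow> frechet_derivative B (at x) v \<bullet> w = frechet_derivative B (at x) w \<bullet> v"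
  obtains u :: "'a \<Rightarrow> real" where "\<And>x. x \<in> ball q r \<Longrightarrow> (u has_derivative (\<lambda>v. B x \<bullet> v)) (at x)"
proof -
  let ?S = "ball q r" and ?y = "\<lambda>x t. q + t *\<^sub>R (x - q)"
  let ?DB = "\<lambda>x. frechet_derivative B (at x)"
  \<comment> \<open>By the symmetry hypothesis this is the gradient in x of the integrand. It is
    also the t-derivative of t B(q + t (x - q)), so its integral over the unit interval is
    B(x).\<close>
  define c where "c x t = t *\<^sub>R ?DB (?y x t) (x - q) + B (?y x t)" for x and t :: real
  define u where "u x = integral (cbox 0 1) (\<lambda>t. B (?y x t) \<bullet> (x - q))" for x
  have y: "?y x t \<in> ?S" if "x \<in> ?S" "t \<in> {0..1}" for x t
  proof -
    have "norm (t *\<^sub>R (x - q)) \<le> norm (x - q)" using that(2) by (simp add: mult_left_le_one_le)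
    then show ?thesis using that(1) by (simp add: dist_norm norm_minus_commute)
  qed
  have DB: "(B has_derivative ?DB x) (at x)" if "x \<in> ?S" for x
    by (rule smooth_on_has_derivative[OF B that])
  have y_cont: "continuous_on (?S \<times> cbox 0 1) (\<lambda>p. ?y (fst p) (snd p))"
    by (intro continuous_intros)
  have c_cont: "continuous_on (?S \<times> cbox 0 1) (\<lambda>p. c (fst p) (snd p))"
  proof -
    have "continuous_on (?S \<times> cbox 0 1) (\<lambda>p. snd p *\<^sub>R (\<Sum>b\<in>Basis. ((fst p - q) \<bullet> b) *\<^sub>R ?DB (?y (fst p) (snd p)) b) + B (?y (fst p) (snd p)))"
      using y by (intro continuous_on_add continuous_on_scaleR continuous_on_sum continuous_on_inner continuous_on_diff
          continuous_on_compose2[OF smooth_on_continuous[OF smooth_on_frechet[OF B]] y_cont]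
          continuous_on_compose2[OF smooth_on_continuous[OF B] y_cont] continuous_on_fst continuous_on_snd continuous_on_id continuous_on_const)
        auto
    moreover have "snd p *\<^sub>R (\<Sum>b\<in>Basis. ((fst p - q) \<bullet> b) *\<^sub>R ?DB (?y (fst p) (snd p)) b) + B (?y (fst p) (snd p)) = c (fst p) (snd p)"
      if "p \<in> ?S \<times> cbox 0 1" for p
    proof -
      have "?y (fst p) (snd p) \<in> ?S" using that y by auto
      note lin = has_derivative_linear[OF DB[OF this]]
      have "?DB (?y (fst p) (snd p)) (fst p - q) = (\<Sum>b\<in>Basis. ((fst p - q) \<bullet> b) *\<^sub>R ?DB (?y (fst p) (snd p)) b)"
        by (subst euclidean_representation[of "fst p - q", symmetric], simp only: linear_sum[OF lin] linear_scale[OF lin])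
      then show ?thesis by (simp add: c_def)
    qed
    ultimately show ?thesis by (rule continuous_on_eq)
  qed
  have deriv_line: "((\<lambda>x. B (?y x t) \<bullet> (x - q)) has_derivative blinfun_apply (blinfun_inner_right (c x t))) (at x)"
    if x: "x \<in> ?S" and t: "t \<in> {0..1}" for x t
  proof -
    have "((\<lambda>x. ?y x t) has_derivative (\<lambda>v. t *\<^sub>R v)) (at x)" by (auto intro!: derivative_eq_intros)
    from has_derivative_compose[OF this DB[OF y[OF x t]]]
    have "((\<lambda>x. B (?y x t)) has_derivative (\<lambda>v. ?DB (?y x t) (t *\<^sub>R v))) (at x)" .
    then have "((\<lambda>x. B (?y x t) \<bullet> (x - q)) has_derivative (\<lambda>v. B (?y x t) \<bullet> v + ?DB (?y x t) (t *\<^sub>R v) \<bullet> (x - q))) (at x)"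
      by (auto intro!: derivative_eq_intros)
    moreover have "B (?y x t) \<bullet> v + ?DB (?y x t) (t *\<^sub>R v) \<bullet> (x - q) = c x t \<bullet> v" for v
      using sym[OF y[OF x t], of v "x - q"] linear_scale[OF has_derivative_linear[OF DB[OF y[OF x t]]], of t v]
      by (simp add: c_def inner_add_left)
    ultimately show ?thesis by simp
  qed
  have "(u has_derivative (\<lambda>v. B x \<bullet> v)) (at x)" if x: "x \<in> ?S" for x
  proof -
    have cx: "continuous_on (cbox 0 1) (c x)"
      using x by (intro continuous_on_compose2[OF c_cont, of _ "\<lambda>t. (x, t)", simplified] continuous_intros) auto
    have "(u has_derivative integral (cbox 0 1) (\<lambda>t. blinfun_inner_right (c x t))) (at x within ?S)"
      unfolding u_def
    proof (rule leibniz_rule[where fx = "\<lambda>x t. blinfun_inner_right (c x t)"])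
      show "((\<lambda>x. B (?y x t) \<bullet> (x - q)) has_derivative blinfun_apply (blinfun_inner_right (c x t))) (at x within ?S)"
        if "x \<in> ?S" "t \<in> cbox 0 1" for x t
        using has_derivative_at_withinI[OF deriv_line] that by auto
      show "(\<lambda>t. B (?y x t) \<bullet> (x - q)) integrable_on cbox 0 1" if "x \<in> ?S" for x
        using that y by (intro integrable_continuous continuous_on_inner continuous_on_const
          continuous_on_compose2[OF smooth_on_continuous[OF B]] continuous_intros) auto
      show "continuous_on (?S \<times> cbox 0 1) (\<lambda>(x, t). blinfun_inner_right (c x t))"
        unfolding case_prod_unfold
        by (rule bounded_linear.continuous_on[OF bounded_linear_blinfun_inner_right c_cont])
    qed (use x in auto)
    then have 1: "(u has_derivative integral (cbox 0 1) (\<lambda>t. blinfun_inner_right (c x t))) (at x)"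
      using at_within_open[OF x open_ball] by simp
    have "blinfun_apply (integral (cbox 0 1) (\<lambda>t. blinfun_inner_right (c x t))) v = B x \<bullet> v" for v
    proof -
      have "continuous_on (cbox 0 1) (\<lambda>t. blinfun_inner_right (c x t))"
        by (rule bounded_linear.continuous_on[OF bounded_linear_blinfun_inner_right cx])
      then have "blinfun_apply (integral (cbox 0 1) (\<lambda>t. blinfun_inner_right (c x t))) v = integral (cbox 0 1) (\<lambda>t. c x t \<bullet> v)"
        by (subst blinfun_apply_integral) (auto intro: integrable_continuous_interval)
      also have "((\<lambda>t. c x t \<bullet> v) has_integral (1 *\<^sub>R B (?y x 1) \<bullet> v - 0 *\<^sub>R B (?y x 0) \<bullet> v)) {0..1}"
      proof (rule fundamental_theorem_of_calculus)
        fix t :: real assume t: "t \<in> {0..1}"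
        have "((\<lambda>t. ?y x t) has_derivative (\<lambda>s. s *\<^sub>R (x - q))) (at t)" by (auto intro!: derivative_eq_intros)
        from has_derivative_compose[OF this DB[OF y[OF x t]]]
        have "((\<lambda>t. B (?y x t)) has_derivative (\<lambda>s. s *\<^sub>R ?DB (?y x t) (x - q))) (at t)"
          by (simp add: linear_scale[OF has_derivative_linear[OF DB[OF y[OF x t]]]])
        then have "((\<lambda>t. t *\<^sub>R B (?y x t) \<bullet> v) has_derivative (\<lambda>s. s * (c x t \<bullet> v))) (at t)"
          by (auto intro!: derivative_eq_intros simp: c_def algebra_simps inner_add_left)
        then show "((\<lambda>t. t *\<^sub>R B (?y x t) \<bullet> v) has_vector_derivative c x t \<bullet> v) (at t within {0..1})"
          by (auto simp: has_vector_derivative_def intro: has_derivative_at_withinI)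
      qed simp
      then have "integral (cbox 0 1) (\<lambda>t. c x t \<bullet> v) = B x \<bullet> v"
        by (simp add: integral_unique cbox_interval)
      finally show ?thesis .
    qed
    then show ?thesis using 1 by (metis (no_types, lifting) ext)
  qed
  then show thesis using that by blast
qed

section \<open>Straightening a vector field\<close>

text \<open>Provides the initial frame for straightening: \<open>v\<close> will be the value of the
  field at the base point and \<open>b\<close> the gradient of the function to be kept as a
  coordinate. Being nonzero and orthogonal they are independent and extend to a basis.\<close>

lemma linear_iso_with_two_values:
  fixes v b :: "real^'n::finite" and iu iv :: 'n
  assumes "iu \<noteq> iv" "v \<noteq> 0" "b \<noteq> 0" "b \<bullet> v = 0"
  obtains f :: "real^'n \<Rightarrow> real^'n" where "linear f" "inj f" "f (axis iv 1) = v" "f (axis iu 1) = b"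
proof -
  have vb: "v \<noteq> b" using assms by auto
  have "independent {v, b}"
    using assms by (intro pairwise_orthogonal_independent) (auto simp: pairwise_def orthogonal_def inner_commute)
  then obtain B where B: "{v, b} \<subseteq> B" "independent B" "UNIV \<subseteq> span B"
    using maximal_independent_subset_extend[of "{v, b}" UNIV] by auto
  have cB: "card B = CARD('n)" "finite B"
    using basis_card_eq_dim[OF subset_UNIV B(3,2)] independent_imp_finite[OF B(2)] by auto
  have "card (UNIV - {iv, iu}) = card (B - {v, b})"
    using B(1) cB vb assms(1) by (simp add: card_Diff_subset)
  then obtain h where h: "bij_betw h (UNIV - {iv, iu}) (B - {v, b})"
    using finite_same_card_bij[of "UNIV - {iv, iu}" "B - {v, b}"] cB by auto
  define G where "G x = (if x = axis iv 1 then v else if x = axis iu 1 then b else h (SOME i. x = axis i 1))" for x :: "real^'n"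
  have ax: "axis i (1::real) = axis j 1 \<longleftrightarrow> i = j" for i j :: 'n by (simp add: axis_eq_axis)
  obtain f where f: "linear f" "\<And>x. x \<in> Basis \<Longrightarrow> f x = G x"
    using linear_independent_extend[OF independent_Basis, of G] by blast
  have fa: "f (axis i 1) = G (axis i 1)" for i using f(2) by (simp add: axis_in_Basis_iff)
  have f_iv: "f (axis iv 1) = v" and f_iu: "f (axis iu 1) = b"
    using assms(1) by (auto simp: fa G_def ax)
  have f_h: "f (axis i 1) = h i" if "i \<notin> {iv, iu}" for i
    using that by (simp add: fa G_def ax)
  have "B \<subseteq> range f"
  proof
    fix x assume x: "x \<in> B"
    show "x \<in> range f"
    proof (cases "x \<in> {v, b}")
      case True then show ?thesis using f_iv f_iu by (metis insertE rangeI singletonD)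
    next
      case False
      then have "x \<in> h ` (UNIV - {iv, iu})" using h x by (simp add: bij_betw_def)
      then obtain i where "i \<notin> {iv, iu}" "h i = x" by auto
      then show ?thesis using f_h by (metis rangeI)
    qed
  qed
  then have "span B \<subseteq> range f"
    by (intro span_minimal) (simp_all add: linear_subspace_image[OF f(1) subspace_UNIV])
  then have "surj f" using B(3) by auto
  then have "inj f" using linear_surjective_imp_injective[OF f(1)] by simp
  then show thesis using that f(1) f_iv f_iu by blast
qed

lemma derivative_left_inverse:
  assumes "(f has_derivative f') (at x)" "(g has_derivative g') (at (f x))"
    and "open U" "x \<in> U" "\<And>y. y \<in> U \<Longrightarrow> g (f y) = y"
  shows "g' (f' v) = v"
proof -
  have "((\<lambda>y. g (f y)) has_derivative (\<lambda>v. g' (f' v))) (at x)" by (rule has_derivative_compose[OF assms(1,2)])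
  then have "((\<lambda>y. y) has_derivative (\<lambda>v. g' (f' v))) (at x)"
    by (rule has_derivative_transform_within_open[OF _ assms(3,4,5)])
  from has_derivative_unique[OF this has_derivative_ident] show ?thesis by meson
qed

text \<open>\<open>\<Psi>\<close> follows the flow for time \<open>z $ iv\<close> from a point of a
  hyperplane transversal to \<open>V\<close>, so its local inverse \<open>g\<close> sends
  \<open>V\<close> to \<open>axis iv 1\<close>. Overwriting the coordinate \<open>iu\<close> of
  \<open>g\<close> by \<open>u\<close> does not disturb this, since \<open>u\<close> is constant
  along \<open>V\<close>.\<close>

lemma straighten_vector_field:
  fixes V :: "real^'n::finite \<Rightarrow> real^'n" and u :: "real^'n \<Rightarrow> real" and iu iv :: 'n
  assumes N: "open N" "q \<in> N" and V: "smooth_on V N" and u: "smooth_on u N"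
    and Vu: "\<And>x. x \<in> N \<Longrightarrow> frechet_derivative u (at x) (V x) = 0" and Vq: "V q \<noteq> 0"
    and b: "frechet_derivative u (at q) = (\<lambda>v. b \<bullet> v)" "b \<noteq> 0" and i: "iu \<noteq> iv"
  obtains W X Y where "open W" "q \<in> W" "W \<subseteq> N" "smooth_on X W" "open (X ` W)" "convex (X ` W)"
    "homeomorphism W (X ` W) X Y" "smooth_on Y (X ` W)" "\<And>x. x \<in> W \<Longrightarrow> X x $ iu = u x"
    "\<And>x. x \<in> W \<Longrightarrow> frechet_derivative X (at x) (V x) = axis iv 1"
proof -
  obtain r T w where r: "0 < r" "0 < T" and w: "smooth_on w (ball q r \<times> {-T<..<T})"
    and wN: "\<And>x t. x \<in> ball q r \<Longrightarrow> t \<in> {-T<..<T} \<Longrightarrow> w (x, t) \<in> N"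
    and w0: "\<And>x. x \<in> ball q r \<Longrightarrow> w (x, 0) = x"
    and wt: "\<And>x t. x \<in> ball q r \<Longrightarrow> t \<in> {-T<..<T} \<Longrightarrow> ((\<lambda>t. w (x, t)) has_vector_derivative V (w (x, t))) (at t)"
    using local_flow[OF N V] by blast
  have bV: "b \<bullet> V q = 0" using Vu[OF N(2)] by (simp add: b)
  obtain f :: "real^'n \<Rightarrow> real^'n" where f: "linear f" "inj f" "f (axis iv 1) = V q" "f (axis iu 1) = b"
    using linear_iso_with_two_values[OF i Vq b(2) bV] by blast
  have fb: "bounded_linear f" using f(1) by (simp add: linear_conv_bounded_linear)
  \<comment> \<open>\<open>p\<close> removes the coordinate reserved for time, so
    \<open>q + f (p z)\<close> runs through a hyperplane complementary to
    \<open>V q\<close>.\<close>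
  define p where "p z = z - (z $ iv) *\<^sub>R axis iv 1" for z :: "real^'n"
  have pb: "bounded_linear p"
    unfolding p_def by (intro bounded_linear_sub bounded_linear_ident
        bounded_linear_compose[OF bounded_linear_scaleR_left bounded_linear_vec_nth])
  have fpb: "bounded_linear (\<lambda>z. f (p z))" by (rule bounded_linear_compose[OF fb pb])
  let ?\<iota> = "\<lambda>z. (q + f (p z), z $ iv)"
  define \<Psi> where "\<Psi> z = w (?\<iota> z)" for z
  define Z where "Z = ?\<iota> -` (ball q r \<times> {-T<..<T})"
  have opn: "open (ball q r \<times> {-T<..<T})" by (intro open_Times) auto
  have \<iota>c: "continuous_on UNIV ?\<iota>"
    by (intro continuous_on_Pair continuous_on_add continuous_on_const linear_continuous_on fpb bounded_linear_vec_nth)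
  have Z: "open Z" unfolding Z_def by (rule open_vimage[OF opn \<iota>c])
  have p0: "p 0 = 0" by (simp add: p_def)
  have f0: "f 0 = 0" using linear_0[OF f(1)] .
  have Z0: "0 \<in> Z" using r by (simp add: Z_def p0 f0)
  have \<iota>s: "smooth_on ?\<iota> Z"
    by (intro smooth_on_Pair smooth_on_add Z smooth_on_const smooth_on_bounded_linear fpb bounded_linear_vec_nth)
  have \<Psi>s: "smooth_on \<Psi> Z" unfolding \<Psi>_def
    by (rule smooth_on_compose[OF Z \<iota>s w]) (auto simp: Z_def)
  have Dw: "(w has_derivative frechet_derivative w (at z)) (at z)" if "z \<in> ball q r \<times> {-T<..<T}" for z
    by (rule smooth_on_has_derivative[OF w that])
  have D\<iota>: "(?\<iota> has_derivative (\<lambda>v. (f (p v), v $ iv))) (at z)" for z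
    by (intro has_derivative_Pair) (auto intro!: derivative_eq_intros bounded_linear_imp_has_derivative fpb bounded_linear_vec_nth)
  have D\<Psi>: "(\<Psi> has_derivative (\<lambda>v. frechet_derivative w (at (?\<iota> z)) (f (p v), v $ iv))) (at z)" if "z \<in> Z" for z
    unfolding \<Psi>_def by (rule has_derivative_compose[OF D\<iota> Dw]) (use that in \<open>auto simp: Z_def\<close>)
  have Dwt: "frechet_derivative w (at (x, t)) (0, s) = s *\<^sub>R V (w (x, t))" if xt: "(x, t) \<in> ball q r \<times> {-T<..<T}" for x t s
  proof -
    have "((\<lambda>t. (x, t)) has_derivative (\<lambda>s. (0, s))) (at t)" by (auto intro!: derivative_eq_intros)
    from has_derivative_compose[OF this Dw[OF xt]]
    have "((\<lambda>t. w (x, t)) has_derivative (\<lambda>s. frechet_derivative w (at (x, t)) (0, s))) (at t)" .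
    moreover have "((\<lambda>t. w (x, t)) has_derivative (\<lambda>s. s *\<^sub>R V (w (x, t)))) (at t)"
      using wt[of x t] xt by (simp add: has_vector_derivative_def)
    ultimately show ?thesis using has_derivative_unique by metis
  qed
  have Dwx: "frechet_derivative w (at (q, 0)) (h, 0) = h" for h
  proof -
    have "((\<lambda>x. (x, 0::real)) has_derivative (\<lambda>h. (h, 0))) (at q)" by (auto intro!: derivative_eq_intros)
    from has_derivative_compose[OF this Dw] r
    have "((\<lambda>x. w (x, 0)) has_derivative (\<lambda>h. frechet_derivative w (at (q, 0)) (h, 0))) (at q)" by simp
    then have "((\<lambda>x. x) has_derivative (\<lambda>h. frechet_derivative w (at (q, 0)) (h, 0))) (at q)"
      by (rule has_derivative_transform_within_open[of _ _ _ _ "ball q r"]) (use r w0 in auto)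
    from has_derivative_unique[OF this has_derivative_ident] show ?thesis by meson
  qed
  have piv: "p (axis iv 1) = 0" by (simp add: p_def)
  have \<Psi>0: "\<Psi> 0 = q" using w0[of q] r by (simp add: \<Psi>_def p0 f0)
  have D\<Psi>_iv: "frechet_derivative \<Psi> (at z) (axis iv 1) = V (\<Psi> z)" if "z \<in> Z" for z
    using frechet_derivative_eqI[OF D\<Psi>[OF that]] Dwt[of "q + f (p z)" "z $ iv" 1] that
    by (simp add: piv f0 \<Psi>_def Z_def)
  have D\<Psi>0: "frechet_derivative \<Psi> (at 0) = f"
  proof
    fix v
    have in0: "(q, 0) \<in> ball q r \<times> {-T<..<T}" using r by simp
    have "frechet_derivative \<Psi> (at 0) v = frechet_derivative w (at (q, 0)) (f (p v), v $ iv)"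
      using frechet_derivative_eqI[OF D\<Psi>[OF Z0]] by (simp add: p0 f0)
    also have "\<dots> = frechet_derivative w (at (q, 0)) ((f (p v), 0) + (0, v $ iv))" by simp
    also have "\<dots> = f (p v) + (v $ iv) *\<^sub>R V q"
      using linear_add[OF has_derivative_linear[OF Dw[OF in0]], of "(f (p v), 0)" "(0, v $ iv)"]
        Dwt[OF in0] Dwx w0[of q] r by simp
    also have "\<dots> = f v"
      using linear_diff[OF f(1), of v "(v $ iv) *\<^sub>R axis iv 1"] linear_scale[OF f(1), of "v $ iv" "axis iv 1"] f(3)
      by (simp add: p_def)
    finally show "frechet_derivative \<Psi> (at 0) v = f v" .
  qed
  obtain U g where U: "open U" "0 \<in> U" "U \<subseteq> Z" "open (\<Psi> ` U)" and hom: "homeomorphism U (\<Psi> ` U) \<Psi> g" and g: "smooth_on g (\<Psi> ` U)"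
    using smooth_local_inverse[OF Z Z0 \<Psi>s] f(2) D\<Psi>0 by metis
  let ?N = "\<Psi> ` U"
  have NN: "?N \<subseteq> N" using U(3) wN by (auto simp: \<Psi>_def Z_def)
  have qN: "q \<in> ?N" using U(2) \<Psi>0 by (metis imageI)
  have Dg\<Psi>: "frechet_derivative g (at (\<Psi> z)) (frechet_derivative \<Psi> (at z) v) = v" if "z \<in> U" for z v
    by (rule derivative_left_inverse[OF smooth_on_has_derivative[OF \<Psi>s] smooth_on_has_derivative[OF g] U(1) that])
      (use that U(3) hom in \<open>auto simp: homeomorphism_def\<close>)
  have DgV: "frechet_derivative g (at x) (V x) = axis iv 1" if x: "x \<in> ?N" for x
  proof -
    obtain z where z: "z \<in> U" "x = \<Psi> z" using x by auto
    then show ?thesis using Dg\<Psi>[OF z(1), of "axis iv 1"] D\<Psi>_iv[of z] U(3) by auto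
  qed
  define X where "X x = g x + (u x - g x $ iu) *\<^sub>R axis iu 1" for x
  have uN: "smooth_on u ?N" by (rule smooth_on_subset[OF u NN])
  have Xs: "smooth_on X ?N" unfolding X_def
    by (intro smooth_on_add smooth_on_scaleR smooth_on_diff smooth_on_vec_nth smooth_on_const U(4) g uN)
  have DX: "frechet_derivative X (at x) = (\<lambda>v. frechet_derivative g (at x) v +
      (frechet_derivative u (at x) v - frechet_derivative g (at x) v $ iu) *\<^sub>R axis iu 1)" if "x \<in> ?N" for x
    unfolding X_def
    by (intro frechet_derivative_eqI has_derivative_add smooth_on_has_derivative[OF g that]
        has_derivative_scaleR_left has_derivative_diff smooth_on_has_derivative[OF uN that]
        bounded_linear.has_derivative[OF bounded_linear_vec_nth])
  have DXV: "frechet_derivative X (at x) (V x) = axis iv 1" if "x \<in> ?N" for x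
    using DX[OF that] DgV[OF that] Vu[of x] NN that i by (auto simp: axis_def)
  have "inj (frechet_derivative X (at q))"
  proof -
    have lin: "linear (frechet_derivative X (at q))"
      by (rule has_derivative_linear[OF smooth_on_has_derivative[OF Xs qN]])
    have "v = 0" if v: "frechet_derivative X (at q) v = 0" for v
    proof -
      have "surj f" using linear_injective_imp_surjective[OF f(1,2)] by simp
      then obtain y where y: "v = f y" by (metis surjD)
      have gy: "frechet_derivative g (at q) v = y" using Dg\<Psi>[OF U(2), of y] by (simp add: \<Psi>0 D\<Psi>0 y)
      have *: "y + (b \<bullet> f y - y $ iu) *\<^sub>R axis iu 1 = 0" using v DX[OF qN] gy b y by simp
      define c where "c = - (b \<bullet> f y - y $ iu)"
      \<comment> \<open>Only multiples of \<open>axis iu 1\<close> could be killed. The map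
        \<open>f\<close> was made to send that axis to the gradient \<open>b\<close>, so on them the
        new coordinate has derivative c (b \<bullet> b), which is nonzero unless c = 0.\<close>
      have yc: "y = c *\<^sub>R axis iu 1" using * unfolding c_def scaleR_minus_left by (simp only: eq_neg_iff_add_eq_0)
      then have "b \<bullet> f y = c * (b \<bullet> b)" using linear_scale[OF f(1)] f(4) by simp
      moreover have "y $ iu = c" unfolding yc by simp
      moreover have "c = - (b \<bullet> f y - y $ iu)" by (fact c_def)
      ultimately have "c * (b \<bullet> b) = 0" by linarith
      then have "c = 0" using b(2) by (simp only: mult_eq_0_iff inner_eq_zero_iff) blast
      then show ?thesis using yc y f0 by simp
    qed
    then show ?thesis by (simp add: linear_injective_0[OF lin])
  qed
  from smooth_local_inverse[OF U(4) qN Xs this]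
  obtain U2 g2 where U2: "open U2" "q \<in> U2" "U2 \<subseteq> ?N" "open (X ` U2)" and hom2: "homeomorphism U2 (X ` U2) X g2"
    and g2: "smooth_on g2 (X ` U2)" by metis
  \<comment> \<open>The domain is cut down to the preimage of a ball so that the coordinate image is
    convex. Independence of a coordinate will be deduced there from a vanishing partial
    derivative.\<close>
  obtain \<rho> where \<rho>: "\<rho> > 0" "ball (X q) \<rho> \<subseteq> X ` U2" using U2 open_contains_ball by (metis imageI)
  define W where "W = g2 ` ball (X q) \<rho>"
  have Xg2: "X (g2 y) = y" "g2 y \<in> U2" if "y \<in> ball (X q) \<rho>" for y
    using hom2 \<rho>(2) that by (auto simp: homeomorphism_def)
  have g2X: "g2 (X x) = x" if "x \<in> U2" for x
    using hom2 that by (auto simp: homeomorphism_def)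
  have XW: "X ` W = ball (X q) \<rho>"
    unfolding W_def image_image using Xg2(1) by (simp cong: image_cong_simp)
  have WU: "W \<subseteq> U2" using Xg2(2) by (auto simp: W_def)
  have hom3: "homeomorphism W (X ` W) X g2"
    by (rule homeomorphism_of_subsets[OF hom2 WU]) (use \<rho>(2) XW in auto)
  have W: "open W"
  proof -
    have "W = U2 \<inter> X -` ball (X q) \<rho>"
    proof
      show "W \<subseteq> U2 \<inter> X -` ball (X q) \<rho>" using WU XW by blast
      show "U2 \<inter> X -` ball (X q) \<rho> \<subseteq> W" using g2X unfolding W_def by (metis IntE image_eqI subsetI vimageE)
    qed
    moreover have "continuous_on U2 X" using hom2 by (simp add: homeomorphism_def)
    ultimately show ?thesis using continuous_open_preimage[OF _ U2(1) open_ball] by metis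
  qed
  have qW: "q \<in> W" unfolding W_def using g2X[OF U2(2)] \<rho>(1) by (metis centre_in_ball image_eqI)
  have WN: "W \<subseteq> ?N" using WU U2(3) by blast
  show thesis
  proof (rule that[of W X g2])
    show "smooth_on g2 (X ` W)" using smooth_on_subset[OF g2] \<rho>(2) XW by simp
    show "X x $ iu = u x" if "x \<in> W" for x by (simp add: X_def)
    show "W \<subseteq> N" using WN NN by blast
    show "smooth_on X W" by (rule smooth_on_subset[OF Xs WN])
  qed (use W qW hom3 XW DXV WN in auto)
qed

section \<open>The canonical nonlinear connection\<close>

lemma frechet_derivative_sum_snd_times:
  fixes f :: "'n::finite \<Rightarrow> (real^'n) \<times> (real^'n) \<Rightarrow> real"
  assumes "\<And>k. f k differentiable (at z)"
  shows "frechet_derivative (\<lambda>z. \<Sum>k\<in>UNIV. snd z $ k * f k z) (at z) d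
       = (\<Sum>k\<in>UNIV. snd d $ k * f k z + snd z $ k * frechet_derivative (f k) (at z) d)"
proof -
  have "((\<lambda>z. snd z $ k) has_derivative (\<lambda>d. snd d $ k)) (at z)" for k :: 'n
    by (intro bounded_linear_imp_has_derivative bounded_linear_compose[OF bounded_linear_vec_nth bounded_linear_snd])
  then have "((\<lambda>z. \<Sum>k\<in>UNIV. snd z $ k * f k z) has_derivative
      (\<lambda>d. \<Sum>k\<in>UNIV. snd z $ k * frechet_derivative (f k) (at z) d + snd d $ k * f k z)) (at z)"
    by (intro has_derivative_sum has_derivative_mult differentiable_frechetD assms)
  from frechet_derivative_eqI[OF this] show ?thesis by (simp add: add.commute)
qed

lemma frechet_derivative_vertical:
  fixes L :: "(real^'n::finite) \<times> (real^'n) \<Rightarrow> real"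
  assumes "L differentiable (at z)"
  shows "frechet_derivative L (at z) (0, v) = (\<Sum>k\<in>UNIV. v $ k * pdy k L z)"
proof -
  note lin = has_derivative_linear[OF differentiable_frechetD[OF assms]]
  have eq: "(0, v) = (\<Sum>k\<in>UNIV. v $ k *\<^sub>R ((0 :: real^'n), axis k (1::real)))"
    by (simp add: prod_eq_iff fst_sum snd_sum vec_eq_iff axis_def if_distrib cong: if_cong)
  show ?thesis by (subst eq, simp only: linear_sum[OF lin] linear_scale[OF lin] real_scaleR_def pdy_def)
qed

text \<open>The square of a Finsler metric in one chart. Homogeneity of degree two is recorded as
  Euler's relation, the form in which it gets differentiated.\<close>

locale finsler_lagrangian =
  fixes L :: "(real^'n::finite) \<times> (real^'n) \<Rightarrow> real" and \<Omega> :: "((real^'n) \<times> (real^'n)) set"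
  assumes open_\<Omega>: "open \<Omega>" and L_smooth: "smooth_on L \<Omega>"
    and euler: "\<And>z. z \<in> \<Omega> \<Longrightarrow> frechet_derivative L (at z) (0, snd z) = 2 * L z"
    and nondegenerate: "\<And>z. z \<in> \<Omega> \<Longrightarrow> invertible (fundamental_tensor L z)"
begin

text \<open>Four times the usual spray coefficients, normalized so that geodesics satisfy x'' + 2 G
  = 0.\<close>

definition spray :: "'n \<Rightarrow> (real^'n) \<times> (real^'n) \<Rightarrow> real" where
  "spray j z = (\<Sum>k\<in>UNIV. matrix_inv (fundamental_tensor L z) $ j $ k *
     ((\<Sum>l\<in>UNIV. snd z $ l * pdx l (pdy k L) z) - pdx k L z))"

lemma nonlinear_conn_spray: "nonlinear_conn L j i z = 1/4 * pdy i (spray j) z"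
  unfolding nonlinear_conn_def spray_def by simp

lemma pdx_smooth: "smooth_on f \<Omega> \<Longrightarrow> smooth_on (pdx i f) \<Omega>"
  and pdy_smooth: "smooth_on f \<Omega> \<Longrightarrow> smooth_on (pdy i f) \<Omega>"
  unfolding pdx_def pdy_def by (rule smooth_on_frechet, assumption)+

lemma snd_nth_smooth: "smooth_on (\<lambda>z::(real^'n) \<times> (real^'n). snd z $ l) \<Omega>"
  by (intro smooth_on_bounded_linear open_\<Omega> bounded_linear_compose[OF bounded_linear_vec_nth bounded_linear_snd])

lemma spray_smooth: "smooth_on (spray j) \<Omega>"
proof -
  have g: "smooth_on (\<lambda>z. fundamental_tensor L z $ i $ j) \<Omega>" for i j
    using smooth_on_mult[OF open_\<Omega> smooth_on_const[of "1/2"] pdy_smooth[OF pdy_smooth[OF L_smooth]]]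
    by (simp add: fundamental_tensor_def)
  have "smooth_on (\<lambda>z. matrix_inv (fundamental_tensor L z) $ j $ k) \<Omega>" for k
    by (intro smooth_on_vec_nth[OF open_\<Omega> smooth_on_vec_nth[OF open_\<Omega>]] smooth_on_matrix_inv open_\<Omega> g nondegenerate)
  then show ?thesis unfolding spray_def
    by (intro smooth_on_sum smooth_on_mult smooth_on_diff open_\<Omega> snd_nth_smooth pdx_smooth pdy_smooth L_smooth)
qed

lemma diff_at: "smooth_on f \<Omega> \<Longrightarrow> z \<in> \<Omega> \<Longrightarrow> f differentiable (at z)"
  by (rule smooth_on_differentiable)

lemma pdxy_commute: "z \<in> \<Omega> \<Longrightarrow> pdy i (pdx l L) z = pdx l (pdy i L) z"
  and pdyy_commute: "z \<in> \<Omega> \<Longrightarrow> pdy i (pdy j L) z = pdy j (pdy i L) z"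
  unfolding pdx_def pdy_def by (rule second_derivative_symmetric[OF open_\<Omega> _ L_smooth], assumption)+

lemma euler_sum: "z \<in> \<Omega> \<Longrightarrow> (\<Sum>k\<in>UNIV. snd z $ k * pdy k L z) = 2 * L z"
  using euler[of z] frechet_derivative_vertical[OF diff_at[OF L_smooth], of z "snd z"] by simp

lemma derivative_euler_sum:
  assumes z: "z \<in> \<Omega>"
  shows "(\<Sum>k\<in>UNIV. snd d $ k * pdy k L z + snd z $ k * frechet_derivative (pdy k L) (at z) d) = 2 * frechet_derivative L (at z) d"
proof -
  have "frechet_derivative (\<lambda>z. \<Sum>k\<in>UNIV. snd z $ k * pdy k L z) (at z) d = frechet_derivative (\<lambda>z. 2 * L z) (at z) d"
    by (rule fun_cong[OF frechet_derivative_cong_open[OF open_\<Omega> z]]) (rule euler_sum)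
  also have "\<dots> = 2 * frechet_derivative L (at z) d"
    by (rule frechet_derivative_bounded_linear_compose[OF bounded_linear_mult_right diff_at[OF L_smooth z]])
  finally show ?thesis
    using frechet_derivative_sum_snd_times[of "\<lambda>k. pdy k L" z d] diff_at[OF pdy_smooth[OF L_smooth] z] by simp
qed

lemma euler_pdx:
  assumes z: "z \<in> \<Omega>"
  shows "(\<Sum>k\<in>UNIV. snd z $ k * pdx l (pdy k L) z) = 2 * pdx l L z"
  using derivative_euler_sum[OF z, of "(axis l 1, 0)"] by (simp add: pdx_def)

lemma euler_pdy:
  assumes z: "z \<in> \<Omega>"
  shows "(\<Sum>k\<in>UNIV. snd z $ k * pdy j (pdy k L) z) = pdy j L z"
proof -
  have "(\<Sum>k\<in>UNIV. axis j 1 $ k * pdy k L z) = pdy j L z"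
    by (simp add: axis_def if_distrib[of "\<lambda>x. x * _"] cong: if_cong)
  then show ?thesis
    using derivative_euler_sum[OF z, of "(0, axis j 1)"] by (simp add: pdy_def sum.distrib)
qed

text \<open>Clears the inverse matrix from the definition of the spray; the factor 2 appears because
  the fundamental tensor is half the Hessian.\<close>

lemma spray_equation:
  assumes z: "z \<in> \<Omega>"
  shows "(\<Sum>j\<in>UNIV. pdy k (pdy j L) z * spray j z) = 2 * ((\<Sum>l\<in>UNIV. snd z $ l * pdx l (pdy k L) z) - pdx k L z)"
proof -
  define E :: "real^'n" where "E = (\<chi> k. (\<Sum>l\<in>UNIV. snd z $ l * pdx l (pdy k L) z) - pdx k L z)"
  let ?g = "fundamental_tensor L z"
  have sp: "(\<chi> j. spray j z) = matrix_inv ?g *v E"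
    by (simp add: spray_def E_def matrix_vector_mult_def)
  have "?g *v (\<chi> j. spray j z) = E"
    unfolding sp using matrix_inv_right[OF nondegenerate[OF z]] by (simp add: matrix_vector_mul_assoc)
  then have "(?g *v (\<chi> j. spray j z)) $ k = E $ k" by simp
  then have "(\<Sum>j\<in>UNIV. 1/2 * pdy k (pdy j L) z * spray j z) = E $ k"
    by (simp add: matrix_vector_mult_def fundamental_tensor_def)
  then have "1/2 * (\<Sum>j\<in>UNIV. pdy k (pdy j L) z * spray j z) = E $ k"
    by (simp add: sum_distrib_left mult.assoc)
  then show ?thesis by (simp add: E_def)
qed

text \<open>Contraction of the spray equation with y. Euler's relation for the fibre derivatives of
  \<open>L\<close> removes the Hessian on the left, and its derivative in x removes the mixed
  derivatives on the right.\<close>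

lemma spray_contracted:
  assumes z: "z \<in> \<Omega>"
  shows "(\<Sum>j\<in>UNIV. pdy j L z * spray j z) = 2 * (\<Sum>l\<in>UNIV. snd z $ l * pdx l L z)"
proof -
  have "(\<Sum>j\<in>UNIV. pdy j L z * spray j z) = (\<Sum>j\<in>UNIV. (\<Sum>k\<in>UNIV. snd z $ k * pdy k (pdy j L) z) * spray j z)"
    using euler_pdy[OF z] pdyy_commute[OF z] by simp
  also have "\<dots> = (\<Sum>k\<in>UNIV. snd z $ k * (\<Sum>j\<in>UNIV. pdy k (pdy j L) z * spray j z))"
    by (simp add: sum_distrib_left sum_distrib_right mult.assoc) (rule sum.swap)
  also have "\<dots> = 2 * (\<Sum>k\<in>UNIV. snd z $ k * (\<Sum>l\<in>UNIV. snd z $ l * pdx l (pdy k L) z)) - 2 * (\<Sum>k\<in>UNIV. snd z $ k * pdx k L z)"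
  proof -
    have "c * (2 * (A - B)) = 2 * (c * A) - 2 * (c * B)" for c A B :: real by (simp add: algebra_simps)
    then show ?thesis by (simp only: spray_equation[OF z] sum_subtractf sum_distrib_left[symmetric])
  qed
  also have "(\<Sum>k\<in>UNIV. snd z $ k * (\<Sum>l\<in>UNIV. snd z $ l * pdx l (pdy k L) z))
      = (\<Sum>l\<in>UNIV. snd z $ l * (\<Sum>k\<in>UNIV. snd z $ k * pdx l (pdy k L) z))"
    unfolding sum_distrib_left by (subst sum.swap) (simp add: mult_ac)
  also have "\<dots> = 2 * (\<Sum>l\<in>UNIV. snd z $ l * pdx l L z)"
    by (simp add: euler_pdx[OF z] sum_distrib_left mult_ac)
  finally show ?thesis by simp
qed

text \<open>Obtained by differentiating the contracted spray equation in the fibre direction.\<close>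

lemma horizontal:
  assumes z: "z \<in> \<Omega>"
  shows "pdx i L z = (\<Sum>j\<in>UNIV. nonlinear_conn L j i z * pdy j L z)"
proof -
  let ?D = "\<lambda>f. frechet_derivative f (at z) (0, axis i 1)"
  have d: "(pdy j L has_derivative frechet_derivative (pdy j L) (at z)) (at z)"
    "(spray j has_derivative frechet_derivative (spray j) (at z)) (at z)" for j
    by (intro smooth_on_has_derivative[OF _ z] pdy_smooth L_smooth spray_smooth)+
  have "?D (\<lambda>z. \<Sum>j\<in>UNIV. pdy j L z * spray j z) = (\<Sum>j\<in>UNIV. pdy j L z * pdy i (spray j) z + pdy i (pdy j L) z * spray j z)"
    by (subst frechet_derivative_eqI[OF has_derivative_sum[OF has_derivative_mult[OF d]]]) (simp add: pdy_def)
  moreover have "?D (\<lambda>z. \<Sum>j\<in>UNIV. pdy j L z * spray j z) = ?D (\<lambda>z. 2 * (\<Sum>l\<in>UNIV. snd z $ l * pdx l L z))"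
    by (rule fun_cong[OF frechet_derivative_cong_open[OF open_\<Omega> z]]) (rule spray_contracted)
  moreover have "?D (\<lambda>z. 2 * (\<Sum>l\<in>UNIV. snd z $ l * pdx l L z)) = 2 * ?D (\<lambda>z. \<Sum>l\<in>UNIV. snd z $ l * pdx l L z)"
    by (rule frechet_derivative_bounded_linear_compose[OF bounded_linear_mult_right diff_at[OF _ z]])
      (intro smooth_on_sum smooth_on_mult open_\<Omega> snd_nth_smooth pdx_smooth L_smooth)
  moreover have "?D (\<lambda>z. \<Sum>l\<in>UNIV. snd z $ l * pdx l L z) = pdx i L z + (\<Sum>l\<in>UNIV. snd z $ l * pdx l (pdy i L) z)"
  proof -
    have "(\<Sum>k\<in>UNIV. axis i 1 $ k * pdx k L z) = pdx i L z"
      by (simp add: axis_def if_distrib[of "\<lambda>x. x * _"] cong: if_cong)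
    moreover have "?D (pdx l L) = pdx l (pdy i L) z" for l using pdxy_commute[OF z] by (simp add: pdy_def)
    ultimately show ?thesis
      using frechet_derivative_sum_snd_times[of "\<lambda>l. pdx l L" z "(0, axis i 1)"] diff_at[OF pdx_smooth[OF L_smooth] z]
      by (simp add: sum.distrib)
  qed
  ultimately have "(\<Sum>j\<in>UNIV. pdy j L z * pdy i (spray j) z) = 4 * pdx i L z"
    using spray_equation[OF z, of i] by (simp add: sum.distrib)
  then show ?thesis by (simp add: nonlinear_conn_spray sum_divide_distrib[symmetric] mult.commute)
qed

text \<open>The symbols are a quarter of the second fibre derivatives of the spray, and those
  commute. This is the absence of torsion.\<close>

lemma connection_symmetric:
  assumes \<Gamma>: "\<And>z k i. z \<in> \<Omega> \<Longrightarrow> nonlinear_conn L k i z = (\<Sum>j\<in>UNIV. \<Gamma> (fst z) k i j * snd z $ j)"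
    and z: "z \<in> \<Omega>"
  shows "\<Gamma> (fst z) k i j = \<Gamma> (fst z) k j i"
proof -
  have sp: "pdy i (spray k) z = 4 * (\<Sum>j\<in>UNIV. \<Gamma> (fst z) k i j * snd z $ j)" if "z \<in> \<Omega>" for z i
    using \<Gamma>[OF that, of k i] by (simp add: nonlinear_conn_spray)
  have "pdy j (pdy i (spray k)) z = 4 * \<Gamma> (fst z) k i j" for i j
    unfolding pdy_def[of j]
  proof (rule affine_directional_derivative[OF diff_at[OF pdy_smooth[OF spray_smooth] z] open_\<Omega> z])
    fix t assume t: "z + t *\<^sub>R (0, axis j 1) \<in> \<Omega>"
    have "(\<Sum>l\<in>UNIV. \<Gamma> (fst z) k i l * (t * axis j 1 $ l)) = t * \<Gamma> (fst z) k i j"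
      by (simp add: axis_def if_distrib cong: if_cong)
    then show "pdy i (spray k) (z + t *\<^sub>R (0, axis j 1)) = pdy i (spray k) z + t *\<^sub>R (4 * \<Gamma> (fst z) k i j)"
      unfolding sp[OF t] sp[OF z] by (simp add: algebra_simps sum.distrib sum_distrib_left)
  qed
  moreover have "pdy j (pdy i (spray k)) z = pdy i (pdy j (spray k)) z"
    unfolding pdy_def by (rule second_derivative_symmetric[OF open_\<Omega> z spray_smooth])
  ultimately show ?thesis by simp
qed

text \<open>\<open>\<Delta>\<close> is the difference of two torsion-free connections preserving \<open>L\<close>. The fibre derivative
  of \<open>dL(\<Delta>(e, y)) = 0\<close> at \<open>e = y\<close> puts \<open>\<Delta>(y, y)\<close> in the kernel of the fundamental tensor.\<close>

lemma horizontal_unique: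
  fixes \<Delta> :: "real^'n \<Rightarrow> real^'n \<Rightarrow> real^'n"
  assumes lin: "\<And>e. linear (\<Delta> e)" and sym: "\<And>e y. \<Delta> e y = \<Delta> y e"
    and hor: "\<And>e y. (x, y) \<in> \<Omega> \<Longrightarrow> frechet_derivative L (at (x, y)) (0, \<Delta> e y) = 0"
    and ne: "(x, y0) \<in> \<Omega>"
  shows "\<Delta> e y = 0"
proof -
  have diag: "\<Delta> y y = 0" if y: "(x, y) \<in> \<Omega>" for y
  proof -
    let ?w = "\<Delta> y y"
    have "(fundamental_tensor L (x, y) *v ?w) $ i = 0" for i
    proof -
      let ?v = "axis i 1 :: real^'n"
      have d: "(pdy k L has_derivative frechet_derivative (pdy k L) (at (x, y))) (at (x, y))" for k
        by (intro smooth_on_has_derivative[OF _ y] pdy_smooth L_smooth)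
      have dl: "((\<lambda>y'. pdy k L (x, y')) has_derivative (\<lambda>v. frechet_derivative (pdy k L) (at (x, y)) (0, v))) (at y)" for k
      proof -
        have "((\<lambda>y'. (x, y')) has_derivative (\<lambda>v. (0, v))) (at y)" by (auto intro!: derivative_eq_intros)
        from has_derivative_compose[OF this d] show ?thesis .
      qed
      have bl: "bounded_linear (\<lambda>y'. \<Delta> y y' $ k)" for k
        using lin[of y] by (intro bounded_linear_compose[OF bounded_linear_vec_nth]) (simp add: linear_conv_bounded_linear)
      have "((\<lambda>y'. \<Sum>k\<in>UNIV. \<Delta> y y' $ k * pdy k L (x, y')) has_derivative
         (\<lambda>v. \<Sum>k\<in>UNIV. \<Delta> y y $ k * frechet_derivative (pdy k L) (at (x, y)) (0, v) + \<Delta> y v $ k * pdy k L (x, y))) (at y)"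
        by (intro has_derivative_sum has_derivative_mult dl bounded_linear_imp_has_derivative bl)
      moreover have "((\<lambda>y'. \<Sum>k\<in>UNIV. \<Delta> y y' $ k * pdy k L (x, y')) has_derivative (\<lambda>v. 0)) (at y)"
      proof (rule has_derivative_transform_within_open[OF has_derivative_const, of "Pair x -` \<Omega>" y 0])
        show "open (Pair x -` \<Omega>)" by (intro open_vimage open_\<Omega> continuous_intros)
        show "0 = (\<Sum>k\<in>UNIV. \<Delta> y y' $ k * pdy k L (x, y'))" if "y' \<in> Pair x -` \<Omega>" for y'
          using hor[of y' y] frechet_derivative_vertical[OF diff_at[OF L_smooth], of "(x, y')" "\<Delta> y y'"] that by simp
      qed (use y in simp)
      ultimately have "(\<lambda>v. \<Sum>k\<in>UNIV. \<Delta> y y $ k * frechet_derivative (pdy k L) (at (x, y)) (0, v) + \<Delta> y v $ k * pdy k L (x, y)) = (\<lambda>v. 0)"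
        by (rule has_derivative_unique)
      from fun_cong[OF this, of ?v]
      have "(\<Sum>k\<in>UNIV. \<Delta> y y $ k * pdy i (pdy k L) (x, y)) + (\<Sum>k\<in>UNIV. \<Delta> y ?v $ k * pdy k L (x, y)) = 0"
        by (simp add: pdy_def sum.distrib)
      \<comment> \<open>By the symmetry of \<open>\<Delta>\<close> this is \<open>hor\<close> for
        the pair \<open>?v\<close>, \<open>y\<close>, so only the Hessian term survives.\<close>
      moreover have "(\<Sum>k\<in>UNIV. \<Delta> y ?v $ k * pdy k L (x, y)) = 0"
        using hor[OF y, of ?v] frechet_derivative_vertical[OF diff_at[OF L_smooth y], of "\<Delta> ?v y"] sym[of y ?v] by simp
      ultimately have "1/2 * (\<Sum>k\<in>UNIV. \<Delta> y y $ k * pdy i (pdy k L) (x, y)) = 0" by simp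
      then show ?thesis
        by (simp add: matrix_vector_mult_def fundamental_tensor_def sum_divide_distrib[symmetric] mult.commute)
    qed
    then have "fundamental_tensor L (x, y) *v ?w = 0" by (simp add: vec_eq_iff)
    then have "matrix_inv (fundamental_tensor L (x, y)) *v (fundamental_tensor L (x, y) *v ?w) = 0" by simp
    then show ?thesis using matrix_inv_left[OF nondegenerate[OF y]] by (simp add: matrix_vector_mul_assoc)
  qed
  have lin2: "linear (\<lambda>e. \<Delta> e y)" for y
  proof -
    have "(\<lambda>e. \<Delta> e y) = \<Delta> y" using sym by blast
    then show ?thesis using lin[of y] by simp
  qed
  have exp: "\<Delta> (u + v) (u + v) = \<Delta> u u + 2 *\<^sub>R \<Delta> u v + \<Delta> v v" for u v
    using sym[of v u] by (simp add: linear_add[OF lin] linear_add[OF lin2] scaleR_2)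
  \<comment> \<open>So far only vectors in the open fibre are covered. An arbitrary \<open>v\<close>
    is reached through y0 + t v and y0 - t v with small t: adding the two expansions cancels the
    cross term.\<close>
  have all: "\<Delta> v v = 0" for v
  proof -
    have "open (Pair x -` \<Omega>)" by (intro open_vimage open_\<Omega> continuous_intros)
    moreover have "y0 \<in> Pair x -` \<Omega>" using ne by simp
    ultimately obtain r where r: "r > 0" "ball y0 r \<subseteq> Pair x -` \<Omega>" by (meson open_contains_ball)
    define t where "t = r / (2 * (norm v + 1))"
    have nv: "norm v + 1 > 0" by (simp add: add_nonneg_pos)
    have t: "t > 0" using r nv by (simp add: t_def)
    have tv: "norm (t *\<^sub>R v) < r"
    proof -
      have "norm (t *\<^sub>R v) = t * norm v" using t by simp
      also have "\<dots> < t * (2 * (norm v + 1))" using t nv by (intro mult_strict_left_mono) auto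
      also have "\<dots> = r" using nv by (simp add: t_def)
      finally show ?thesis .
    qed
    have "(x, y0 + t *\<^sub>R v) \<in> \<Omega>" "(x, y0 + (- t) *\<^sub>R v) \<in> \<Omega>"
      using r(2) tv by (auto simp: subset_eq dist_norm)
    note d = diag[OF this(1)] diag[OF this(2)]
    have sc: "\<Delta> y0 (c *\<^sub>R v) = c *\<^sub>R \<Delta> y0 v" "\<Delta> (c *\<^sub>R v) (c *\<^sub>R v) = (c * c) *\<^sub>R \<Delta> v v" for c
      using linear_scale[OF lin] linear_scale[OF lin2] by simp_all
    have 1: "2 *\<^sub>R (t *\<^sub>R \<Delta> y0 v) + (t * t) *\<^sub>R \<Delta> v v = 0"
      using d(1) unfolding exp sc diag[OF ne] by simp
    have 2: "- (2 *\<^sub>R (t *\<^sub>R \<Delta> y0 v)) + (t * t) *\<^sub>R \<Delta> v v = 0"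
      using d(2) unfolding exp sc diag[OF ne] by simp
    have "(t * t) *\<^sub>R \<Delta> v v + (t * t) *\<^sub>R \<Delta> v v =
       (2 *\<^sub>R (t *\<^sub>R \<Delta> y0 v) + (t * t) *\<^sub>R \<Delta> v v) + (- (2 *\<^sub>R (t *\<^sub>R \<Delta> y0 v)) + (t * t) *\<^sub>R \<Delta> v v)" by simp
    also have "\<dots> = 0" unfolding 1 2 by simp
    finally have "(2 * (t * t)) *\<^sub>R \<Delta> v v = 0" by (simp only: scaleR_left_distrib mult_2)
    then show ?thesis using t by simp
  qed
  have "2 *\<^sub>R \<Delta> e y = 0" using exp[of e y] all by simp
  then show ?thesis by simp
qed

end

section \<open>Covariant derivatives in coordinates\<close>

text \<open>The connection form evaluated on the k-th coordinate field, with the upper index as row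
  index.\<close>

definition christoffel_matrix :: "('n::finite \<Rightarrow> 'n \<Rightarrow> 'n \<Rightarrow> real) \<Rightarrow> 'n \<Rightarrow> real^'n^'n" where
  "christoffel_matrix \<Gamma> k = (\<chi> l i. \<Gamma> l k i)"

definition metric_deriv :: "(real^'n::finite \<Rightarrow> real^'n^'n) \<Rightarrow> real^'n \<Rightarrow> real^'n \<Rightarrow> real^'n^'n" where
  "metric_deriv a x e = (\<chi> i j. frechet_derivative (\<lambda>x. a x $ i $ j) (at x) e)"

definition cov_metric :: "('n::finite \<Rightarrow> 'n \<Rightarrow> 'n \<Rightarrow> real) \<Rightarrow> (real^'n \<Rightarrow> real^'n^'n) \<Rightarrow> 'n \<Rightarrow> real^'n \<Rightarrow> real^'n^'n" where
  "cov_metric \<Gamma> a k x = metric_deriv a x (axis k 1)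
     - transpose (christoffel_matrix \<Gamma> k) ** a x - a x ** christoffel_matrix \<Gamma> k"

definition cov_form :: "('n::finite \<Rightarrow> 'n \<Rightarrow> 'n \<Rightarrow> real) \<Rightarrow> (real^'n \<Rightarrow> real^'n) \<Rightarrow> 'n \<Rightarrow> real^'n \<Rightarrow> real^'n" where
  "cov_form \<Gamma> b k x = frechet_derivative b (at x) (axis k 1) - transpose (christoffel_matrix \<Gamma> k) *v b x"

lemma cov_metric_nth: "cov_metric \<Gamma> a k x $ i $ j = pd k (\<lambda>x. a x $ i $ j) x
    - (\<Sum>l\<in>UNIV. \<Gamma> l k i * a x $ l $ j) - (\<Sum>l\<in>UNIV. \<Gamma> l k j * a x $ i $ l)"
  by (simp add: cov_metric_def metric_deriv_def christoffel_matrix_def pd_def matrix_matrix_mult_def transpose_def mult.commute)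

lemma inner_matrix_transpose: "(A *v x) \<bullet> y = x \<bullet> (transpose A *v (y :: real^'k))" for A :: "real^'n^'k"
  by (metis dot_lmul_matrix inner_commute transpose_matrix_vector)

lemma matrix_inner_expand: "y \<bullet> (A *v z) = (\<Sum>i\<in>UNIV. \<Sum>j\<in>UNIV. y $ i * A $ i $ j * z $ j)" for A :: "real^'n^'k"
  by (simp add: inner_vec_def matrix_vector_mult_def sum_distrib_left mult.assoc)

lemma has_derivative_quadratic:
  fixes a :: "real^'n::finite \<Rightarrow> real^'n^'n"
  assumes "\<And>i j. (\<lambda>x. a x $ i $ j) differentiable (at x)"
  shows "((\<lambda>z. snd z \<bullet> (a (fst z) *v snd z)) has_derivative
     (\<lambda>d. snd d \<bullet> (a x *v y) + y \<bullet> (metric_deriv a x (fst d) *v y) + y \<bullet> (a x *v snd d))) (at (x, y))"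
proof -
  have y: "((\<lambda>z. snd z $ i) has_derivative (\<lambda>d. snd d $ i)) (at (x, y))" for i :: 'n
    by (intro bounded_linear_imp_has_derivative bounded_linear_compose[OF bounded_linear_vec_nth bounded_linear_snd])
  have "((\<lambda>x. a x $ i $ j) has_derivative (\<lambda>e. metric_deriv a x e $ i $ j)) (at (fst (x, y)))" for i j
    using differentiable_frechetD[OF assms, of i j] by (simp add: metric_deriv_def)
  note a = has_derivative_compose[OF bounded_linear_imp_has_derivative[OF bounded_linear_fst] this]
  have "((\<lambda>z. \<Sum>i\<in>UNIV. \<Sum>j\<in>UNIV. snd z $ i * a (fst z) $ i $ j * snd z $ j) has_derivative
     (\<lambda>d. \<Sum>i\<in>UNIV. \<Sum>j\<in>UNIV. (snd (x, y) $ i * a (fst (x, y)) $ i $ j) * snd d $ j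
        + (snd (x, y) $ i * metric_deriv a x (fst d) $ i $ j + snd d $ i * a (fst (x, y)) $ i $ j) * snd (x, y) $ j)) (at (x, y))"
    by (intro has_derivative_sum has_derivative_mult y a)
  then show ?thesis
    unfolding matrix_inner_expand by (simp add: algebra_simps sum.distrib)
qed

lemma has_derivative_form:
  fixes b :: "real^'n::finite \<Rightarrow> real^'n"
  assumes "b differentiable (at x)"
  shows "((\<lambda>z. b (fst z) \<bullet> snd z) has_derivative (\<lambda>d. b x \<bullet> snd d + frechet_derivative b (at x) (fst d) \<bullet> y)) (at (x, y))"
proof -
  have "(b has_derivative frechet_derivative b (at x)) (at (fst (x, y)))"
    using differentiable_frechetD[OF assms] by simp
  note b = has_derivative_compose[OF bounded_linear_imp_has_derivative[OF bounded_linear_fst] this]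
  from has_derivative_inner[OF b bounded_linear_imp_has_derivative[OF bounded_linear_snd]] show ?thesis by simp
qed

text \<open>The derivatives along the horizontal lift \<open>\<partial>\<^sub>k - \<Gamma>\<^sup>j\<^sub>k\<^sub>l y\<^sup>l \<partial>/\<partial>y\<^sup>j\<close> are the covariant derivatives.\<close>

lemma quadratic_horizontal:
  assumes "transpose (a x) = a x"
  shows "(- (christoffel_matrix \<Gamma> k *v y)) \<bullet> (a x *v y) + y \<bullet> (metric_deriv a x (axis k 1) *v y)
      + y \<bullet> (a x *v (- (christoffel_matrix \<Gamma> k *v y))) = y \<bullet> (cov_metric \<Gamma> a k x *v y)"
proof -
  have "(christoffel_matrix \<Gamma> k *v y) \<bullet> (a x *v y) = y \<bullet> ((transpose (christoffel_matrix \<Gamma> k) ** a x) *v y)"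
    by (simp add: inner_matrix_transpose matrix_vector_mul_assoc)
  then show ?thesis
    by (simp add: cov_metric_def matrix_vector_mult_diff_rdistrib inner_diff_right matrix_vector_mul_assoc[symmetric]
        linear_neg[OF matrix_vector_mul_linear])
qed

lemma form_horizontal:
  "b x \<bullet> (- (christoffel_matrix \<Gamma> k *v y)) + frechet_derivative b (at x) (axis k 1) \<bullet> y = cov_form \<Gamma> b k x \<bullet> y"
  by (simp add: cov_form_def inner_diff_left inner_commute[of "b x"] inner_matrix_transpose[of _ y])
    (simp add: inner_commute)

lemma has_derivative_exp_compose:
  fixes \<phi> :: "'a::real_normed_vector \<Rightarrow> real"
  assumes "\<phi> differentiable (at x)"
  shows "((\<lambda>x. exp (\<phi> x)) has_derivative (\<lambda>v. exp (\<phi> x) * frechet_derivative \<phi> (at x) v)) (at x)"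
  using differentiable_frechetD[OF assms] by (auto intro!: derivative_eq_intros)

lemma pd_exp:
  assumes "\<phi> differentiable (at x)" "f differentiable (at x)"
  shows "pd k (\<lambda>x. exp (\<phi> x) * f x) x = exp (\<phi> x) * (pd k f x + pd k \<phi> x * f x)"
proof -
  have "((\<lambda>x. exp (\<phi> x) * f x) has_derivative (\<lambda>v. exp (\<phi> x) * frechet_derivative f (at x) v
      + (exp (\<phi> x) * frechet_derivative \<phi> (at x) v) * f x)) (at x)"
    by (intro has_derivative_mult has_derivative_exp_compose differentiable_frechetD assms)
  from frechet_derivative_eqI[OF this] show ?thesis by (simp add: pd_def algebra_simps)
qed

text \<open>Applied with a \<phi> whose derivative cancels the factor in a recurrence \<nabla>a =
  \<theta> \<otimes> a, so that the rescaled metric is parallel.\<close>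

lemma cov_metric_rescale:
  fixes a :: "real^'n::finite \<Rightarrow> real^'n^'n"
  assumes "\<phi> differentiable (at x)" "\<And>i j. (\<lambda>x. a x $ i $ j) differentiable (at x)"
  shows "cov_metric \<Gamma> (\<lambda>x. exp (\<phi> x) *\<^sub>R a x) k x = exp (\<phi> x) *\<^sub>R (cov_metric \<Gamma> a k x + pd k \<phi> x *\<^sub>R a x)"
proof -
  have s: "(\<Sum>l\<in>UNIV. c l * (E * d l)) = E * (\<Sum>l\<in>UNIV. c l * d l)" for c d :: "'n \<Rightarrow> real" and E
    by (simp add: sum_distrib_left mult_ac)
  show ?thesis
    by (simp add: vec_eq_iff cov_metric_nth pd_exp[OF assms] s) (simp add: algebra_simps)
qed

lemma frechet_nth:
  fixes b :: "'a::real_normed_vector \<Rightarrow> real^'n::finite"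
  assumes "b differentiable (at x)"
  shows "frechet_derivative b (at x) e $ i = frechet_derivative (\<lambda>x. b x $ i) (at x) e"
  by (rule frechet_derivative_bounded_linear_compose[OF bounded_linear_vec_nth assms, symmetric])

lemma cov_form_rescale:
  fixes b :: "real^'n::finite \<Rightarrow> real^'n"
  assumes "\<phi> differentiable (at x)" "b differentiable (at x)"
  shows "cov_form \<Gamma> (\<lambda>x. exp (\<phi> x) *\<^sub>R b x) k x = exp (\<phi> x) *\<^sub>R (cov_form \<Gamma> b k x + pd k \<phi> x *\<^sub>R b x)"
proof -
  have "((\<lambda>x. exp (\<phi> x) *\<^sub>R b x) has_derivative (\<lambda>v. exp (\<phi> x) *\<^sub>R frechet_derivative b (at x) v
      + (exp (\<phi> x) * frechet_derivative \<phi> (at x) v) *\<^sub>R b x)) (at x)"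
    by (intro has_derivative_scaleR has_derivative_exp_compose differentiable_frechetD assms)
  from frechet_derivative_eqI[OF this] show ?thesis
    by (simp add: cov_form_def pd_def scaleR_right_distrib scaleR_right_diff_distrib
        linear_scale[OF matrix_vector_mul_linear])
qed

lemma matrix_mult_scaleR: "A ** (c *\<^sub>R B) = c *\<^sub>R (A ** B)" for A :: "real^'n^'k" and B :: "real^'l^'n"
  by (simp add: matrix_matrix_mult_def vec_eq_iff sum_distrib_left mult_ac)

text \<open>The trace of \<open>\<nabla>a = \<theta> \<otimes> a\<close> compared with that of \<open>\<nabla>g = 0\<close> shows that
  \<open>\<theta>\<close> is exact, with an explicit potential.\<close>

lemma ln_det_ratio_derivative:
  fixes a g :: "real^'n::finite \<Rightarrow> real^'n^'n"
  assumes a: "\<And>i j. (\<lambda>x. a x $ i $ j) differentiable (at x)" "invertible (a x)"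
    and g: "\<And>i j. (\<lambda>x. g x $ i $ j) differentiable (at x)" "invertible (g x)"
    and cov: "cov_metric \<Gamma> a k x = \<theta> *\<^sub>R a x" "cov_metric \<Gamma> g k x = 0"
  shows "pd k (\<lambda>x. ln \<bar>det (a x)\<bar> - ln \<bar>det (g x)\<bar>) x = real CARD('n) * \<theta>"
proof -
  let ?G = "christoffel_matrix \<Gamma> k"
  have tr: "trace (matrix_inv (A x) ** metric_deriv A x (axis k 1)) = 2 * trace ?G + real CARD('n) * c"
    if inv: "invertible (A x)" and c: "cov_metric \<Gamma> A k x = c *\<^sub>R A x" for A and c
  proof -
    have "metric_deriv A x (axis k 1) = transpose ?G ** A x + A x ** ?G + c *\<^sub>R A x"
      using c unfolding cov_metric_def by (simp add: algebra_simps)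
    then have "matrix_inv (A x) ** metric_deriv A x (axis k 1)
        = matrix_inv (A x) ** (transpose ?G ** A x) + ?G + c *\<^sub>R mat 1"
      using matrix_inv_left[OF inv]
      by (simp add: matrix_add_ldistrib matrix_mul_assoc matrix_mult_scaleR)
    moreover have "trace (matrix_inv (A x) ** (transpose ?G ** A x)) = trace ?G"
    proof -
      have "trace (matrix_inv (A x) ** (transpose ?G ** A x)) = trace ((transpose ?G ** A x) ** matrix_inv (A x))"
        by (rule trace_mul_sym)
      also have "\<dots> = trace (transpose ?G)"
        using matrix_inv_right[OF inv] by (simp add: matrix_mul_assoc[symmetric])
      finally show ?thesis by (simp add: trace_def transpose_def)
    qed
    ultimately show ?thesis by (simp add: trace_add) (simp add: trace_def mat_def sum_distrib_left)
  qed
  have d: "((\<lambda>x. ln \<bar>det (A x)\<bar>) has_derivative (\<lambda>v. trace (matrix_inv (A x) ** metric_deriv A x v))) (at x)"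
    if "\<And>i j. (\<lambda>x. A x $ i $ j) differentiable (at x)" "invertible (A x)" for A :: "real^'n \<Rightarrow> real^'n^'n"
    by (rule has_derivative_ln_abs_det) (use that differentiable_frechetD in \<open>auto simp: metric_deriv_def\<close>)
  have "((\<lambda>x. ln \<bar>det (a x)\<bar> - ln \<bar>det (g x)\<bar>) has_derivative
      (\<lambda>v. trace (matrix_inv (a x) ** metric_deriv a x v) - trace (matrix_inv (g x) ** metric_deriv g x v))) (at x)"
    by (intro has_derivative_diff d a g)
  from frechet_derivative_eqI[OF this] show ?thesis
    using tr[OF a(2) cov(1)] tr[of g 0] g(2) cov(2) by (simp add: pd_def)
qed

section \<open>The Kropina condition as a polynomial identity\<close>

text \<open>On the line through \<open>y0\<close> and \<open>y\<close> both sides are cubic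
  polynomials in the parameter. They agree for infinitely many values, hence at the value 1 that
  gives \<open>y\<close>.\<close>

lemma quadratic_zero_on_open_extends:
  fixes a a' :: "real^'n::finite^'n" and b b' :: "real^'n"
  assumes S: "open S" "y0 \<in> S"
    and eq: "\<And>y. y \<in> S \<Longrightarrow> p * (y \<bullet> (a' *v y)) * (b \<bullet> y) = q * (y \<bullet> (a *v y)) * (b' \<bullet> y)"
  shows "p * (y \<bullet> (a' *v y)) * (b \<bullet> y) = q * (y \<bullet> (a *v y)) * (b' \<bullet> y)"
proof -
  define v where "v = y - y0"
  define Q where "Q A = [: y0 \<bullet> (A *v y0), y0 \<bullet> (A *v v) + v \<bullet> (A *v y0), v \<bullet> (A *v v) :]" for A :: "real^'n^'n"
  define B where "B c = [: c \<bullet> y0, c \<bullet> v :]" for c :: "real^'n"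
  have Q: "poly (Q A) t = (y0 + t *\<^sub>R v) \<bullet> (A *v (y0 + t *\<^sub>R v))" for A t
    by (simp add: Q_def matrix_vector_right_distrib linear_scale[OF matrix_vector_mul_linear] inner_add_left inner_add_right algebra_simps)
  have B: "poly (B c) t = c \<bullet> (y0 + t *\<^sub>R v)" for c t by (simp add: B_def inner_add_right)
  define P where "P = smult p (Q a' * B b) - smult q (Q a * B b')"
  have P: "poly P t = p * ((y0 + t *\<^sub>R v) \<bullet> (a' *v (y0 + t *\<^sub>R v))) * (b \<bullet> (y0 + t *\<^sub>R v))
     - q * ((y0 + t *\<^sub>R v) \<bullet> (a *v (y0 + t *\<^sub>R v))) * (b' \<bullet> (y0 + t *\<^sub>R v))" for t
    by (simp add: P_def Q B)
  have opn: "open ((\<lambda>t::real. y0 + t *\<^sub>R v) -` S)" by (intro open_vimage S(1) continuous_intros)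
  have "0 \<in> (\<lambda>t::real. y0 + t *\<^sub>R v) -` S" using S(2) by simp
  then have "infinite ((\<lambda>t::real. y0 + t *\<^sub>R v) -` S)" using opn by (metis empty_iff finite_imp_not_open)
  moreover have "(\<lambda>t::real. y0 + t *\<^sub>R v) -` S \<subseteq> {t. poly P t = 0}" using eq P by auto
  ultimately have "P = 0" using poly_roots_finite[of P] finite_subset by blast
  then have "poly P 1 = 0" by simp
  then show ?thesis unfolding P by (simp add: v_def)
qed

lemma orthogonal_complement_multiple:
  fixes w b :: "'a::euclidean_space"
  assumes "b \<noteq> 0" "\<And>k. b \<bullet> k = 0 \<Longrightarrow> w \<bullet> k = 0"
  shows "w = ((w \<bullet> b) / (b \<bullet> b)) *\<^sub>R b"
proof -
  let ?c = "(w \<bullet> b) / (b \<bullet> b)"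
  have bb: "b \<bullet> b \<noteq> 0" using assms(1) by simp
  have k: "b \<bullet> (w - ?c *\<^sub>R b) = 0" using bb by (simp add: inner_diff_right inner_commute)
  have "(w - ?c *\<^sub>R b) \<bullet> (w - ?c *\<^sub>R b) = w \<bullet> (w - ?c *\<^sub>R b) - ?c * (b \<bullet> (w - ?c *\<^sub>R b))"
    by (simp add: inner_diff_left)
  also have "\<dots> = 0" using k assms(2)[OF k] by simp
  finally show ?thesis by simp
qed

text \<open>The hyperplane argument shows b' = \<kappa> b. Then b(y) cancels where it is nonzero, so
  the quadratic form (1 + m) a' - 2m \<kappa> a vanishes off the hyperplane and therefore
  everywhere; the common factor is f = \<kappa> / (1 + m).\<close>

lemma kropina_identity:
  fixes a a' :: "real^'n::finite^'n" and b b' :: "real^'n"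
  assumes a: "transpose a = a" "invertible a" and a': "transpose a' = a'" and b: "b \<noteq> 0" and n: "CARD('n) > 2"
    and m: "m \<noteq> 0" "1 + m \<noteq> 0"
    and S: "open S" "y0 \<in> S"
    and eq: "\<And>y. y \<in> S \<Longrightarrow> (1 + m) * (y \<bullet> (a' *v y)) * (b \<bullet> y) = (2 * m) * (y \<bullet> (a *v y)) * (b' \<bullet> y)"
  shows "\<exists>f. a' = (2 * m * f) *\<^sub>R a \<and> b' = ((1 + m) * f) *\<^sub>R b"
proof -
  have sym: "u \<bullet> (A *v v) = v \<bullet> (A *v u)" if "transpose A = A" for u v and A :: "real^'n^'n"
    using inner_matrix_transpose[of A u v] that by (simp add: inner_commute)
  have expand: "(u + t *\<^sub>R v) \<bullet> (A *v (u + t *\<^sub>R v)) = u \<bullet> (A *v u) + t * (2 * (u \<bullet> (A *v v))) + t * t * (v \<bullet> (A *v v))"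
    if "transpose A = A" for u v t and A :: "real^'n^'n"
    using sym[OF that, of v u]
    by (simp add: matrix_vector_right_distrib linear_scale[OF matrix_vector_mul_linear] inner_add_left inner_add_right algebra_simps)
  have eq': "(1 + m) * (y \<bullet> (a' *v y)) * (b \<bullet> y) = (2 * m) * (y \<bullet> (a *v y)) * (b' \<bullet> y)" for y
    by (rule quadratic_zero_on_open_extends[OF S eq])
  have b'K: "b' \<bullet> z = 0" if z: "b \<bullet> z = 0" for z
  proof (rule ccontr)
    assume nz: "b' \<bullet> z \<noteq> 0"
    have Kz: "(y \<bullet> (a *v y)) * (b' \<bullet> y) = 0" if "b \<bullet> y = 0" for y
      using eq'[of y] that m(1) by simp
    \<comment> \<open>Along y + t z, inside the hyperplane, the product of the polynomials
      \<open>P\<close> for a and \<open>R\<close> for b' vanishes. \<open>R\<close> has the leading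
      coefficient \<open>b' \<bullet> z \<noteq> 0\<close>, so every coefficient of \<open>P\<close>
      is zero.\<close>
    have Q0: "y \<bullet> (a *v y) = 0 \<and> y \<bullet> (a *v z) = 0" if y: "b \<bullet> y = 0" for y
    proof -
      define P where "P = [: y \<bullet> (a *v y), 2 * (y \<bullet> (a *v z)), z \<bullet> (a *v z) :]"
      define R where "R = [: b' \<bullet> y, b' \<bullet> z :]"
      have "poly (P * R) t = 0" for t
      proof -
        have "poly (P * R) t = ((y + t *\<^sub>R z) \<bullet> (a *v (y + t *\<^sub>R z))) * (b' \<bullet> (y + t *\<^sub>R z))"
          unfolding expand[OF a(1), of y t z] by (simp add: P_def R_def inner_add_right algebra_simps)
        also have "\<dots> = 0" by (rule Kz) (use y z in \<open>simp add: inner_add_right\<close>)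
        finally show ?thesis .
      qed
      then have "P * R = 0" by (metis poly_all_0_iff_0)
      moreover have "R \<noteq> 0" using nz by (simp add: R_def)
      ultimately have "P = 0" by simp
      then show ?thesis by (simp add: P_def)
    qed
    have iso: "w \<bullet> (a *v y) = 0" if "b \<bullet> y = 0" "b \<bullet> w = 0" for y w
      using Q0[of "y + 1 *\<^sub>R w"] Q0[of y] Q0[of w] that expand[OF a(1), of y 1 w] sym[OF a(1), of w y]
      by (simp add: inner_add_right)
    \<comment> \<open>For y in the hyperplane, \<open>a *v y\<close> annihilates the hyperplane and
      so is a multiple of \<open>b\<close>. Inverting \<open>a\<close> confines the whole hyperplane
      to one line.\<close>
    have "{y. b \<bullet> y = 0} \<subseteq> span {matrix_inv a *v b}"
    proof
      fix y assume "y \<in> {y. b \<bullet> y = 0}"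
      then have y: "b \<bullet> y = 0" by simp
      have "a *v y = ((a *v y) \<bullet> b / (b \<bullet> b)) *\<^sub>R b"
        by (rule orthogonal_complement_multiple[OF b]) (use iso[OF y] in \<open>simp add: inner_commute\<close>)
      then have "matrix_inv a *v (a *v y) = ((a *v y) \<bullet> b / (b \<bullet> b)) *\<^sub>R (matrix_inv a *v b)"
        by (metis linear_scale[OF matrix_vector_mul_linear])
      then have "y = ((a *v y) \<bullet> b / (b \<bullet> b)) *\<^sub>R (matrix_inv a *v b)"
        using matrix_inv_left[OF a(2)] by (simp add: matrix_vector_mul_assoc)
      then show "y \<in> span {matrix_inv a *v b}" by (metis span_base span_scale singletonI)
    qed
    then have "dim {y. b \<bullet> y = 0} \<le> card {matrix_inv a *v b}"
      by (intro dim_le_card) auto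
    moreover have "dim {y. b \<bullet> y = 0} = DIM(real^'n) - 1" by (rule dim_hyperplane[OF b])
    ultimately show False using n by simp
  qed
  define \<kappa> where "\<kappa> = (b' \<bullet> b) / (b \<bullet> b)"
  have b'_eq: "b' = \<kappa> *\<^sub>R b"
    unfolding \<kappa>_def by (rule orthogonal_complement_multiple[OF b b'K])
  define C where "C = (1 + m) *\<^sub>R a' - (2 * m * \<kappa>) *\<^sub>R a"
  have C: "transpose C = C" using a(1) a' by (simp add: C_def vec_eq_iff transpose_def)
  have Cy: "y \<bullet> (C *v y) = (1 + m) * (y \<bullet> (a' *v y)) - 2 * m * \<kappa> * (y \<bullet> (a *v y))" for y
    by (simp add: C_def matrix_vector_mult_diff_rdistrib scaleR_matrix_vector_assoc[symmetric] inner_diff_right)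
  have 0: "y \<bullet> (C *v y) = 0" if "b \<bullet> y \<noteq> 0" for y
  proof -
    have "(y \<bullet> (C *v y)) * (b \<bullet> y) = 0"
      using eq'[of y] unfolding Cy b'_eq by (simp add: algebra_simps)
    then show ?thesis using that by simp
  qed
  have all: "y \<bullet> (C *v y) = 0" for y
  proof (cases "b \<bullet> y = 0")
    case True
    have bb: "b \<bullet> b \<noteq> 0" using b by simp
    \<comment> \<open>Moving off the hyperplane in direction \<open>b\<close> gives a quadratic
      polynomial in t that vanishes for t \<noteq> 0; three values of t force its constant term to
      vanish.\<close>
    have "y \<bullet> (C *v y) + t * (2 * (y \<bullet> (C *v b))) + t * t * (b \<bullet> (C *v b)) = 0" if "t \<noteq> 0" for t
      using 0[of "y + t *\<^sub>R b"] expand[OF C, of y t b] True bb that by (simp add: inner_add_right)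
    from this[of 1] this[of "-1"] this[of 2] show ?thesis by simp
  qed (rule 0)
  have "C = 0"
  proof -
    have "axis i 1 \<bullet> (C *v axis j 1) = 0" for i j
      using expand[OF C, of "axis i 1" 1 "axis j 1"] all[of "axis i 1 + 1 *\<^sub>R axis j 1"] all[of "axis i 1"] all[of "axis j 1"] by simp
    then have "C $ i $ j = 0" for i j
      by (simp add: matrix_vector_mult_basis column_def inner_axis' )
    then show ?thesis by (simp add: vec_eq_iff)
  qed
  then have "(1 + m) *\<^sub>R a' = (2 * m * \<kappa>) *\<^sub>R a" by (simp add: C_def)
  then have "a' = (1 / (1 + m)) *\<^sub>R (2 * m * \<kappa>) *\<^sub>R a" using m(2)
    by (metis divide_inverse inverse_eq_divide mult_1 scaleR_one scaleR_scaleR left_inverse)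
  then have "a' = (2 * m * (\<kappa> / (1 + m))) *\<^sub>R a" by simp
  moreover have "b' = ((1 + m) * (\<kappa> / (1 + m))) *\<^sub>R b" using b'_eq m(2) by simp
  ultimately show ?thesis by blast
qed

section \<open>Connections as bilinear maps\<close>

definition conn :: "('n::finite \<Rightarrow> 'n \<Rightarrow> 'n \<Rightarrow> real) \<Rightarrow> real^'n \<Rightarrow> real^'n \<Rightarrow> real^'n" where
  "conn \<Gamma> e y = (\<Sum>k\<in>UNIV. e $ k *\<^sub>R (christoffel_matrix \<Gamma> k *v y))"

lemma conn_nth: "conn \<Gamma> e y $ l = (\<Sum>k\<in>UNIV. \<Sum>j\<in>UNIV. e $ k * y $ j * \<Gamma> l k j)"
  by (simp add: conn_def christoffel_matrix_def matrix_vector_mult_def sum_distrib_left mult_ac)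

lemma conn_axis: "conn \<Gamma> (axis k 1) y = christoffel_matrix \<Gamma> k *v y"
  by (simp add: conn_def axis_def if_distrib[of "\<lambda>x. x *\<^sub>R _"] cong: if_cong)

lemma linear_conn: "linear (conn \<Gamma> e)"
  unfolding conn_def
  by (intro linear_compose_sum ballI linear_compose_scale_right matrix_vector_mul_linear)

lemma linear_conn_left: "linear (\<lambda>e. conn \<Gamma> e y)"
  by (rule linearI) (simp_all add: conn_def scaleR_add_left sum.distrib scaleR_sum_right)

lemma conn_add_left: "conn \<Gamma> (e + e') y = conn \<Gamma> e y + conn \<Gamma> e' y"
  and conn_scale_left: "conn \<Gamma> (c *\<^sub>R e) y = c *\<^sub>R conn \<Gamma> e y"
  by (rule linear_add[OF linear_conn_left] linear_scale[OF linear_conn_left])+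

lemma conn_sym:
  assumes "\<And>k i j. \<Gamma> k i j = \<Gamma> k j i"
  shows "conn \<Gamma> e y = conn \<Gamma> y e"
proof -
  have "conn \<Gamma> e y $ l = conn \<Gamma> y e $ l" for l
    unfolding conn_nth using assms[of l] by (subst sum.swap) (simp add: mult_ac)
  then show ?thesis by (simp add: vec_eq_iff)
qed

lemma linear_axis_expand:
  assumes "linear f"
  shows "f e = (\<Sum>k\<in>UNIV. e $ k *\<^sub>R f (axis k (1::real)))"
proof -
  have "e = (\<Sum>k\<in>UNIV. e $ k *\<^sub>R axis k (1::real))"
    by (simp add: vec_eq_iff axis_def if_distrib cong: if_cong)
  then have "f e = f (\<Sum>k\<in>UNIV. e $ k *\<^sub>R axis k (1::real))" by simp
  then show ?thesis by (simp only: linear_sum[OF assms] linear_scale[OF assms])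
qed

lemma metric_deriv_linear:
  fixes g :: "real^'n::finite \<Rightarrow> real^'n^'n"
  assumes "\<And>i j. (\<lambda>x. g x $ i $ j) differentiable (at x)"
  shows "linear (metric_deriv g x)"
proof -
  have "linear (frechet_derivative (\<lambda>x. g x $ i $ j) (at x))" for i j
    by (rule has_derivative_linear[OF differentiable_frechetD[OF assms]])
  then show ?thesis
    by (intro linearI) (simp_all add: metric_deriv_def vec_eq_iff linear_add linear_scale)
qed

lemma metric_deriv_inner:
  fixes g :: "real^'n::finite \<Rightarrow> real^'n^'n"
  assumes "\<And>i j. (\<lambda>x. g x $ i $ j) differentiable (at x)"
  shows "((\<lambda>x. y \<bullet> (g x *v z)) has_derivative (\<lambda>e. y \<bullet> (metric_deriv g x e *v z))) (at x)"
  unfolding matrix_inner_expand metric_deriv_def vec_lambda_beta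
  by (intro has_derivative_sum has_derivative_mult_left has_derivative_mult_right differentiable_frechetD assms)

lemma cov_metric_inner:
  "y \<bullet> (cov_metric \<Gamma> g k x *v z) = y \<bullet> (metric_deriv g x (axis k 1) *v z)
     - conn \<Gamma> (axis k 1) y \<bullet> (g x *v z) - y \<bullet> (g x *v conn \<Gamma> (axis k 1) z)"
  by (simp add: cov_metric_def matrix_vector_mult_diff_rdistrib inner_diff_right conn_axis
      inner_matrix_transpose matrix_vector_mul_assoc[symmetric])

lemma transpose_eq_nth: "transpose A = A \<Longrightarrow> A $ i $ j = A $ j $ i"
  by (drule arg_cong[of _ _ "\<lambda>B. B $ i $ j"]) (simp add: transpose_def)

lemma matrix_eq_0_inner: "(\<And>y z. y \<bullet> (A *v z) = 0) \<Longrightarrow> A = 0" for A :: "real^'n^'k"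
proof -
  assume 0: "\<And>y z. y \<bullet> (A *v z) = 0"
  have "A $ i $ j = axis i 1 \<bullet> (A *v axis j 1)" for i j
    by (simp add: matrix_vector_mult_basis column_def inner_axis')
  then show "A = 0" using 0 by (simp add: vec_eq_iff)
qed

text \<open>The form of parallelism with arbitrary directions. Under a change of chart coordinate
  directions go to general ones, so the componentwise form cannot be transported directly.\<close>

lemma parallel_metric_iff:
  fixes g :: "real^'n::finite \<Rightarrow> real^'n^'n"
  assumes g: "\<And>i j. (\<lambda>x. g x $ i $ j) differentiable (at x)"
  shows "(\<forall>k. cov_metric \<Gamma> g k x = 0) \<longleftrightarrow>
     (\<forall>e y z. y \<bullet> (metric_deriv g x e *v z) = conn \<Gamma> e y \<bullet> (g x *v z) + y \<bullet> (g x *v conn \<Gamma> e z))"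
proof
  assume R: "\<forall>e y z. y \<bullet> (metric_deriv g x e *v z) = conn \<Gamma> e y \<bullet> (g x *v z) + y \<bullet> (g x *v conn \<Gamma> e z)"
  show "\<forall>k. cov_metric \<Gamma> g k x = 0"
    by (intro allI matrix_eq_0_inner) (simp add: cov_metric_inner R)
next
  assume L: "\<forall>k. cov_metric \<Gamma> g k x = 0"
  show "\<forall>e y z. y \<bullet> (metric_deriv g x e *v z) = conn \<Gamma> e y \<bullet> (g x *v z) + y \<bullet> (g x *v conn \<Gamma> e z)"
  proof (intro allI)
    fix e y z
    define f where "f e = y \<bullet> (metric_deriv g x e *v z) - conn \<Gamma> e y \<bullet> (g x *v z) - y \<bullet> (g x *v conn \<Gamma> e z)" for e
    have "linear f"
      using metric_deriv_linear[OF g]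
      by (intro linearI) (simp_all add: f_def conn_add_left conn_scale_left linear_add linear_scale matrix_vector_mult_add_rdistrib
          scaleR_matrix_vector_assoc[symmetric] matrix_vector_right_distrib linear_scale[OF matrix_vector_mul_linear]
          inner_add_left inner_add_right algebra_simps)
    from linear_axis_expand[OF this, of e]
    have "f e = 0" using cov_metric_inner[of y \<Gamma> g _ x z] L by (simp add: f_def)
    then show "y \<bullet> (metric_deriv g x e *v z) = conn \<Gamma> e y \<bullet> (g x *v z) + y \<bullet> (g x *v conn \<Gamma> e z)" by (simp add: f_def)
  qed
qed

context finsler_lagrangian begin

text \<open>Stated for bilinear maps because a connection pulled back from another chart arises as
  such a map and not as an array of symbols.\<close>

lemma bilinear_connection_unique:
  assumes B1: "\<And>e. linear (B1 e)" "\<And>e y. B1 e y = B1 y e"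
      "\<And>e y. (x, y) \<in> \<Omega> \<Longrightarrow> frechet_derivative L (at (x, y)) (e, - B1 e y) = 0"
    and B2: "\<And>e. linear (B2 e)" "\<And>e y. B2 e y = B2 y e"
      "\<And>e y. (x, y) \<in> \<Omega> \<Longrightarrow> frechet_derivative L (at (x, y)) (e, - B2 e y) = 0"
    and ne: "(x, y0) \<in> \<Omega>"
  shows "B1 e y = B2 e y"
proof -
  have "B1 e y - B2 e y = 0"
  proof (rule horizontal_unique[OF _ _ _ ne, of "\<lambda>e y. B1 e y - B2 e y"])
    show "linear (\<lambda>y. B1 e y - B2 e y)" for e by (intro linear_compose_sub B1 B2)
    show "B1 e y - B2 e y = B1 y e - B2 y e" for e y using B1(2)[of e y] B2(2)[of e y] by simp
    show "frechet_derivative L (at (x, y)) (0, B1 e y - B2 e y) = 0" if "(x, y) \<in> \<Omega>" for e y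
    proof -
      have "(0, B1 e y - B2 e y) = (e, - B2 e y) - (e, - B1 e y)" by simp
      then show ?thesis
        using linear_diff[OF has_derivative_linear[OF smooth_on_has_derivative[OF L_smooth that]], of "(e, - B2 e y)" "(e, - B1 e y)"]
          B1(3)[OF that, of e] B2(3)[OF that, of e] by simp
    qed
  qed
  then show ?thesis by simp
qed

lemma horizontal_conn:
  assumes \<Gamma>: "\<And>z k i. z \<in> \<Omega> \<Longrightarrow> nonlinear_conn L k i z = (\<Sum>j\<in>UNIV. \<Gamma> (fst z) k i j * snd z $ j)"
    and z: "(x, y) \<in> \<Omega>"
  shows "frechet_derivative L (at (x, y)) (e, - conn (\<Gamma> x) e y) = 0"
proof -
  note lin = has_derivative_linear[OF smooth_on_has_derivative[OF L_smooth z]]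
  have ax: "frechet_derivative L (at (x, y)) (axis k 1, - conn (\<Gamma> x) (axis k 1) y) = 0" for k
  proof -
    have "(axis k (1::real), - conn (\<Gamma> x) (axis k 1) y) = (axis k 1, 0) - (0, conn (\<Gamma> x) (axis k 1) y)" by simp
    then have "frechet_derivative L (at (x, y)) (axis k 1, - conn (\<Gamma> x) (axis k 1) y)
      = pdx k L (x, y) - (\<Sum>j\<in>UNIV. conn (\<Gamma> x) (axis k 1) y $ j * pdy j L (x, y))"
      by (simp only: linear_diff[OF lin] frechet_derivative_vertical[OF diff_at[OF L_smooth z]] pdx_def)
    moreover have "conn (\<Gamma> x) (axis k 1) y $ j = nonlinear_conn L j k (x, y)" for j
      using \<Gamma>[OF z, of j k] by (simp add: conn_axis christoffel_matrix_def matrix_vector_mult_def)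
    ultimately show ?thesis using horizontal[OF z, of k] by simp
  qed
  have "linear (\<lambda>e. frechet_derivative L (at (x, y)) (e, - conn (\<Gamma> x) e y))"
  proof -
    have "linear (\<lambda>e. (e, - conn (\<Gamma> x) e y))"
      by (intro linearI) (simp_all add: conn_add_left conn_scale_left)
    from linear_compose[OF this lin] show ?thesis by (simp add: o_def)
  qed
  from linear_axis_expand[OF this, of e] show ?thesis by (simp add: ax)
qed

end

section \<open>The local form of Kropina metrics\<close>

lemma has_derivative_kropina:
  fixes Q \<beta> :: "'a::real_normed_vector \<Rightarrow> real"
  assumes Q: "(Q has_derivative Q') (at z)" "Q z \<noteq> 0" and \<beta>: "(\<beta> has_derivative \<beta>') (at z)" "\<beta> z > 0"
  shows "((\<lambda>z. \<bar>Q z\<bar> powr p * \<beta> z powr q) has_derivative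
     (\<lambda>d. (\<bar>Q z\<bar> powr p * \<beta> z powr q) * (p * Q' d / Q z + q * \<beta>' d / \<beta> z))) (at z)"
proof -
  \<comment> \<open>The absolute value is replaced by a power of the square, which is differentiable
    wherever \<open>Q\<close> is nonzero, whatever its sign.\<close>
  have QQ: "(Q w * Q w) powr (p / 2) = \<bar>Q w\<bar> powr p" for w
  proof -
    have "Q w * Q w = \<bar>Q w\<bar> powr 2" by (simp add: powr_numeral power2_eq_square)
    then have "(Q w * Q w) powr (p / 2) = \<bar>Q w\<bar> powr (2 * (p / 2))" by (simp only: powr_powr)
    then show ?thesis by simp
  qed
  have "((\<lambda>w. Q w * Q w) has_derivative (\<lambda>d. Q z * Q' d + Q' d * Q z)) (at z)" by (rule has_derivative_mult[OF Q(1) Q(1)])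
  then have "((\<lambda>w. (Q w * Q w) powr (p / 2)) has_derivative
     (\<lambda>d. (Q z * Q z) powr (p / 2) * (0 * ln (Q z * Q z) + (Q z * Q' d + Q' d * Q z) * (p / 2) / (Q z * Q z)))) (at z)"
    by (rule has_derivative_powr[OF _ has_derivative_const]) (use Q(2) in \<open>auto simp: zero_less_mult_iff\<close>)
  then have 1: "((\<lambda>w. \<bar>Q w\<bar> powr p) has_derivative (\<lambda>d. \<bar>Q z\<bar> powr p * (p * Q' d / Q z))) (at z)"
    using Q(2) by (simp add: QQ field_simps)
  have 2: "((\<lambda>w. \<beta> w powr q) has_derivative (\<lambda>d. \<beta> z powr q * (0 * ln (\<beta> z) + \<beta>' d * q / \<beta> z))) (at z)"
    by (rule has_derivative_powr[OF \<beta>(1) has_derivative_const]) (use \<beta>(2) in auto)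
  show ?thesis
    using has_derivative_mult[OF 1 2] by (simp add: algebra_simps)
qed

text \<open>\<open>L = F\<^sup>2\<close> for an \<open>m\<close>-Kropina metric in a chart with coordinate domain \<open>S\<close>.\<close>

locale kropina_lagrangian = finsler_lagrangian L \<Omega>
  for L :: "(real^'n::finite) \<times> (real^'n) \<Rightarrow> real" and \<Omega> +
  fixes S :: "(real^'n) set" and a :: "real^'n \<Rightarrow> real^'n^'n" and b :: "real^'n \<Rightarrow> real^'n" and m :: real
  assumes open_S: "open S" and fst_\<Omega>: "\<And>z. z \<in> \<Omega> \<Longrightarrow> fst z \<in> S"
    and fibre_ne: "\<And>x. x \<in> S \<Longrightarrow> \<exists>y. (x, y) \<in> \<Omega>"
    and a_smooth: "\<And>i j. smooth_on (\<lambda>x. a x $ i $ j) S" and b_smooth: "smooth_on b S"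
    and a_sym: "\<And>x. x \<in> S \<Longrightarrow> transpose (a x) = a x" and a_inv: "\<And>x. x \<in> S \<Longrightarrow> invertible (a x)"
    and a_ne: "\<And>x y. (x, y) \<in> \<Omega> \<Longrightarrow> y \<bullet> (a x *v y) \<noteq> 0" and b_pos: "\<And>x y. (x, y) \<in> \<Omega> \<Longrightarrow> b x \<bullet> y > 0"
    and L_eq: "\<And>x y. (x, y) \<in> \<Omega> \<Longrightarrow> L (x, y) = \<bar>y \<bullet> (a x *v y)\<bar> powr (1 + m) * (b x \<bullet> y) powr (- 2 * m)"
begin

lemma a_diff: "x \<in> S \<Longrightarrow> (\<lambda>x. a x $ i $ j) differentiable (at x)"
  by (rule smooth_on_differentiable[OF a_smooth])

lemma b_diff: "x \<in> S \<Longrightarrow> b differentiable (at x)"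
  by (rule smooth_on_differentiable[OF b_smooth])

lemma b_ne: "x \<in> S \<Longrightarrow> b x \<noteq> 0"
  using fibre_ne b_pos by fastforce

lemma L_pos: "(x, y) \<in> \<Omega> \<Longrightarrow> L (x, y) > 0"
  using L_eq a_ne b_pos[of x y] by simp

text \<open>A logarithmic derivative: each of the two factors of \<open>L\<close> contributes its
  exponent times the relative change of a(y, y) or b(y), and along the horizontal lift these changes
  are the covariant derivatives.\<close>

lemma L_derivative_horizontal:
  assumes z: "(x, y) \<in> \<Omega>"
  shows "frechet_derivative L (at (x, y)) (axis k 1, - conn \<Gamma> (axis k 1) y) =
     L (x, y) * ((1 + m) * (y \<bullet> (cov_metric \<Gamma> a k x *v y)) / (y \<bullet> (a x *v y)) - 2 * m * (cov_form \<Gamma> b k x \<bullet> y) / (b x \<bullet> y))"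
proof -
  have x: "x \<in> S" using fst_\<Omega>[OF z] by simp
  let ?Q = "\<lambda>z. snd z \<bullet> (a (fst z) *v snd z)" and ?\<beta> = "\<lambda>z. b (fst z) \<bullet> snd z"
  have "((\<lambda>z. \<bar>?Q z\<bar> powr (1 + m) * ?\<beta> z powr (- 2 * m)) has_derivative
     (\<lambda>d. (\<bar>?Q (x, y)\<bar> powr (1 + m) * ?\<beta> (x, y) powr (- 2 * m)) *
       ((1 + m) * (snd d \<bullet> (a x *v y) + y \<bullet> (metric_deriv a x (fst d) *v y) + y \<bullet> (a x *v snd d)) / ?Q (x, y)
        + (- 2 * m) * (b x \<bullet> snd d + frechet_derivative b (at x) (fst d) \<bullet> y) / ?\<beta> (x, y)))) (at (x, y))"
    by (rule has_derivative_kropina[OF has_derivative_quadratic[OF a_diff[OF x]] _ has_derivative_form[OF b_diff[OF x]]])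
      (use a_ne[OF z] b_pos[OF z] in auto)
  moreover have "frechet_derivative L (at (x, y)) = frechet_derivative (\<lambda>z. \<bar>?Q z\<bar> powr (1 + m) * ?\<beta> z powr (- 2 * m)) (at (x, y))"
    by (rule frechet_derivative_cong_open[OF open_\<Omega> z]) (use L_eq in auto)
  ultimately show ?thesis
    using quadratic_horizontal[of a x \<Gamma> k y, OF a_sym[OF x]] form_horizontal[of b x \<Gamma> k y] L_eq[OF z]
    by (simp add: frechet_derivative_eqI conn_axis)
qed

lemma covariant_derivatives:
  assumes n: "CARD('n) > 2" and m: "m \<noteq> 0" "1 + m \<noteq> 0"
    and \<Gamma>: "\<And>z k i. z \<in> \<Omega> \<Longrightarrow> nonlinear_conn L k i z = (\<Sum>j\<in>UNIV. \<Gamma> (fst z) k i j * snd z $ j)"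
    and x: "x \<in> S"
  shows "\<exists>f. cov_metric (\<Gamma> x) a k x = (2 * m * f) *\<^sub>R a x \<and> cov_form (\<Gamma> x) b k x = ((1 + m) * f) *\<^sub>R b x"
proof -
  obtain y0 where y0: "(x, y0) \<in> \<Omega>" using fibre_ne[OF x] by blast
  show ?thesis
  proof (rule kropina_identity[OF a_sym[OF x] a_inv[OF x] _ b_ne[OF x] n m])
    have sym_deriv: "metric_deriv a x e $ i $ j = metric_deriv a x e $ j $ i" for e i j
    proof -
      have "a y $ i $ j = a y $ j $ i" if "y \<in> S" for y
        by (rule transpose_eq_nth[OF a_sym[OF that]])
      then show ?thesis
        using frechet_derivative_cong_open[OF open_S x, of "\<lambda>x. a x $ i $ j" "\<lambda>x. a x $ j $ i"] by (simp add: metric_deriv_def)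
    qed
    have asym: "a x $ i $ j = a x $ j $ i" for i j by (rule transpose_eq_nth[OF a_sym[OF x]])
    have "cov_metric (\<Gamma> x) a k x $ i $ j = cov_metric (\<Gamma> x) a k x $ j $ i" for i j
      using sym_deriv[of "axis k 1" i j] asym
      by (simp add: cov_metric_nth metric_deriv_def pd_def[symmetric])
    then show "transpose (cov_metric (\<Gamma> x) a k x) = cov_metric (\<Gamma> x) a k x"
      by (simp add: vec_eq_iff transpose_def)
    show "open (Pair x -` \<Omega>)" by (intro open_vimage open_\<Omega> continuous_intros)
    show "y0 \<in> Pair x -` \<Omega>" using y0 by simp
    fix y assume "y \<in> Pair x -` \<Omega>"
    then have z: "(x, y) \<in> \<Omega>" by simp
    \<comment> \<open>\<open>L\<close> is positive, so its vanishing horizontal derivative leaves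
      only this bracket; clearing the nonzero denominators makes it a polynomial identity in
      y.\<close>
    have "(1 + m) * (y \<bullet> (cov_metric (\<Gamma> x) a k x *v y)) / (y \<bullet> (a x *v y)) - 2 * m * (cov_form (\<Gamma> x) b k x \<bullet> y) / (b x \<bullet> y) = 0"
      using L_derivative_horizontal[OF z, of k "\<Gamma> x"] horizontal_conn[OF \<Gamma> z, of "axis k 1"] L_pos[OF z] by simp
    then show "(1 + m) * (y \<bullet> (cov_metric (\<Gamma> x) a k x *v y)) * (b x \<bullet> y) = 2 * m * (y \<bullet> (a x *v y)) * (cov_form (\<Gamma> x) b k x \<bullet> y)"
      using a_ne[OF z] b_pos[OF z] by (simp add: field_simps)
  qed
qed

lemma parallel_imp_horizontal:
  assumes "\<And>k. cov_metric \<Gamma> a k x = 0" "\<And>k. cov_form \<Gamma> b k x = 0" "(x, y) \<in> \<Omega>"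
  shows "frechet_derivative L (at (x, y)) (e, - conn \<Gamma> e y) = 0"
proof -
  note lin = has_derivative_linear[OF smooth_on_has_derivative[OF L_smooth assms(3)]]
  have "linear (\<lambda>e. frechet_derivative L (at (x, y)) (e, - conn \<Gamma> e y))"
  proof -
    have "linear (\<lambda>e. (e, - conn \<Gamma> e y))"
      by (intro linearI) (simp_all add: conn_add_left conn_scale_left)
    from linear_compose[OF this lin] show ?thesis by (simp add: o_def)
  qed
  from linear_axis_expand[OF this, of e] show ?thesis
    using L_derivative_horizontal[OF assms(3), of _ \<Gamma>] assms(1,2) by simp
qed

end

section \<open>Coordinates adapted to a parallel null form\<close>

definition levi_civita_symbol :: "(real^'n::finite \<Rightarrow> real^'n^'n) \<Rightarrow> real^'n \<Rightarrow> 'n \<Rightarrow> 'n \<Rightarrow> 'n \<Rightarrow> real" where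
  "levi_civita_symbol g x k i j = 1/2 * (\<Sum>l\<in>UNIV. matrix_inv (g x) $ k $ l *
     (pd i (\<lambda>x. g x $ l $ j) x + pd j (\<lambda>x. g x $ l $ i) x - pd l (\<lambda>x. g x $ i $ j) x))"

lemma pd_cong_open: "open S \<Longrightarrow> x \<in> S \<Longrightarrow> (\<And>y. y \<in> S \<Longrightarrow> f y = g y) \<Longrightarrow> pd k f x = pd k g x"
  unfolding pd_def using frechet_derivative_cong_open[of S x f g] by simp

text \<open>Lowering the upper index gives the symbols of the first kind and removes the inverse
  matrix, so both parallelism and the Killing condition become linear in derivatives of g.\<close>

lemma levi_civita_lower:
  assumes "invertible (g x)"
  shows "(\<Sum>k\<in>UNIV. g x $ p $ k * levi_civita_symbol g x k i j) =
     1/2 * (pd i (\<lambda>x. g x $ p $ j) x + pd j (\<lambda>x. g x $ p $ i) x - pd p (\<lambda>x. g x $ i $ j) x)"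
proof -
  define c where "c = (\<chi> l. pd i (\<lambda>x. g x $ l $ j) x + pd j (\<lambda>x. g x $ l $ i) x - pd l (\<lambda>x. g x $ i $ j) x)"
  have "(\<Sum>k\<in>UNIV. g x $ p $ k * levi_civita_symbol g x k i j) = 1/2 * (g x *v (matrix_inv (g x) *v c)) $ p"
    by (simp add: levi_civita_symbol_def matrix_vector_mult_def c_def sum_distrib_left mult_ac)
  also have "\<dots> = 1/2 * c $ p" using matrix_inv_right[OF assms] by (simp add: matrix_vector_mul_assoc)
  finally show ?thesis by (simp add: c_def)
qed

locale symmetric_metric =
  fixes g :: "real^'n::finite \<Rightarrow> real^'n^'n" and S :: "(real^'n) set"
  assumes opn: "open S" and sym: "\<And>x i j. x \<in> S \<Longrightarrow> g x $ i $ j = g x $ j $ i"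
begin

lemma pd_sym: "x \<in> S \<Longrightarrow> pd k (\<lambda>x. g x $ i $ j) x = pd k (\<lambda>x. g x $ j $ i) x"
  by (rule pd_cong_open[OF opn]) (auto simp: sym)

lemma levi_civita_symbol_sym: "x \<in> S \<Longrightarrow> levi_civita_symbol g x k i j = levi_civita_symbol g x k j i"
  unfolding levi_civita_symbol_def using pd_sym[of x _ i j] by (simp add: add.commute)

lemma levi_civita_parallel:
  assumes x: "x \<in> S" and inv: "invertible (g x)"
  shows "cov_metric (levi_civita_symbol g x) g k x = 0"
proof -
  let ?\<Gamma> = "levi_civita_symbol g x"
  have "cov_metric ?\<Gamma> g k x $ i $ j = 0" for i j
  proof -
    have "(\<Sum>l\<in>UNIV. ?\<Gamma> l k i * g x $ l $ j) = (\<Sum>l\<in>UNIV. g x $ j $ l * ?\<Gamma> l k i)"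
      using sym[OF x] by (simp add: mult.commute)
    moreover have "(\<Sum>l\<in>UNIV. ?\<Gamma> l k j * g x $ i $ l) = (\<Sum>l\<in>UNIV. g x $ i $ l * ?\<Gamma> l k j)"
      by (simp add: mult.commute)
    ultimately show ?thesis
      using pd_sym[OF x, of k i j] pd_sym[OF x, of i j k] pd_sym[OF x, of j i k]
      by (simp add: cov_metric_nth levi_civita_lower[of g x, OF inv])
  qed
  then show ?thesis by (simp add: vec_eq_iff)
qed

lemma null_row_pd:
  assumes row: "\<And>x j. x \<in> S \<Longrightarrow> g x $ iv $ j = r j" and x: "x \<in> S"
  shows "pd k (\<lambda>x. g x $ iv $ j) x = 0"
proof -
  have "pd k (\<lambda>x. g x $ iv $ j) x = pd k (\<lambda>x. r j) x"
    by (rule pd_cong_open[OF opn x]) (rule row)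
  then show ?thesis by (simp add: pd_def frechet_derivative_const)
qed

text \<open>The covector dual to \<open>-\<partial>/\<partial>v\<close> is parallel iff \<open>\<partial>/\<partial>v\<close> is a Killing field.\<close>

lemma killing_imp_parallel:
  assumes row: "\<And>x j. x \<in> S \<Longrightarrow> g x $ iv $ j = - axis iu 1 $ j" and x: "x \<in> S"
    and inv: "invertible (g x)" and killing: "\<And>i j. pd iv (\<lambda>x. g x $ i $ j) x = 0"
  shows "cov_form (levi_civita_symbol g x) (\<lambda>x. axis iu 1) k x = 0"
proof -
  have "(\<Sum>l\<in>UNIV. g x $ iv $ l * levi_civita_symbol g x l i j) = 0" for i j
    using null_row_pd[OF row x] by (simp add: levi_civita_lower[of g x, OF inv] killing)
  then have "levi_civita_symbol g x iu i j = 0" for i j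
    by (simp add: row[OF x] axis_def sum_negf if_distrib[of "\<lambda>x. x * _"] cong: if_cong)
  then show ?thesis
    by (simp add: cov_form_def frechet_derivative_const vec_eq_iff matrix_vector_mult_def christoffel_matrix_def transpose_def
        axis_def if_distrib cong: if_cong)
qed

lemma parallel_imp_killing:
  assumes row: "\<And>x j. x \<in> S \<Longrightarrow> g x $ iv $ j = - axis iu 1 $ j" and x: "x \<in> S"
    and \<Gamma>: "\<And>k i j. \<Gamma> k i j = \<Gamma> k j i"
    and par: "\<And>k. cov_metric \<Gamma> g k x = 0" "\<And>k. cov_form \<Gamma> (\<lambda>x. axis iu 1) k x = 0"
  shows "pd iv (\<lambda>x. g x $ i $ j) x = 0"
proof -
  have "cov_form \<Gamma> (\<lambda>x. axis iu 1) k x $ i = - \<Gamma> iu k i" for k i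
    by (simp add: cov_form_def frechet_derivative_const matrix_vector_mult_def christoffel_matrix_def transpose_def
        axis_def if_distrib cong: if_cong)
  then have iu0: "\<Gamma> iu k i = 0" for k i using par(2)[of k] by (metis neg_equal_0_iff_equal zero_index)
  have "(\<Sum>l\<in>UNIV. \<Gamma> l k j * g x $ iv $ l) = - \<Gamma> iu k j" for k j
    by (simp add: row[OF x] axis_def sum_negf if_distrib cong: if_cong)
  \<comment> \<open>The row of \<open>iv\<close> is constant, so the component (iv, j) of \<nabla>g
    = 0 has no derivative term, and its other connection term is a symbol with upper index
    \<open>iu\<close>, already zero. What remains says that \<partial>/\<partial>v is
    parallel.\<close>
  then have A: "(\<Sum>l\<in>UNIV. \<Gamma> l k iv * g x $ l $ j) = 0" for k j
    using par(1)[of k] null_row_pd[OF row x, of k j] iu0 cov_metric_nth[of \<Gamma> g k x iv j] by simp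
  have B: "(\<Sum>l\<in>UNIV. \<Gamma> l iv i * g x $ l $ j) = 0" for i j using A[of i j] \<Gamma> by simp
  have "(\<Sum>l\<in>UNIV. \<Gamma> l iv j * g x $ i $ l) = 0" using B[of j i] sym[OF x] by simp
  then show ?thesis using B[of i j] par(1)[of iv] cov_metric_nth[of \<Gamma> g iv x i j] by simp
qed

end

lemma has_derivative_bilinear_form:
  fixes g :: "real^'n::finite \<Rightarrow> real^'n^'n" and \<tau> P R :: "'a::real_normed_vector \<Rightarrow> real^'n"
  assumes g: "\<And>i j. (\<lambda>x. g x $ i $ j) differentiable (at (\<tau> x))"
    and \<tau>: "(\<tau> has_derivative \<tau>') (at x)" and P: "(P has_derivative P') (at x)" and R: "(R has_derivative R') (at x)"
  shows "((\<lambda>x. P x \<bullet> (g (\<tau> x) *v R x)) has_derivative (\<lambda>e. P' e \<bullet> (g (\<tau> x) *v R x)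
     + P x \<bullet> (metric_deriv g (\<tau> x) (\<tau>' e) *v R x) + P x \<bullet> (g (\<tau> x) *v R' e))) (at x)"
proof -
  have Pi: "((\<lambda>x. P x $ i) has_derivative (\<lambda>e. P' e $ i)) (at x)" and Ri: "((\<lambda>x. R x $ i) has_derivative (\<lambda>e. R' e $ i)) (at x)" for i
    by (rule bounded_linear.has_derivative[OF bounded_linear_vec_nth P] bounded_linear.has_derivative[OF bounded_linear_vec_nth R])+
  have "((\<lambda>x. g x $ i $ j) has_derivative (\<lambda>e. metric_deriv g (\<tau> x) e $ i $ j)) (at (\<tau> x))" for i j
    using differentiable_frechetD[OF g, of i j] by (simp add: metric_deriv_def)
  note gi = has_derivative_compose[OF \<tau> this]
  have "((\<lambda>x. \<Sum>i\<in>UNIV. \<Sum>j\<in>UNIV. P x $ i * g (\<tau> x) $ i $ j * R x $ j) has_derivative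
     (\<lambda>e. \<Sum>i\<in>UNIV. \<Sum>j\<in>UNIV. (P x $ i * g (\<tau> x) $ i $ j) * R' e $ j
        + (P x $ i * metric_deriv g (\<tau> x) (\<tau>' e) $ i $ j + P' e $ i * g (\<tau> x) $ i $ j) * R x $ j)) (at x)"
    by (intro has_derivative_sum has_derivative_mult Pi Ri gi)
  then show ?thesis
    unfolding matrix_inner_expand by (simp add: algebra_simps sum.distrib)
qed

section \<open>Change of coordinates\<close>

locale coordinate_change =
  fixes \<tau> :: "real^'n::finite \<Rightarrow> real^'n" and T :: "(real^'n) set"
  assumes open_T: "open T" and \<tau>_smooth: "smooth_on \<tau> T"
    and \<tau>_bij: "\<And>x. x \<in> T \<Longrightarrow> bij (frechet_derivative \<tau> (at x))"
begin

abbreviation D\<tau> where "D\<tau> x \<equiv> frechet_derivative \<tau> (at x)"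

definition D2\<tau> where "D2\<tau> x e y = frechet_derivative (\<lambda>x. D\<tau> x y) (at x) e"

lemma D\<tau>: "x \<in> T \<Longrightarrow> (\<tau> has_derivative D\<tau> x) (at x)"
  by (rule smooth_on_has_derivative[OF \<tau>_smooth])

lemma D2\<tau>: "x \<in> T \<Longrightarrow> ((\<lambda>x. D\<tau> x y) has_derivative (\<lambda>e. D2\<tau> x e y)) (at x)"
  unfolding D2\<tau>_def by (rule smooth_on_has_derivative[OF smooth_on_frechet[OF \<tau>_smooth]])

lemma D2\<tau>_sym: "x \<in> T \<Longrightarrow> D2\<tau> x e y = D2\<tau> x y e"
  unfolding D2\<tau>_def by (rule second_derivative_symmetric[OF open_T _ \<tau>_smooth])

lemma D2\<tau>_linear_left: "x \<in> T \<Longrightarrow> linear (\<lambda>e. D2\<tau> x e y)"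
  by (rule has_derivative_linear[OF D2\<tau>])

lemma D2\<tau>_linear:
  assumes "x \<in> T"
  shows "linear (D2\<tau> x e)"
proof -
  have "(\<lambda>e'. D2\<tau> x e' e) = D2\<tau> x e" by (intro ext D2\<tau>_sym assms)
  then show ?thesis using D2\<tau>_linear_left[OF assms, of e] by simp
qed

text \<open>The Hessian term \<open>D2\<tau>\<close> is the source of the inhomogeneous term in the
  transformation law of connections. Expanding y in the coordinate axes gives differentiability
  jointly in x and y.\<close>

lemma tangent_map_derivative:
  assumes x: "x \<in> T"
  shows "((\<lambda>z. (\<tau> (fst z), D\<tau> (fst z) (snd z))) has_derivative
    (\<lambda>d. (D\<tau> x (fst d), D2\<tau> x (fst d) y + D\<tau> x (snd d)))) (at (x, y))"
proof -
  have fx: "(fst has_derivative fst) (at (x, y))" by (rule bounded_linear_imp_has_derivative[OF bounded_linear_fst])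
  have x': "fst (x, y) \<in> T" using x by simp
  have "((\<lambda>z. \<Sum>k\<in>UNIV. snd z $ k *\<^sub>R D\<tau> (fst z) (axis k 1)) has_derivative
     (\<lambda>d. \<Sum>k\<in>UNIV. snd (x, y) $ k *\<^sub>R D2\<tau> (fst (x, y)) (fst d) (axis k 1) + snd d $ k *\<^sub>R D\<tau> (fst (x, y)) (axis k 1))) (at (x, y))"
    by (intro has_derivative_sum has_derivative_scaleR has_derivative_compose[OF fx D2\<tau>[OF x']]
        bounded_linear_imp_has_derivative bounded_linear_compose[OF bounded_linear_vec_nth bounded_linear_snd])
  moreover have "(\<Sum>k\<in>UNIV. snd (x, y) $ k *\<^sub>R D2\<tau> (fst (x, y)) (fst d) (axis k 1) + snd d $ k *\<^sub>R D\<tau> (fst (x, y)) (axis k 1))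
      = D2\<tau> x (fst d) y + D\<tau> x (snd d)" for d
    using linear_axis_expand[OF D2\<tau>_linear[OF x, of "fst d"], of y] linear_axis_expand[OF has_derivative_linear[OF D\<tau>[OF x]], of "snd d"]
    by (simp add: sum.distrib)
  ultimately have "((\<lambda>z. \<Sum>k\<in>UNIV. snd z $ k *\<^sub>R D\<tau> (fst z) (axis k 1)) has_derivative (\<lambda>d. D2\<tau> x (fst d) y + D\<tau> x (snd d))) (at (x, y))"
    by simp
  then have "((\<lambda>z. D\<tau> (fst z) (snd z)) has_derivative (\<lambda>d. D2\<tau> x (fst d) y + D\<tau> x (snd d))) (at (x, y))"
  proof (rule has_derivative_transform_within_open)
    show "open (T \<times> (UNIV :: (real^'n) set))" by (intro open_Times open_T open_UNIV)
    show "(x, y) \<in> T \<times> UNIV" using x by simp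
    show "(\<Sum>k\<in>UNIV. snd z $ k *\<^sub>R D\<tau> (fst z) (axis k 1)) = D\<tau> (fst z) (snd z)" if "z \<in> T \<times> UNIV" for z
      using linear_axis_expand[OF has_derivative_linear[OF D\<tau>], of "fst z" "snd z"] that by auto
  qed
  moreover have "((\<lambda>z. \<tau> (fst z)) has_derivative (\<lambda>d. D\<tau> x (fst d))) (at (x, y))"
    using has_derivative_compose[OF fx D\<tau>[OF x']] by simp
  ultimately show ?thesis by (intro has_derivative_Pair)
qed

text \<open>The right-hand side \<open>R\<close> pulled back by the inverse \<open>K\<close> of
  \<open>D\<tau> x\<close> is a symmetric bilinear map. By the chain rule for Ld(x, y) = Lc(\<tau>
  x, D\<tau> x y) it also preserves \<open>Ld\<close>, so uniqueness identifies it with the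
  connection of \<open>\<Gamma>d\<close>.\<close>

lemma connection_transformation:
  assumes c: "finsler_lagrangian Lc \<Omega>c" and d: "finsler_lagrangian Ld \<Omega>d" and x: "x \<in> T"
    and \<Omega>: "\<And>x y. (x, y) \<in> \<Omega>d \<Longrightarrow> x \<in> T \<Longrightarrow> (\<tau> x, D\<tau> x y) \<in> \<Omega>c"
    and L: "\<And>x y. (x, y) \<in> \<Omega>d \<Longrightarrow> x \<in> T \<Longrightarrow> Ld (x, y) = Lc (\<tau> x, D\<tau> x y)"
    and \<Gamma>c: "\<And>k i j. \<Gamma>c k i j = \<Gamma>c k j i" "\<And>e y. (\<tau> x, y) \<in> \<Omega>c \<Longrightarrow> frechet_derivative Lc (at (\<tau> x, y)) (e, - conn \<Gamma>c e y) = 0"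
    and \<Gamma>d: "\<And>k i j. \<Gamma>d k i j = \<Gamma>d k j i" "\<And>e y. (x, y) \<in> \<Omega>d \<Longrightarrow> frechet_derivative Ld (at (x, y)) (e, - conn \<Gamma>d e y) = 0"
    and ne: "(x, y0) \<in> \<Omega>d"
  shows "D\<tau> x (conn \<Gamma>d e y) = D2\<tau> x e y + conn \<Gamma>c (D\<tau> x e) (D\<tau> x y)"
proof -
  interpret c: finsler_lagrangian Lc \<Omega>c by (rule c)
  interpret d: finsler_lagrangian Ld \<Omega>d by (rule d)
  have lin: "linear (D\<tau> x)" by (rule has_derivative_linear[OF D\<tau>[OF x]])
  have inj: "inj (D\<tau> x)" and surj: "surj (D\<tau> x)" using \<tau>_bij[OF x] by (auto simp: bij_def)
  obtain K where K: "linear K" "K \<circ> D\<tau> x = id"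
    using linear_injective_left_inverse[OF lin inj] by blast
  have KD: "K (D\<tau> x v) = v" for v using fun_cong[OF K(2), of v] by simp
  have DK: "D\<tau> x (K v) = v" for v using KD surj by (metis surjD)
  define R where "R e y = D2\<tau> x e y + conn \<Gamma>c (D\<tau> x e) (D\<tau> x y)" for e y
  have Rlin: "linear (R e)" for e
    unfolding R_def using linear_compose[OF lin linear_conn, of \<Gamma>c "D\<tau> x e"]
    by (intro linear_compose_add D2\<tau>_linear[OF x]) (simp add: o_def)
  have Rsym: "R e y = R y e" for e y
    unfolding R_def using D2\<tau>_sym[OF x] conn_sym[of \<Gamma>c, OF \<Gamma>c(1)] by metis
  have "conn \<Gamma>d e y = K (R e y)"
  proof (rule d.bilinear_connection_unique[OF linear_conn conn_sym[of \<Gamma>d, OF \<Gamma>d(1)] \<Gamma>d(2) _ _ _ ne])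
    show "linear (\<lambda>y. K (R e y))" for e using linear_compose[OF Rlin K(1)] by (simp add: o_def)
    show "K (R e y) = K (R y e)" for e y using Rsym[of e y] by simp
    fix e y assume z: "(x, y) \<in> \<Omega>d"
    have "open (\<Omega>d \<inter> T \<times> UNIV)" by (intro open_Int d.open_\<Omega> open_Times open_T open_UNIV)
    moreover have "(x, y) \<in> \<Omega>d \<inter> T \<times> UNIV" using z x by simp
    ultimately have "frechet_derivative Ld (at (x, y)) = frechet_derivative (\<lambda>z. Lc (\<tau> (fst z), D\<tau> (fst z) (snd z))) (at (x, y))"
      by (rule frechet_derivative_cong_open) (use L in auto)
    moreover have "((\<lambda>z. Lc (\<tau> (fst z), D\<tau> (fst z) (snd z))) has_derivative
        (\<lambda>d. frechet_derivative Lc (at (\<tau> x, D\<tau> x y)) (D\<tau> x (fst d), D2\<tau> x (fst d) y + D\<tau> x (snd d)))) (at (x, y))"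
      using has_derivative_compose[OF tangent_map_derivative[OF x, of y], of Lc] smooth_on_has_derivative[OF c.L_smooth \<Omega>[OF z x]] by simp
    ultimately have "frechet_derivative Ld (at (x, y)) (e, - K (R e y))
        = frechet_derivative Lc (at (\<tau> x, D\<tau> x y)) (D\<tau> x e, D2\<tau> x e y + D\<tau> x (- K (R e y)))"
      by (simp add: frechet_derivative_eqI)
    also have "D2\<tau> x e y + D\<tau> x (- K (R e y)) = - conn \<Gamma>c (D\<tau> x e) (D\<tau> x y)"
      by (simp add: linear_neg[OF lin] DK R_def)
    finally show "frechet_derivative Ld (at (x, y)) (e, - K (R e y)) = 0" using \<Gamma>c(2)[OF \<Omega>[OF z x]] by simp
  qed
  then show ?thesis by (simp add: DK R_def)
qed

text \<open>Differentiating the pullback identity for the metrics produces two Hessian terms. With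
  the transformed connection of \<open>\<Gamma>c\<close> they combine exactly to images of the
  connection of \<open>\<Gamma>d\<close>.\<close>

lemma parallel_transformation:
  fixes gc gd :: "real^'n \<Rightarrow> real^'n^'n"
  assumes x: "x \<in> T"
    and tr: "\<And>e y. D\<tau> x (conn \<Gamma>d e y) = D2\<tau> x e y + conn \<Gamma>c (D\<tau> x e) (D\<tau> x y)"
    and gc: "\<And>i j. (\<lambda>x. gc x $ i $ j) differentiable (at (\<tau> x))"
    and gd: "\<And>i j. (\<lambda>x. gd x $ i $ j) differentiable (at x)"
    and pull: "\<And>x y z. x \<in> T \<Longrightarrow> y \<bullet> (gd x *v z) = D\<tau> x y \<bullet> (gc (\<tau> x) *v D\<tau> x z)"
    and par: "\<And>k. cov_metric \<Gamma>c gc k (\<tau> x) = 0"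
  shows "cov_metric \<Gamma>d gd k x = 0"
proof -
  have "y \<bullet> (metric_deriv gd x e *v z) = conn \<Gamma>d e y \<bullet> (gd x *v z) + y \<bullet> (gd x *v conn \<Gamma>d e z)" for e y z
  proof -
    let ?G = "gc (\<tau> x)" and ?J = "D\<tau> x"
    have "((\<lambda>x. D\<tau> x y \<bullet> (gc (\<tau> x) *v D\<tau> x z)) has_derivative (\<lambda>e. D2\<tau> x e y \<bullet> (?G *v ?J z)
        + ?J y \<bullet> (metric_deriv gc (\<tau> x) (?J e) *v ?J z) + ?J y \<bullet> (?G *v D2\<tau> x e z))) (at x)"
      by (rule has_derivative_bilinear_form[where g = gc and \<tau> = \<tau>, OF gc D\<tau>[OF x] D2\<tau>[OF x] D2\<tau>[OF x]])
    then have "((\<lambda>x. y \<bullet> (gd x *v z)) has_derivative (\<lambda>e. D2\<tau> x e y \<bullet> (?G *v ?J z)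
        + ?J y \<bullet> (metric_deriv gc (\<tau> x) (?J e) *v ?J z) + ?J y \<bullet> (?G *v D2\<tau> x e z))) (at x)"
      by (rule has_derivative_transform_within_open[OF _ open_T x]) (simp add: pull)
    from has_derivative_unique[OF metric_deriv_inner[OF gd] this]
    have "y \<bullet> (metric_deriv gd x e *v z) = D2\<tau> x e y \<bullet> (?G *v ?J z)
        + ?J y \<bullet> (metric_deriv gc (\<tau> x) (?J e) *v ?J z) + ?J y \<bullet> (?G *v D2\<tau> x e z)" by meson
    also have "?J y \<bullet> (metric_deriv gc (\<tau> x) (?J e) *v ?J z)
        = conn \<Gamma>c (?J e) (?J y) \<bullet> (?G *v ?J z) + ?J y \<bullet> (?G *v conn \<Gamma>c (?J e) (?J z))"
      using par parallel_metric_iff[OF gc] by blast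
    also have "D2\<tau> x e y \<bullet> (?G *v ?J z) + (conn \<Gamma>c (?J e) (?J y) \<bullet> (?G *v ?J z) + ?J y \<bullet> (?G *v conn \<Gamma>c (?J e) (?J z)))
        + ?J y \<bullet> (?G *v D2\<tau> x e z) = ?J (conn \<Gamma>d e y) \<bullet> (?G *v ?J z) + ?J y \<bullet> (?G *v ?J (conn \<Gamma>d e z))"
      by (simp add: tr inner_add_left inner_add_right matrix_vector_right_distrib)
    finally show ?thesis by (simp add: pull[OF x])
  qed
  then show ?thesis using parallel_metric_iff[OF gd] by blast
qed

end

text \<open>Convexity keeps the segment between two points that differ only in coordinate
  \<open>i\<close> inside \<open>S\<close>. On a general open set the slices in that direction may
  be disconnected.\<close>

lemma pd_zero_imp_independent:
  assumes "open S" "convex S" "\<And>x. x \<in> S \<Longrightarrow> f differentiable (at x)" "\<And>x. x \<in> S \<Longrightarrow> pd i f x = 0"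
  shows "independent_of_on i S f"
  unfolding independent_of_on_def
proof (intro ballI impI)
  fix x x' assume x: "x \<in> S" "x' \<in> S" and eq: "\<forall>j. j \<noteq> i \<longrightarrow> x $ j = x' $ j"
  define c where "c = x' $ i - x $ i"
  have x': "x' = x + c *\<^sub>R axis i 1" using eq by (auto simp: vec_eq_iff axis_def c_def)
  let ?p = "\<lambda>t. x + (t * c) *\<^sub>R axis i 1"
  have pS: "?p t \<in> S" if "t \<in> {0..1}" for t
  proof -
    have "?p t = (1 - t) *\<^sub>R x + t *\<^sub>R x'" by (simp add: x' algebra_simps)
    then show ?thesis using convexD[OF assms(2) x, of "1 - t" t] that by simp
  qed
  have "((\<lambda>t. f (?p t)) has_derivative (\<lambda>h. 0)) (at t within {0..1})" if t: "t \<in> {0..1}" for t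
  proof -
    have "(?p has_derivative (\<lambda>h. (h * c) *\<^sub>R axis i 1)) (at t)" by (auto intro!: derivative_eq_intros)
    from has_derivative_compose[OF this differentiable_frechetD[OF assms(3)[OF pS[OF t]]]]
    have "((\<lambda>t. f (?p t)) has_derivative (\<lambda>h. (h * c) *\<^sub>R frechet_derivative f (at (?p t)) (axis i 1))) (at t)"
      by (simp only: linear_scale[OF has_derivative_linear[OF differentiable_frechetD[OF assms(3)[OF pS[OF t]]]]])
    then show ?thesis using assms(4)[OF pS[OF t]] has_derivative_at_withinI by (fastforce simp: pd_def)
  qed
  from has_derivative_zero_constant[OF convex_real_interval(5) this]
  obtain d where "\<And>t. t \<in> {0..1} \<Longrightarrow> f (?p t) = d" by blast
  from this[of 0] this[of 1] show "f x = f x'" by (simp add: x')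
qed

lemma independent_imp_pd_zero:
  assumes "independent_of_on i S f" "open S" "x \<in> S" "f differentiable (at x)"
  shows "pd i f x = 0"
  unfolding pd_def
proof (rule affine_directional_derivative[OF assms(4,2,3)])
  fix t assume "x + t *\<^sub>R axis i 1 \<in> S"
  moreover have "(x + t *\<^sub>R axis i 1) $ j = x $ j" if "j \<noteq> i" for j using that by (simp add: axis_def)
  ultimately show "f (x + t *\<^sub>R axis i 1) = f x + t *\<^sub>R 0"
    using assms(1,3) unfolding independent_of_on_def by fastforce
qed

section \<open>Charts, tangent vectors and tensors\<close>

abbreviation (input) chart_image :: "('m, 'n::finite) chart \<Rightarrow> (real^'n) set" where
  "chart_image c \<equiv> snd c ` fst c"

locale manifold =
  fixes M :: "('m::topological_space, 'n::finite) chart set"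
  assumes M: "smooth_structure M"
begin

lemmas atlas = M[unfolded smooth_structure_def]

lemma is_chart: "c \<in> M \<Longrightarrow> is_chart c"
  by (rule bspec[OF conjunct1[OF atlas]])

lemma compatible: "c \<in> M \<Longrightarrow> d \<in> M \<Longrightarrow> compatible c d"
  by (rule bspec[OF bspec[OF conjunct1[OF conjunct2[OF conjunct2[OF atlas]]]]])

lemma maximal: "is_chart c \<Longrightarrow> (\<And>d. d \<in> M \<Longrightarrow> compatible c d) \<Longrightarrow> c \<in> M"
  by (rule spec[OF conjunct2[OF conjunct2[OF conjunct2[OF atlas]]], THEN mp]) (intro conjI ballI)

lemma chart_around: obtains c where "c \<in> M" "p \<in> fst c"
proof -
  have "p \<in> (\<Union>c\<in>M. fst c)" by (simp only: conjunct1[OF conjunct2[OF atlas]] UNIV_I)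
  then show thesis by (rule UN_E) (rule that)
qed

lemma chart_open: "c \<in> M \<Longrightarrow> open (fst c)"
  and chart_image_open: "c \<in> M \<Longrightarrow> open (chart_image c)"
  by (drule is_chart, simp only: is_chart_def)+

lemma chart_inj: "c \<in> M \<Longrightarrow> inj_on (snd c) (fst c)"
  by (drule is_chart) (auto simp: is_chart_def homeomorphism_def intro: inj_on_inverseI)

lemma chart_inv [simp]: "c \<in> M \<Longrightarrow> p \<in> fst c \<Longrightarrow> chart_inv c (snd c p) = p"
  unfolding chart_inv_def by (rule inv_into_f_f[OF chart_inj])

lemma chart_inv_in: "x \<in> chart_image c \<Longrightarrow> chart_inv c x \<in> fst c"
  and snd_chart_inv: "x \<in> chart_image c \<Longrightarrow> snd c (chart_inv c x) = x"
  unfolding chart_inv_def by (rule inv_into_into f_inv_into_f, assumption)+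

lemma chart_homeomorphism: "c \<in> M \<Longrightarrow> homeomorphism (fst c) (chart_image c) (snd c) (chart_inv c)"
proof -
  assume c: "c \<in> M"
  then obtain g where g: "homeomorphism (fst c) (chart_image c) (snd c) g" using is_chart[OF c] unfolding is_chart_def by blast
  have "g x = chart_inv c x" if "x \<in> chart_image c" for x
    using that g c by (auto simp: homeomorphism_def)
  then show ?thesis using g c by (auto simp: homeomorphism_def cong: continuous_on_cong)
qed

lemma chart_image_Int_open:
  assumes "c \<in> M" "open U"
  shows "open (snd c ` (U \<inter> fst c))"
proof -
  have "openin (top_of_set (chart_image c)) (snd c ` (U \<inter> fst c))"
    by (rule homeomorphism_imp_open_map[OF chart_homeomorphism[OF assms(1)]])
      (use assms(2) in \<open>auto simp: openin_open\<close>)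
  then show ?thesis using chart_image_open[OF assms(1)] by (simp add: openin_open_eq)
qed

lemma transition_apply: "c \<in> M \<Longrightarrow> p \<in> fst c \<Longrightarrow> transition c d (snd c p) = snd d p"
  by (simp add: transition_def)

abbreviation Dtr where "Dtr c d p \<equiv> frechet_derivative (transition c d) (at (snd c p))"

lemma overlap_open: "c \<in> M \<Longrightarrow> d \<in> M \<Longrightarrow> open (snd c ` (fst c \<inter> fst d))"
  using chart_image_Int_open[OF _ chart_open, of c d] by (simp add: Int_commute)

lemma transition_smooth: "c \<in> M \<Longrightarrow> d \<in> M \<Longrightarrow> smooth_on (transition c d) (snd c ` (fst c \<inter> fst d))"
  using compatible by (auto simp: compatible_def)

lemma Dtr: "c \<in> M \<Longrightarrow> d \<in> M \<Longrightarrow> p \<in> fst c \<Longrightarrow> p \<in> fst d \<Longrightarrow> (transition c d has_derivative Dtr c d p) (at (snd c p))"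
  by (rule smooth_on_has_derivative[OF transition_smooth]) auto

lemma Dtr_linear: "c \<in> M \<Longrightarrow> d \<in> M \<Longrightarrow> p \<in> fst c \<Longrightarrow> p \<in> fst d \<Longrightarrow> linear (Dtr c d p)"
  by (rule has_derivative_linear[OF Dtr])

lemma Dtr_compose:
  assumes c: "c \<in> M" "p \<in> fst c" and d: "d \<in> M" "p \<in> fst d" and e: "e \<in> M" "p \<in> fst e"
  shows "Dtr d e p (Dtr c d p y) = Dtr c e p y"
proof -
  have "(transition d e has_derivative Dtr d e p) (at (transition c d (snd c p)))"
    using Dtr[OF d(1) e(1) d(2) e(2)] by (simp add: transition_apply[OF c])
  from has_derivative_compose[OF Dtr[OF c(1) d(1) c(2) d(2)] this]
  have "((\<lambda>x. transition d e (transition c d x)) has_derivative (\<lambda>y. Dtr d e p (Dtr c d p y))) (at (snd c p))" .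
  then have "(transition c e has_derivative (\<lambda>y. Dtr d e p (Dtr c d p y))) (at (snd c p))"
  proof (rule has_derivative_transform_within_open)
    show "open (snd c ` (fst d \<inter> fst c))" by (rule chart_image_Int_open[OF c(1) chart_open[OF d(1)]])
    show "transition d e (transition c d x) = transition c e x" if "x \<in> snd c ` (fst d \<inter> fst c)" for x
      using that c(1) d(1) by (auto simp: transition_apply)
  qed (use c d in auto)
  from frechet_derivative_eqI[OF this] show ?thesis by simp
qed

lemma Dtr_same: "c \<in> M \<Longrightarrow> p \<in> fst c \<Longrightarrow> Dtr c c p y = y"
proof -
  assume c: "c \<in> M" "p \<in> fst c"
  have "(transition c c has_derivative (\<lambda>y. y)) (at (snd c p))"
    by (rule has_derivative_transform_within_open[OF has_derivative_ident chart_image_open[OF c(1)]])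
      (use c in \<open>auto simp: transition_apply\<close>)
  from frechet_derivative_eqI[OF this] show ?thesis by simp
qed

lemma Dtr_inverse:
  "c \<in> M \<Longrightarrow> d \<in> M \<Longrightarrow> p \<in> fst c \<Longrightarrow> p \<in> fst d \<Longrightarrow> Dtr d c p (Dtr c d p y) = y"
  using Dtr_compose[of c p d c y] Dtr_same by simp

lemma Dtr_bij: "c \<in> M \<Longrightarrow> d \<in> M \<Longrightarrow> p \<in> fst c \<Longrightarrow> p \<in> fst d \<Longrightarrow> bij (Dtr c d p)"
  by (rule o_bij[of "Dtr d c p"]; rule ext) (simp_all add: Dtr_inverse)

lemma tvec_apply: "d \<in> M \<Longrightarrow> p \<in> fst d \<Longrightarrow> tvec M c p y d = Dtr c d p y"
  by (simp add: tvec_def)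

lemma tvec_same [simp]: "c \<in> M \<Longrightarrow> p \<in> fst c \<Longrightarrow> tvec M c p y c = y"
  by (simp add: tvec_apply Dtr_same)

lemma tvec_in: "c \<in> M \<Longrightarrow> p \<in> fst c \<Longrightarrow> tvec M c p y \<in> tangent_space M p"
  unfolding tangent_space_def mem_Collect_eq
  by (intro conjI ballI allI impI) (simp_all add: tvec_apply Dtr_compose, auto simp: tvec_def)

lemma tangent_transform:
  "w \<in> tangent_space M p \<Longrightarrow> c \<in> M \<Longrightarrow> d \<in> M \<Longrightarrow> p \<in> fst c \<Longrightarrow> p \<in> fst d \<Longrightarrow> w d = Dtr c d p (w c)"
  unfolding tangent_space_def by blast

lemma tvec_tangent: "w \<in> tangent_space M p \<Longrightarrow> c \<in> M \<Longrightarrow> p \<in> fst c \<Longrightarrow> tvec M c p (w c) = w"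
proof
  fix d assume w: "w \<in> tangent_space M p" "c \<in> M" "p \<in> fst c"
  show "tvec M c p (w c) d = w d"
  proof (cases "d \<in> M \<and> p \<in> fst d")
    case True
    then show ?thesis using tangent_transform[OF w(1,2) _ w(3)] by (simp add: tvec_def)
  next
    \<comment> \<open>Outside the charts of \<open>M\<close> around \<open>p\<close> both sides take
      the conventional value 0, which makes them equal as functions.\<close>
    case False
    then have "w d = 0" using w(1) unfolding tangent_space_def by blast
    then show ?thesis unfolding tvec_def if_not_P[OF False] by simp
  qed
qed

lemma tvec_scale: "c \<in> M \<Longrightarrow> p \<in> fst c \<Longrightarrow> tvec M c p (t *\<^sub>R y) = (\<lambda>d. t *\<^sub>R tvec M c p y d)"
  by (rule ext) (simp add: tvec_def linear_scale[OF Dtr_linear])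

lemma coord_rep_apply: "c \<in> M \<Longrightarrow> p \<in> fst c \<Longrightarrow> w \<in> tangent_space M p \<Longrightarrow> coord_rep M c f (snd c p, w c) = f (p, w)"
  by (simp add: coord_rep_def tvec_tangent)

lemma coord_rep_tvec: "c \<in> M \<Longrightarrow> p \<in> fst c \<Longrightarrow> coord_rep M c f (snd c p, y) = f (p, tvec M c p y)"
  by (simp add: coord_rep_def)

lemma TM_coords_iff:
  assumes "A \<subseteq> tangent_bundle M" "c \<in> M" "p \<in> fst c"
  shows "(snd c p, y) \<in> TM_coords c A \<longleftrightarrow> (p, tvec M c p y) \<in> A"
proof
  assume "(snd c p, y) \<in> TM_coords c A"
  then obtain p' w where w: "snd c p = snd c p'" "y = w c" "(p', w) \<in> A" "p' \<in> fst c" by (auto simp: TM_coords_def)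
  then have "p' = p" using chart_inj[OF assms(2)] assms(3) by (metis inj_onD)
  moreover have "w \<in> tangent_space M p'" using w(3) assms(1) by (auto simp: tangent_bundle_def)
  ultimately show "(p, tvec M c p y) \<in> A" using w assms by (simp add: tvec_tangent)
next
  assume "(p, tvec M c p y) \<in> A"
  then show "(snd c p, y) \<in> TM_coords c A"
    unfolding TM_coords_def using assms(2,3) by (auto intro!: exI[of _ p] exI[of _ "tvec M c p y"])
qed

lemma TM_coords_fst: "z \<in> TM_coords c A \<Longrightarrow> fst z \<in> chart_image c"
  by (auto simp: TM_coords_def)

text \<open>Maximality of the atlas turns a diffeomorphism \<open>X\<close> of part of a coordinate
  domain into a chart of \<open>M\<close>, since its transitions to other charts are compositions of
  smooth maps.\<close>

lemma new_chart:
  assumes c: "c \<in> M" and W: "open W" "W \<subseteq> chart_image c" and X: "smooth_on X W" "open (X ` W)"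
    and hom: "homeomorphism W (X ` W) X Y" and Y: "smooth_on Y (X ` W)"
  defines "d \<equiv> (fst c \<inter> snd c -` W, X \<circ> snd c)"
  shows "d \<in> M" "chart_image d = X ` W" "\<And>z. z \<in> X ` W \<Longrightarrow> chart_inv d z = chart_inv c (Y z)"
    "\<And>p. p \<in> fst d \<Longrightarrow> Y (snd d p) = snd c p" "\<And>z. z \<in> X ` W \<Longrightarrow> transition d c z = Y z"
proof -
  note hc = chart_homeomorphism[OF c]
  have im: "snd c ` (fst c \<inter> snd c -` W) = W" using W(2) by auto
  have d1: "fst d = fst c \<inter> snd c -` W" and d2: "snd d = X \<circ> snd c" by (simp_all add: d_def)
  have d1D: "p \<in> fst c" "snd c p \<in> W" if "p \<in> fst d" for p using that by (simp_all add: d1)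
  show image: "chart_image d = X ` W"
  proof -
    have "chart_image d = X ` snd c ` (fst c \<inter> snd c -` W)" by (simp only: d1 d2 image_comp)
    then show ?thesis by (simp only: im)
  qed
  have YX: "Y (X x) = x" if "x \<in> W" for x using hom that by (simp add: homeomorphism_def)
  have XY: "X (Y z) = z" "Y z \<in> W" if "z \<in> X ` W" for z using hom that by (auto simp: homeomorphism_def)
  show Yd: "Y (snd d p) = snd c p" if "p \<in> fst d" for p using d1D[OF that] YX by (simp add: d2)
  have "homeomorphism (fst c \<inter> snd c -` W) W (snd c) (chart_inv c)"
    by (rule homeomorphism_of_subsets[OF hc]) (use W im in auto)
  from homeomorphism_compose[OF this hom]
  have hd: "homeomorphism (fst d) (chart_image d) (snd d) (chart_inv c \<circ> Y)" unfolding image by (simp add: d_def)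
  have inj: "inj_on (snd d) (fst d)" 
    by (rule inj_on_inverseI[of _ "chart_inv c \<circ> Y"]) (use hd in \<open>simp only: homeomorphism_def\<close>)
  have inv: "chart_inv d (snd d p) = p" if "p \<in> fst d" for p
    unfolding chart_inv_def using inv_into_f_f[OF inj that] .
  show inv_eq: "chart_inv d z = chart_inv c (Y z)" if "z \<in> X ` W" for z
  proof -
    have "z \<in> chart_image d" using that by (simp only: image)
    then obtain p where p: "z = snd d p" "p \<in> fst d" by (rule imageE)
    then show ?thesis using d1D[OF p(2)] inv Yd c by simp
  qed
  have opn: "open (fst d)"
  proof -
    have "continuous_on (fst c) (snd c)" using hc by (simp add: homeomorphism_def)
    then show ?thesis using continuous_open_preimage[OF _ chart_open[OF c] W(1)] by (simp add: d1)
  qed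
  show tr: "transition d c z = Y z" if "z \<in> X ` W" for z
    using subsetD[OF W(2) XY(2)[OF that]] by (simp add: transition_def inv_eq[OF that] snd_chart_inv)
  show "d \<in> M"
  proof (rule maximal)
    show "is_chart d" unfolding is_chart_def using opn X(2) hd unfolding image by blast
    fix e assume e: "e \<in> M"
    have sub: "fst d \<inter> fst e \<subseteq> fst c \<inter> fst e" using d1D by blast
    have o1: "open (snd d ` (fst d \<inter> fst e))"
    proof -
      have "openin (top_of_set (chart_image d)) (snd d ` (fst d \<inter> fst e))"
        by (rule homeomorphism_imp_open_map[OF hd]) (use chart_open[OF e] in \<open>auto simp: openin_open\<close>)
      then show ?thesis using X(2) image by (simp add: openin_open_eq)
    qed
    have s1: "smooth_on (\<lambda>z. transition c e (Y z)) (snd d ` (fst d \<inter> fst e))"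
      by (rule smooth_on_compose[OF o1 smooth_on_subset[OF Y] transition_smooth[OF c e]])
        (use image Yd sub in \<open>(blast, force)\<close>)
    have e1: "transition c e (Y z) = transition d e z" if z: "z \<in> snd d ` (fst d \<inter> fst e)" for z
    proof -
      obtain p where p: "p \<in> fst d" "z = snd d p" using z by blast
      then show ?thesis using Yd[OF p(1)] inv[OF p(1)] d1D[OF p(1)] c by (simp add: transition_def)
    qed
    have 1: "smooth_on (transition d e) (snd d ` (fst d \<inter> fst e))"
      by (rule smooth_on_cong[OF o1 e1 s1])
    have o2: "open (snd e ` (fst d \<inter> fst e))" by (rule chart_image_Int_open[OF e opn])
    have s2: "smooth_on (\<lambda>x. X (transition e c x)) (snd e ` (fst d \<inter> fst e))"
    proof (rule smooth_on_compose[OF o2 smooth_on_subset[OF transition_smooth[OF e c]] X(1)])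
      show "snd e ` (fst d \<inter> fst e) \<subseteq> snd e ` (fst e \<inter> fst c)" using sub by blast
      show "transition e c ` snd e ` (fst d \<inter> fst e) \<subseteq> W"
      proof (rule image_subsetI)
        fix x assume "x \<in> snd e ` (fst d \<inter> fst e)"
        then obtain p where p: "p \<in> fst d" "p \<in> fst e" "x = snd e p" by blast
        show "transition e c x \<in> W" using d1D(2)[OF p(1)] unfolding p(3) transition_apply[OF e p(2)] .
      qed
    qed
    have e2: "X (transition e c x) = transition e d x" if x: "x \<in> snd e ` (fst d \<inter> fst e)" for x
    proof -
      obtain p where "p \<in> fst e" "x = snd e p" using x by blast
      then show ?thesis by (simp add: transition_apply[OF e] d2)
    qed
    have 2: "smooth_on (transition e d) (snd e ` (fst d \<inter> fst e))"
      by (rule smooth_on_cong[OF o2 e2 s2])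
    show "compatible d e" unfolding compatible_def using 1 2 by (simp add: Int_commute)
  qed
qed

section \<open>Forms and metrics in overlapping charts\<close>

lemma metric_apply:
  assumes "pseudo_riemannian_on M U a" "c \<in> M" "p \<in> U" "p \<in> fst c" "v \<in> tangent_space M p" "w \<in> tangent_space M p"
  shows "a p v w = v c \<bullet> (metric_comp M a c (snd c p) *v w c)"
  using assms unfolding pseudo_riemannian_on_def by blast

lemma metric_transpose:
  "pseudo_riemannian_on M U a \<Longrightarrow> c \<in> M \<Longrightarrow> p \<in> U \<Longrightarrow> p \<in> fst c \<Longrightarrow>
    transpose (metric_comp M a c (snd c p)) = metric_comp M a c (snd c p)"
  and metric_invertible:
  "pseudo_riemannian_on M U a \<Longrightarrow> c \<in> M \<Longrightarrow> p \<in> U \<Longrightarrow> p \<in> fst c \<Longrightarrow> invertible (metric_comp M a c (snd c p))"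
  and metric_smooth:
  "pseudo_riemannian_on M U a \<Longrightarrow> c \<in> M \<Longrightarrow> smooth_on (metric_comp M a c) (snd c ` (U \<inter> fst c))"
  and metric_open: "pseudo_riemannian_on M U a \<Longrightarrow> open U"
  unfolding pseudo_riemannian_on_def by blast+

lemma metric_smooth_nth:
  assumes "pseudo_riemannian_on M U a" "c \<in> M"
  shows "smooth_on (\<lambda>x. metric_comp M a c x $ i $ j) (snd c ` (U \<inter> fst c))"
proof -
  note o = chart_image_Int_open[OF assms(2) metric_open[OF assms(1)]]
  show ?thesis by (rule smooth_on_vec_nth[OF o smooth_on_vec_nth[OF o metric_smooth[OF assms]]])
qed

lemma metric_pullback:
  assumes a: "pseudo_riemannian_on M U a" and c: "c \<in> M" "p \<in> fst c" and d: "d \<in> M" "p \<in> fst d" and p: "p \<in> U"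
  shows "y \<bullet> (metric_comp M a c (snd c p) *v z) = Dtr c d p y \<bullet> (metric_comp M a d (snd d p) *v Dtr c d p z)"
  using metric_apply[OF a c(1) p c(2) tvec_in[OF c, of y] tvec_in[OF c, of z]]
    metric_apply[OF a d(1) p d(2) tvec_in[OF c, of y] tvec_in[OF c, of z]] c d
  by (simp add: tvec_apply Dtr_same)

lemma form_pullback:
  assumes b: "one_form M b" and c: "c \<in> M" "p \<in> fst c" and d: "d \<in> M" "p \<in> fst d"
  shows "form_comp M b c (snd c p) \<bullet> y = form_comp M b d (snd d p) \<bullet> Dtr c d p y"
proof -
  have "b p (tvec M c p y) = form_comp M b e (snd e p) \<bullet> tvec M c p y e" if "e \<in> M" "p \<in> fst e" for e
    using b that tvec_in[OF c, of y] unfolding one_form_def by blast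
  from this[OF c] this[OF d] show ?thesis using c d by (simp add: tvec_apply Dtr_same)
qed

lemma det_metric_transform:
  assumes a: "pseudo_riemannian_on M U a" and c: "c \<in> M" "p \<in> fst c" and d: "d \<in> M" "p \<in> fst d" and p: "p \<in> U"
  shows "det (metric_comp M a c (snd c p)) = (det (matrix (Dtr c d p)))\<^sup>2 * det (metric_comp M a d (snd d p))"
proof -
  let ?J = "matrix (Dtr c d p)" and ?a = "metric_comp M a d (snd d p)"
  have J: "Dtr c d p y = ?J *v y" for y
    using frechet_matrix[of "transition c d" "snd c p" y] Dtr[OF c(1) d(1) c(2) d(2)] by (auto simp: differentiable_def)
  have "metric_comp M a c (snd c p) - transpose ?J ** ?a ** ?J = 0"
  proof (rule matrix_eq_0_inner)
    fix y z
    have "(?J *v y) \<bullet> (?a *v (?J *v z)) = y \<bullet> (transpose ?J *v (?a *v (?J *v z)))"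
      by (rule inner_matrix_transpose)
    then show "y \<bullet> ((metric_comp M a c (snd c p) - transpose ?J ** ?a ** ?J) *v z) = 0"
      using metric_pullback[OF a c d p, of y z]
      by (simp add: J matrix_vector_mult_diff_rdistrib inner_diff_right matrix_vector_mul_assoc[symmetric])
  qed
  then have "metric_comp M a c (snd c p) = transpose ?J ** ?a ** ?J" by simp
  then show ?thesis by (simp add: det_mul power2_eq_square)
qed

text \<open>Both determinants pick up the same squared Jacobian, which cancels. The potential built
  from them is thus a function on the manifold, and its values in the adapted chart are those of the
  original chart.\<close>

lemma ln_det_ratio_invariant:
  assumes a: "pseudo_riemannian_on M U a" and g: "pseudo_riemannian_on M U g"
    and c: "c \<in> M" "p \<in> fst c" and d: "d \<in> M" "p \<in> fst d" and p: "p \<in> U"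
  shows "ln \<bar>det (metric_comp M a c (snd c p))\<bar> - ln \<bar>det (metric_comp M g c (snd c p))\<bar>
       = ln \<bar>det (metric_comp M a d (snd d p))\<bar> - ln \<bar>det (metric_comp M g d (snd d p))\<bar>"
proof -
  let ?j = "(det (matrix (Dtr c d p)))\<^sup>2"
  have nz: "det (metric_comp M h e (snd e p)) \<noteq> 0" if "pseudo_riemannian_on M U h" "e \<in> M" "p \<in> fst e" for h e
    using metric_invertible[OF that(1,2) p that(3)] by (simp add: invertible_det_nz)
  have j: "?j > 0" using nz[OF a c] det_metric_transform[OF a c d p] by (metis less_eq_real_def mult_zero_left zero_le_power2)
  have "ln \<bar>det (metric_comp M h c (snd c p))\<bar> = ln ?j + ln \<bar>det (metric_comp M h d (snd d p))\<bar>"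
    if h: "pseudo_riemannian_on M U h" for h
    using nz[OF h d] j unfolding det_metric_transform[OF h c d p] abs_mult by (simp add: ln_mult)
  from this[OF a] this[OF g] show ?thesis by simp
qed

end

section \<open>Kropina metrics on a manifold and in its charts\<close>

locale kropina_space = manifold M
  for M :: "('m::topological_space, 'n::finite) chart set" +
  fixes A :: "('m \<times> ('m, 'n) tangent) set" and F :: "'m \<times> ('m, 'n) tangent \<Rightarrow> real"
    and a :: "'m \<Rightarrow> ('m, 'n) tangent \<Rightarrow> ('m, 'n) tangent \<Rightarrow> real" and b :: "'m \<Rightarrow> ('m, 'n) tangent \<Rightarrow> real" and m :: real
  assumes a: "pseudo_riemannian_on M UNIV a" and b: "one_form M b"
    and kropina: "m_kropina M A a b m F" and proper: "properly_finslerian M A F"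
begin

abbreviation "L \<equiv> \<lambda>z. (F z)\<^sup>2"

lemma finsler: "finsler_metric M A F" using kropina by (simp add: m_kropina_def)

lemma conic: "conic_subbundle M A" using finsler by (simp add: finsler_metric_def)

lemma A_tangent: "A \<subseteq> tangent_bundle M" using conic by (simp add: conic_subbundle_def)

lemma A_tangent_space: "(p, w) \<in> A \<Longrightarrow> w \<in> tangent_space M p"
  using A_tangent by (auto simp: tangent_bundle_def)

lemma kropinaD: "(p, w) \<in> A \<Longrightarrow> a p w w \<noteq> 0" "(p, w) \<in> A \<Longrightarrow> b p w > 0"
  "(p, w) \<in> A \<Longrightarrow> F (p, w) = sqrt \<bar>a p w w\<bar> powr (1 + m) * b p w powr (- m)"
  using kropina unfolding m_kropina_def by fastforce+

lemma L_kropina: "(p, w) \<in> A \<Longrightarrow> L (p, w) = \<bar>a p w w\<bar> powr (1 + m) * b p w powr (- 2 * m)"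
proof -
  assume z: "(p, w) \<in> A"
  have "(sqrt \<bar>a p w w\<bar> powr (1 + m))\<^sup>2 = \<bar>a p w w\<bar> powr (1 + m)"
    using powr_mult[of "sqrt \<bar>a p w w\<bar>" "sqrt \<bar>a p w w\<bar>" "1 + m"] by (simp add: power2_eq_square)
  moreover have "(b p w powr (- m))\<^sup>2 = b p w powr (- 2 * m)"
    by (simp add: power2_eq_square powr_add[symmetric])
  ultimately show ?thesis by (simp add: kropinaD(3)[OF z] power_mult_distrib)
qed

text \<open>For m = 0 the square of \<open>F\<close> is |a(y, y)|, quadratic on each of the two sets
  where a(y, y) has a fixed sign. They cover \<open>A\<close>, where a(y, y) never vanishes, against
  proper Finslerianness.\<close>

lemma m_ne_0: "m \<noteq> 0"
proof
  assume m: "m = 0"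
  have L: "L (p, w) = \<bar>a p w w\<bar>" if "(p, w) \<in> A" for p w
    using L_kropina[OF that] kropinaD(2)[OF that] m by simp
  have aq: "a p w w = w c \<bullet> (metric_comp M a c (snd c p) *v w c)" if "(p, w) \<in> A" "c \<in> M" "p \<in> fst c" for p w c
    using metric_apply[OF a that(2) _ that(3) A_tangent_space[OF that(1)] A_tangent_space[OF that(1)]] by simp
  let ?P = "{(p, w) \<in> A. a p w w > 0}" and ?N = "{(p, w) \<in> A. a p w w < 0}"
  have "quadratic_on M ?P L"
    unfolding quadratic_on_def
  proof (intro ballI)
    fix c p assume c: "c \<in> M" "p \<in> fst c"
    show "\<exists>Q. \<forall>w. (p, w) \<in> ?P \<longrightarrow> L (p, w) = w c \<bullet> (Q *v w c)"
    proof (intro exI[of _ "metric_comp M a c (snd c p)"] allI impI)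
      fix w assume "(p, w) \<in> ?P"
      then have w: "(p, w) \<in> A" "a p w w > 0" by auto
      show "L (p, w) = w c \<bullet> (metric_comp M a c (snd c p) *v w c)"
        using w(2) L[OF w(1)] aq[OF w(1) c] by simp
    qed
  qed
  moreover have "quadratic_on M ?N L"
    unfolding quadratic_on_def
  proof (intro ballI)
    fix c p assume c: "c \<in> M" "p \<in> fst c"
    show "\<exists>Q. \<forall>w. (p, w) \<in> ?N \<longrightarrow> L (p, w) = w c \<bullet> (Q *v w c)"
    proof (intro exI[of _ "- metric_comp M a c (snd c p)"] allI impI)
      fix w assume "(p, w) \<in> ?N"
      then have w: "(p, w) \<in> A" "a p w w < 0" by auto
      have "(- metric_comp M a c (snd c p)) *v w c = - (metric_comp M a c (snd c p) *v w c)"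
        by (simp add: vec_eq_iff matrix_vector_mult_def sum_negf)
      then show "L (p, w) = w c \<bullet> ((- metric_comp M a c (snd c p)) *v w c)"
        using w L[OF w(1)] aq[OF w(1) c] by simp
    qed
  qed
  moreover have "\<Union>{?P, ?N} = A" using kropinaD(1) by (auto simp: neq_iff)
  ultimately show False using proper unfolding properly_finslerian_def by (metis (no_types, lifting) finite.intros insertE singletonD)
qed

text \<open>For m = -1 the square of \<open>F\<close> is that of b(y), whose matrix is the outer
  product of the components of b, so \<open>A\<close> itself is a one-element cover.\<close>

lemma m_ne_minus_1: "1 + m \<noteq> 0"
proof
  assume "1 + m = 0"
  then have m: "m = -1" by simp
  have L: "L (p, w) = (b p w)\<^sup>2" if "(p, w) \<in> A" for p w
    using L_kropina[OF that] kropinaD[OF that] m by (simp add: powr_numeral)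
  have "quadratic_on M A L"
    unfolding quadratic_on_def
  proof (intro ballI)
    fix c p assume c: "c \<in> M" "p \<in> fst c"
    let ?b = "form_comp M b c (snd c p)"
    show "\<exists>Q. \<forall>w. (p, w) \<in> A \<longrightarrow> L (p, w) = w c \<bullet> (Q *v w c)"
    proof (intro exI[of _ "\<chi> i j. ?b $ i * ?b $ j"] allI impI)
      fix w assume w: "(p, w) \<in> A"
      have "(\<chi> i j. ?b $ i * ?b $ j) *v w c = (?b \<bullet> w c) *\<^sub>R ?b"
        by (simp add: vec_eq_iff matrix_vector_mult_def inner_vec_def sum_distrib_left sum_distrib_right mult_ac)
      moreover have "b p w = ?b \<bullet> w c" using b c A_tangent_space[OF w] unfolding one_form_def by blast
      ultimately show "L (p, w) = w c \<bullet> ((\<chi> i j. ?b $ i * ?b $ j) *v w c)"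
        using L[OF w] by (simp add: power2_eq_square inner_commute)
    qed
  qed
  then have "finite {A} \<and> \<Union>{A} = A \<and> (\<forall>S\<in>{A}. quadratic_on M S L)" by simp
  then show False using proper unfolding properly_finslerian_def by blast
qed

lemma chart_kropina:
  assumes c: "c \<in> M"
  shows "kropina_lagrangian (coord_rep M c L) (TM_coords c A) (chart_image c) (metric_comp M a c) (form_comp M b c) m"
proof
  let ?L = "coord_rep M c L" and ?\<Omega> = "TM_coords c A"
  show opn: "open ?\<Omega>" using conic c by (simp add: conic_subbundle_def)
  have "smooth_on (coord_rep M c F) ?\<Omega>" using finsler c by (simp add: finsler_metric_def)
  from smooth_on_mult[OF opn this this] show sm: "smooth_on ?L ?\<Omega>"
    by (simp add: coord_rep_def case_prod_unfold power2_eq_square)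
  have coords: "\<exists>p w. p \<in> fst c \<and> (p, w) \<in> A \<and> z = (snd c p, w c) \<and> w \<in> tangent_space M p" if "z \<in> ?\<Omega>" for z
    using that A_tangent_space unfolding TM_coords_def by blast
  show "frechet_derivative ?L (at z) (0, snd z) = 2 * ?L z" if z: "z \<in> ?\<Omega>" for z
  proof -
    obtain p w where p: "p \<in> fst c" "(p, w) \<in> A" "z = (snd c p, w c)" "w \<in> tangent_space M p" using coords[OF z] by blast
    \<comment> \<open>Euler's relation is the derivative of this scaling law at t = 1; positive t
      suffices because they form a neighbourhood of 1.\<close>
    have hom: "?L (snd c p, t *\<^sub>R w c) = t\<^sup>2 * ?L z" if t: "t > 0" for t
    proof -
      have "tvec M c p (t *\<^sub>R w c) = (\<lambda>d. t *\<^sub>R w d)" using tvec_scale[OF c p(1)] tvec_tangent[OF p(4) c p(1)] by simp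
      moreover have "F (p, \<lambda>d. t *\<^sub>R w d) = t * F (p, w)" using finsler p(2) t unfolding finsler_metric_def by blast
      ultimately show ?thesis by (simp add: p(3) coord_rep_tvec[OF c p(1)] tvec_tangent[OF p(4) c p(1)] power_mult_distrib)
    qed
    have "((\<lambda>t::real. (snd c p, t *\<^sub>R w c)) has_derivative (\<lambda>s. (0, s *\<^sub>R w c))) (at 1)"
      by (auto intro!: derivative_eq_intros)
    moreover have "(?L has_derivative frechet_derivative ?L (at z)) (at (snd c p, 1 *\<^sub>R w c))"
      using smooth_on_has_derivative[OF sm z] p(3) by simp
    ultimately have "((\<lambda>t. ?L (snd c p, t *\<^sub>R w c)) has_derivative (\<lambda>s. frechet_derivative ?L (at z) (0, s *\<^sub>R w c))) (at 1)"
      by (rule has_derivative_compose)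
    then have "((\<lambda>t. t\<^sup>2 * ?L z) has_derivative (\<lambda>s. frechet_derivative ?L (at z) (0, s *\<^sub>R w c))) (at 1)"
      by (rule has_derivative_transform_within_open[of _ _ _ _ "{0<..}"]) (use hom in auto)
    moreover have "((\<lambda>t. t\<^sup>2 * ?L z) has_derivative (\<lambda>s. 2 * s * ?L z)) (at 1)"
      by (auto intro!: derivative_eq_intros)
    ultimately have "(\<lambda>s. frechet_derivative ?L (at z) (0, s *\<^sub>R w c)) = (\<lambda>s. 2 * s * ?L z)" by (rule has_derivative_unique)
    from fun_cong[OF this, of 1] show ?thesis by (simp add: p(3))
  qed
  show "invertible (fundamental_tensor ?L z)" if "z \<in> ?\<Omega>" for z
    using finsler c that by (simp add: finsler_metric_def)
  show "open (chart_image c)" by (rule chart_image_open[OF c])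
  show "fst z \<in> chart_image c" if "z \<in> ?\<Omega>" for z by (rule TM_coords_fst[OF that])
  show "\<exists>y. (x, y) \<in> ?\<Omega>" if x: "x \<in> chart_image c" for x
  proof -
    obtain p where p: "p \<in> fst c" "x = snd c p" using x by blast
    have "p \<in> fst ` A" using conic by (simp add: conic_subbundle_def)
    then obtain w where "(p, w) \<in> A" by auto
    then show ?thesis using p unfolding TM_coords_def by blast
  qed
  show "smooth_on (\<lambda>x. metric_comp M a c x $ i $ j) (chart_image c)" for i j
    using metric_smooth_nth[OF a c] by simp
  show "smooth_on (form_comp M b c) (chart_image c)" using b c by (simp add: one_form_def)
  show "transpose (metric_comp M a c x) = metric_comp M a c x" "invertible (metric_comp M a c x)" if "x \<in> chart_image c" for x
    using that metric_transpose[OF a c] metric_invertible[OF a c] by auto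
  have vals: "y \<bullet> (metric_comp M a c x *v y) = a p w w" "form_comp M b c x \<bullet> y = b p w" "?L (x, y) = L (p, w)"
    if "p \<in> fst c" "(p, w) \<in> A" "(x, y) = (snd c p, w c)" "w \<in> tangent_space M p" for x y p w
  proof -
    show "y \<bullet> (metric_comp M a c x *v y) = a p w w" using metric_apply[OF a c _ that(1) that(4,4)] that(3) by simp
    show "form_comp M b c x \<bullet> y = b p w" using b c that unfolding one_form_def by fastforce
    show "?L (x, y) = L (p, w)" using coord_rep_apply[OF c that(1,4)] that(3) by simp
  qed
  show "y \<bullet> (metric_comp M a c x *v y) \<noteq> 0" "form_comp M b c x \<bullet> y > 0"
    "?L (x, y) = \<bar>y \<bullet> (metric_comp M a c x *v y)\<bar> powr (1 + m) * (form_comp M b c x \<bullet> y) powr (- 2 * m)"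
    if z: "(x, y) \<in> ?\<Omega>" for x y
  proof -
    obtain p w where p: "p \<in> fst c" "(p, w) \<in> A" "(x, y) = (snd c p, w c)" "w \<in> tangent_space M p" using coords[OF z] by blast
    show "y \<bullet> (metric_comp M a c x *v y) \<noteq> 0" "form_comp M b c x \<bullet> y > 0"
      "?L (x, y) = \<bar>y \<bullet> (metric_comp M a c x *v y)\<bar> powr (1 + m) * (form_comp M b c x \<bullet> y) powr (- 2 * m)"
      unfolding vals[OF p] using kropinaD[OF p(2)] L_kropina[OF p(2)] by auto
  qed
qed

end

section \<open>The adapted form of the metric\<close>

lemma sum_split_two:
  fixes f :: "'n::finite \<Rightarrow> real"
  assumes "iu \<noteq> iv"
  shows "(\<Sum>i\<in>UNIV. f i) = f iu + f iv + (\<Sum>i\<in>-{iu, iv}. f i)"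
proof -
  have "UNIV = insert iu (insert iv (-{iu, iv}))" by auto
  then have "(\<Sum>i\<in>UNIV. f i) = (\<Sum>i\<in>insert iu (insert iv (-{iu, iv})). f i)" by simp
  also have "\<dots> = f iu + (f iv + (\<Sum>i\<in>-{iu, iv}. f i))" using assms by simp
  finally show ?thesis by simp
qed

text \<open>The prescribed row of \<open>iv\<close> is the whole content of the adapted form: it
  fixes the coefficients of du dv, dv dv and dv with the other coordinates, and every other entry is
  read off as \<open>H\<close>, \<open>W\<close> or \<open>h\<close>.\<close>

lemma wave_metric_matrix:
  fixes A :: "real^'n::finite^'n" and iu iv :: 'n
  assumes i: "iu \<noteq> iv" and sym: "\<And>i j. A $ i $ j = A $ j $ i" and row: "\<And>j. A $ iv $ j = - axis iu 1 $ j"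
  shows "wave_metric iu iv (\<lambda>x. A $ iu $ iu) (\<lambda>x j. A $ iu $ j) (\<lambda>x i j. A $ i $ j) x y z = y \<bullet> (A *v z)"
proof -
  let ?R = "- {iu, iv}"
  have Avu: "A $ iv $ iu = -1" by (simp add: row)
  have Auv: "A $ iu $ iv = -1" using Avu sym[of iu iv] by simp
  have Avv: "A $ iv $ iv = 0" using i by (simp add: row axis_def)
  have Av: "A $ iv $ j = 0" if "j \<in> ?R" for j using that by (simp add: row axis_def)
  have Av': "A $ j $ iv = 0" if "j \<in> ?R" for j using Av[OF that] sym[of j iv] by simp
  \<comment> \<open>The symmetrized product yields half of each of these two double sums; they are
    equal because \<open>A\<close> is symmetric.\<close>
  have swap: "(\<Sum>a\<in>?R. \<Sum>b\<in>?R. A $ a $ b * (y $ b * z $ a)) = (\<Sum>a\<in>?R. \<Sum>b\<in>?R. A $ a $ b * (y $ a * z $ b))"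
    by (subst sum.swap) (intro sum.cong refl, subst sym, rule refl)
  have "(\<Sum>a\<in>?R. \<Sum>b\<in>?R. A $ a $ b * dx2 a b y z)
      = 1/2 * ((\<Sum>a\<in>?R. \<Sum>b\<in>?R. A $ a $ b * (y $ a * z $ b)) + (\<Sum>a\<in>?R. \<Sum>b\<in>?R. A $ a $ b * (y $ b * z $ a)))"
    by (simp add: dx2_def sum.distrib[symmetric] sum_distrib_left algebra_simps add_divide_distrib sum_divide_distrib)
  then have "(\<Sum>a\<in>?R. \<Sum>b\<in>?R. A $ a $ b * dx2 a b y z) = (\<Sum>a\<in>?R. \<Sum>b\<in>?R. A $ a $ b * (y $ a * z $ b))"
    unfolding swap by simp
  then have h: "(\<Sum>a\<in>?R. \<Sum>b\<in>?R. A $ a $ b * dx2 a b y z) = (\<Sum>a\<in>?R. \<Sum>b\<in>?R. y $ a * A $ a $ b * z $ b)"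
    by (simp only: mult_ac)
  have "2 * (A $ iu $ a * dx2 iu a y z) = y $ iu * A $ iu $ a * z $ a + y $ a * A $ a $ iu * z $ iu" for a
    unfolding dx2_def using sym[of a iu] by (simp add: field_simps)
  then have W: "2 * (\<Sum>a\<in>?R. A $ iu $ a * dx2 iu a y z) = (\<Sum>a\<in>?R. y $ iu * A $ iu $ a * z $ a) + (\<Sum>a\<in>?R. y $ a * A $ a $ iu * z $ iu)"
    by (simp only: sum_distrib_left sum.distrib)
  have duu: "dx2 iu iu y z = y $ iu * z $ iu" and duv: "2 * dx2 iu iv y z = y $ iu * z $ iv + y $ iv * z $ iu"
    by (simp_all add: dx2_def)
  have "y \<bullet> (A *v z) = (\<Sum>j\<in>UNIV. y $ iu * A $ iu $ j * z $ j) + (\<Sum>j\<in>UNIV. y $ iv * A $ iv $ j * z $ j)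
      + (\<Sum>a\<in>?R. \<Sum>j\<in>UNIV. y $ a * A $ a $ j * z $ j)"
    unfolding matrix_inner_expand by (rule sum_split_two[OF i])
  also have "(\<Sum>j\<in>UNIV. y $ iu * A $ iu $ j * z $ j) = y $ iu * A $ iu $ iu * z $ iu - y $ iu * z $ iv + (\<Sum>a\<in>?R. y $ iu * A $ iu $ a * z $ a)"
    by (simp add: sum_split_two[OF i] Auv)
  also have "(\<Sum>j\<in>UNIV. y $ iv * A $ iv $ j * z $ j) = - (y $ iv * z $ iu)"
    by (simp add: sum_split_two[OF i] Avu Avv Av)
  also have "(\<Sum>a\<in>?R. \<Sum>j\<in>UNIV. y $ a * A $ a $ j * z $ j)
      = (\<Sum>a\<in>?R. y $ a * A $ a $ iu * z $ iu) + (\<Sum>a\<in>?R. \<Sum>b\<in>?R. y $ a * A $ a $ b * z $ b)"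
    by (simp add: sum_split_two[OF i] Av' sum.distrib)
  finally show ?thesis
    unfolding wave_metric_def h W duu using duv by (simp add: algebra_simps)
qed

lemma wave_metric_row:
  fixes iu iv :: "'n::finite"
  assumes "iu \<noteq> iv"
  shows "wave_metric iu iv H W h x (axis iv 1) (axis j 1) = - axis iu 1 $ j"
proof -
  have "dx2 a b (axis iv 1) z = 0" if "a \<in> -{iu, iv} \<or> a = iu" "b \<in> -{iu, iv} \<or> b = iu" for a b z
    using that assms by (auto simp: dx2_def axis_def)
  then have "wave_metric iu iv H W h x (axis iv 1) (axis j 1) = - 2 * dx2 iu iv (axis iv 1) (axis j 1)"
    by (simp add: wave_metric_def)
  then show ?thesis using assms by (auto simp: dx2_def axis_def)
qed

lemma invertible_scaleR:
  fixes A :: "real^'n::finite^'n"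
  assumes "invertible A" "c \<noteq> 0"
  shows "invertible (c *\<^sub>R A)"
proof -
  have sc: "(r *\<^sub>R X) ** Y = r *\<^sub>R (X ** Y)" for r and X Y :: "real^'n^'n"
    by (simp add: matrix_matrix_mult_def vec_eq_iff sum_distrib_left mult_ac)
  show ?thesis
    unfolding invertible_def
    using matrix_inv_right[OF assms(1)] matrix_inv_left[OF assms(1)] assms(2)
    by (intro exI[of _ "(1 / c) *\<^sub>R matrix_inv A"]) (simp add: sc matrix_mult_scaleR)
qed

lemma cov_form_cong_open:
  assumes "open S" "x \<in> S" "\<And>y. y \<in> S \<Longrightarrow> b y = b' y"
  shows "cov_form \<Gamma> b k x = cov_form \<Gamma> b' k x"
  using frechet_derivative_cong_open[OF assms(1,2), of b b'] assms(2,3) by (simp add: cov_form_def)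

text \<open>For a torsion-free connection the right-hand side is symmetric in \<open>v\<close> and
  \<open>w\<close>, so a parallel 1-form is closed.\<close>

lemma parallel_form_derivative:
  assumes "b differentiable (at x)" "\<And>k. cov_form \<Gamma> b k x = 0"
  shows "frechet_derivative b (at x) v \<bullet> w = b x \<bullet> conn \<Gamma> v w"
proof -
  have "frechet_derivative b (at x) v = (\<Sum>k\<in>UNIV. v $ k *\<^sub>R (transpose (christoffel_matrix \<Gamma> k) *v b x))"
    using linear_axis_expand[OF has_derivative_linear[OF differentiable_frechetD[OF assms(1)]], of v] assms(2)
    by (simp add: cov_form_def)
  then show ?thesis
    by (simp add: conn_def inner_sum_left inner_sum_right dot_lmul_matrix)
qed

lemma matrix_scaleR_vector: "(c *\<^sub>R A) *v x = c *\<^sub>R (A *v x)" for A :: "real^'n^'k"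
  by (simp add: matrix_vector_mult_def vec_eq_iff sum_distrib_left mult_ac)

lemma (in manifold) pseudo_riemannian_on_subset:
  assumes "pseudo_riemannian_on M U a" "open V" "V \<subseteq> U"
  shows "pseudo_riemannian_on M V a"
proof -
  have sub: "snd c ` (V \<inter> fst c) \<subseteq> snd c ` (U \<inter> fst c)" for c :: "('m, 'n) chart" using assms(3) by blast
  show ?thesis
    using assms(1,3) smooth_on_subset[OF _ sub] unfolding pseudo_riemannian_on_def
    by (intro conjI assms(2)) blast
qed

section \<open>From a local metrization to adapted coordinates\<close>

context kropina_space begin

lemma affine_connection_chart:
  assumes "affine_connection_of M A F \<Gamma>" "c \<in> M" "z \<in> TM_coords c A"
  shows "nonlinear_conn (coord_rep M c L) k i z = (\<Sum>j\<in>UNIV. \<Gamma> c (fst z) k i j * snd z $ j)"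
  using assms unfolding affine_connection_of_def by (cases z) fastforce

definition potential :: "('m \<Rightarrow> ('m, 'n) tangent \<Rightarrow> ('m, 'n) tangent \<Rightarrow> real) \<Rightarrow> ('m, 'n) chart \<Rightarrow> real^'n \<Rightarrow> real" where
  "potential g c x = (ln \<bar>det (metric_comp M a c x)\<bar> - ln \<bar>det (metric_comp M g c x)\<bar>) / (2 * m * real CARD('n))"

text \<open>Here flat means rescaled to be parallel for the affine connection, not of vanishing
  curvature; likewise for \<open>flat_form\<close>.\<close>

definition flat_metric where "flat_metric g c x = exp (- 2 * m * potential g c x) *\<^sub>R metric_comp M a c x"

definition flat_form where "flat_form g c x = exp (- (1 + m) * potential g c x) *\<^sub>R form_comp M b c x"

lemma potential_smooth:
  assumes g: "pseudo_riemannian_on M U g" and c: "c \<in> M"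
  shows "smooth_on (potential g c) (snd c ` (U \<inter> fst c))"
proof -
  let ?S = "snd c ` (U \<inter> fst c)"
  have S: "open ?S" by (rule chart_image_Int_open[OF c metric_open[OF g]])
  have ln: "smooth_on (\<lambda>x. ln \<bar>det (metric_comp M h c x)\<bar>) ?S"
    if "\<And>i j. smooth_on (\<lambda>x. metric_comp M h c x $ i $ j) ?S" "\<And>x. x \<in> ?S \<Longrightarrow> invertible (metric_comp M h c x)" for h
    using that by (intro smooth_on_ln_abs smooth_on_det S) (auto simp: invertible_det_nz)
  have "smooth_on (\<lambda>x. ln \<bar>det (metric_comp M a c x)\<bar> - ln \<bar>det (metric_comp M g c x)\<bar>) ?S"
  proof (intro smooth_on_diff S ln)
    show "smooth_on (\<lambda>x. metric_comp M a c x $ i $ j) ?S" for i j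
      by (rule smooth_on_subset[OF metric_smooth_nth[OF a c]]) blast
    show "smooth_on (\<lambda>x. metric_comp M g c x $ i $ j) ?S" for i j by (rule metric_smooth_nth[OF g c])
    show "invertible (metric_comp M a c x)" "invertible (metric_comp M g c x)" if "x \<in> ?S" for x
      using that metric_invertible[OF a c] metric_invertible[OF g c] by blast+
  qed
  then show ?thesis unfolding potential_def divide_inverse by (intro smooth_on_mult S smooth_on_const)
qed

lemma flat_parallel:
  assumes g: "pseudo_riemannian_on M U g" and \<Gamma>: "affine_connection_of M A F \<Gamma>" and lc: "levi_civita_on M U g \<Gamma>"
    and n: "CARD('n) > 2" and c: "c \<in> M" and x: "x \<in> snd c ` (U \<inter> fst c)"
  shows "cov_metric (\<Gamma> c x) (flat_metric g c) k x = 0" "cov_form (\<Gamma> c x) (flat_form g c) k x = 0"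
    "\<Gamma> c x l i j = \<Gamma> c x l j i"
proof -
  interpret K: kropina_lagrangian "coord_rep M c L" "TM_coords c A" "chart_image c" "metric_comp M a c" "form_comp M b c" m
    by (rule chart_kropina[OF c])
  have xc: "x \<in> chart_image c" using x by blast
  have lcx: "\<Gamma> c x k i j = \<Gamma> c x k j i"
    "pd k (\<lambda>x'. metric_comp M g c x' $ i $ j) x
       - (\<Sum>l\<in>UNIV. \<Gamma> c x l k i * metric_comp M g c x $ l $ j)
       - (\<Sum>l\<in>UNIV. \<Gamma> c x l k j * metric_comp M g c x $ i $ l) = 0" for i j k
    using lc c x unfolding levi_civita_on_def by blast+
  show "\<Gamma> c x l i j = \<Gamma> c x l j i" by (rule lcx(1))
  have covg: "cov_metric (\<Gamma> c x) (metric_comp M g c) k x = 0"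
    by (simp add: vec_eq_iff cov_metric_nth lcx(2))
  obtain f where f: "cov_metric (\<Gamma> c x) (metric_comp M a c) k x = (2 * m * f) *\<^sub>R metric_comp M a c x"
    "cov_form (\<Gamma> c x) (form_comp M b c) k x = ((1 + m) * f) *\<^sub>R form_comp M b c x"
    using K.covariant_derivatives[OF n m_ne_0 m_ne_minus_1 affine_connection_chart[OF \<Gamma> c] xc] by blast
  have gd: "(\<lambda>x. metric_comp M g c x $ i $ j) differentiable (at x)" for i j
    by (rule smooth_on_differentiable[OF metric_smooth_nth[OF g c] x])
  have ginv: "invertible (metric_comp M g c x)" using x metric_invertible[OF g c] by blast
  have pdiff: "potential g c differentiable (at x)" by (rule smooth_on_differentiable[OF potential_smooth[OF g c] x])
  have N: "2 * m * real CARD('n) \<noteq> 0" using m_ne_0 by simp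
  have pd_scale: "pd k (\<lambda>x. r * potential g c x) x = r * pd k (potential g c) x" for r
    unfolding pd_def by (rule frechet_derivative_bounded_linear_compose[OF bounded_linear_mult_right pdiff])
  have "pd k (\<lambda>x. (2 * m * real CARD('n)) * potential g c x) x = real CARD('n) * (2 * m * f)"
    using ln_det_ratio_derivative[OF K.a_diff[OF xc] K.a_inv[OF xc] gd ginv f(1) covg] N by (simp add: potential_def)
  \<comment> \<open>\<open>f\<close> was only known to exist at this point and for this
    \<open>k\<close>. It is now the k-th derivative of one smooth function, which is what the two
    rescalings below cancel.\<close>
  then have pf: "pd k (potential g c) x = f" unfolding pd_scale using m_ne_0 by simp
  have d: "(\<lambda>x. r * potential g c x) differentiable (at x)" for r
    by (rule differentiable_mult[OF differentiable_const pdiff])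
  show "cov_metric (\<Gamma> c x) (flat_metric g c) k x = 0"
    using cov_metric_rescale[where \<phi> = "\<lambda>x. (- 2 * m) * potential g c x" and k = k, OF d K.a_diff[OF xc]] f(1)
    by (simp only: flat_metric_def[abs_def] pd_scale pf) (simp add: scaleR_add_left[symmetric])
  show "cov_form (\<Gamma> c x) (flat_form g c) k x = 0"
    using cov_form_rescale[where \<phi> = "\<lambda>x. (- (1 + m)) * potential g c x" and k = k, OF d K.b_diff[OF xc]] f(2)
    by (simp only: flat_form_def[abs_def] pd_scale pf) (simp add: scaleR_add_left[symmetric], simp add: algebra_simps)
qed

lemma flat_smooth:
  assumes g: "pseudo_riemannian_on M U g" and c: "c \<in> M"
  shows "smooth_on (\<lambda>x. flat_metric g c x $ i $ j) (snd c ` (U \<inter> fst c))" "smooth_on (flat_form g c) (snd c ` (U \<inter> fst c))"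
proof -
  interpret K: kropina_lagrangian "coord_rep M c L" "TM_coords c A" "chart_image c" "metric_comp M a c" "form_comp M b c" m
    by (rule chart_kropina[OF c])
  have S: "open (snd c ` (U \<inter> fst c))" by (rule chart_image_Int_open[OF c metric_open[OF g]])
  have sub: "snd c ` (U \<inter> fst c) \<subseteq> chart_image c" by blast
  show "smooth_on (\<lambda>x. flat_metric g c x $ i $ j) (snd c ` (U \<inter> fst c))"
    unfolding flat_metric_def vector_scaleR_component real_scaleR_def
    by (intro smooth_on_mult smooth_on_exp_compose S smooth_on_const potential_smooth[OF g c] smooth_on_subset[OF K.a_smooth sub])
  show "smooth_on (flat_form g c) (snd c ` (U \<inter> fst c))"
    unfolding flat_form_def
    by (intro smooth_on_scaleR smooth_on_mult smooth_on_exp_compose S smooth_on_const potential_smooth[OF g c] smooth_on_subset[OF K.b_smooth sub])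
qed

lemma metrizable_imp_adapted:
  fixes iu iv :: 'n
  assumes n: "CARD('n) > 2" and i: "iu \<noteq> iv" and null: "\<forall>c\<in>M. \<forall>x \<in> chart_image c. form_normsq M a b c x = 0"
    and lm: "local_metrization M A F U g" and p: "p \<in> U"
  shows "\<exists>c \<psi> H W h. p \<in> fst c \<and> adapted_coordinates M a b m iu iv c \<psi> H W h"
proof -
  obtain \<Gamma> where g: "pseudo_riemannian_on M U g" and \<Gamma>: "affine_connection_of M A F \<Gamma>" and lc: "levi_civita_on M U g \<Gamma>"
    using lm unfolding local_metrization_def by blast
  obtain c where c: "c \<in> M" "p \<in> fst c" by (rule chart_around)
  interpret K: kropina_lagrangian "coord_rep M c L" "TM_coords c A" "chart_image c" "metric_comp M a c" "form_comp M b c" m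
    by (rule chart_kropina[OF c(1)])
  let ?S = "snd c ` (U \<inter> fst c)" and ?q = "snd c p"
  have S: "open ?S" by (rule chart_image_Int_open[OF c(1) metric_open[OF g]])
  have "?q \<in> ?S" using p c(2) by blast
  \<comment> \<open>Work on a ball, so that the closed form has a potential.\<close>
  then obtain r where r: "r > 0" "ball ?q r \<subseteq> ?S" using S open_contains_ball by blast
  let ?N = "ball ?q r" and ?\<beta> = "flat_form g c" and ?\<psi> = "potential g c"
  have Nc: "x \<in> chart_image c" if "x \<in> ?N" for x using that r(2) by blast
  have \<beta>_smooth: "smooth_on ?\<beta> ?N" by (rule smooth_on_subset[OF flat_smooth(2)[OF g c(1)] r(2)])
  have closed: "frechet_derivative ?\<beta> (at x) v \<bullet> w = frechet_derivative ?\<beta> (at x) w \<bullet> v" if x: "x \<in> ?N" for x v w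
  proof -
    have xS: "x \<in> ?S" using x r(2) by blast
    have d: "?\<beta> differentiable (at x)" by (rule smooth_on_differentiable[OF \<beta>_smooth x])
    show ?thesis
      using parallel_form_derivative[OF d flat_parallel(2)[OF g \<Gamma> lc n c(1) xS]]
        conn_sym[of "\<Gamma> c x", OF flat_parallel(3)[OF g \<Gamma> lc n c(1) xS]] by metis
  qed
  obtain u where u: "\<And>x. x \<in> ?N \<Longrightarrow> (u has_derivative (\<lambda>v. ?\<beta> x \<bullet> v)) (at x)"
    using closed_form_has_potential[OF \<beta>_smooth closed] by blast
  have u_smooth: "smooth_on u ?N"
    by (rule smooth_on_derivI[OF open_ball u], assumption) (intro smooth_on_inner open_ball \<beta>_smooth smooth_on_const)
  \<comment> \<open>The exponent m - 1 is chosen so that lowering with \<open>flat_metric\<close>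
    adds -2m and gives the exponent -(1 + m) of \<open>flat_form\<close>. The minus sign matches -2
    du dv, for which lowering \<partial>/\<partial>v gives -du.\<close>
  define V where "V x = - (exp ((m - 1) * ?\<psi> x) *\<^sub>R form_raised M a b c x)" for x
  have raised: "metric_comp M a c x *v form_raised M a b c x = form_comp M b c x" if "x \<in> ?N" for x
    using matrix_inv_right[OF K.a_inv[OF Nc[OF that]]] by (simp add: form_raised_def matrix_vector_mul_assoc)
  have aV: "flat_metric g c x *v V x = - ?\<beta> x" if "x \<in> ?N" for x
  proof -
    have "flat_metric g c x *v V x = - ((exp (- 2 * m * ?\<psi> x) * exp ((m - 1) * ?\<psi> x)) *\<^sub>R form_comp M b c x)"
      unfolding V_def flat_metric_def using raised[OF that]
      by (simp add: matrix_scaleR_vector linear_neg[OF matrix_vector_mul_linear] linear_scale[OF matrix_vector_mul_linear])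
    also have "exp (- 2 * m * ?\<psi> x) * exp ((m - 1) * ?\<psi> x) = exp (- (1 + m) * ?\<psi> x)"
      by (simp add: exp_add[symmetric] algebra_simps)
    finally show ?thesis by (simp add: flat_form_def)
  qed
  have V_smooth: "smooth_on V ?N"
  proof -
    have "smooth_on (\<lambda>x. matrix_inv (metric_comp M a c x) *v form_comp M b c x) ?N"
      using Nc by (intro smooth_on_matrix_vector_mult smooth_on_matrix_inv open_ball
          smooth_on_subset[OF K.a_smooth] smooth_on_subset[OF K.b_smooth] K.a_inv) blast+
    then show ?thesis unfolding V_def form_raised_def
      by (intro smooth_on_minus smooth_on_scaleR smooth_on_exp_compose smooth_on_mult smooth_on_const open_ball
          smooth_on_subset[OF potential_smooth[OF g c(1)] r(2)])
  qed
  have Du: "frechet_derivative u (at x) = (\<lambda>v. ?\<beta> x \<bullet> v)" if "x \<in> ?N" for x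
    by (rule frechet_derivative_eqI[OF u[OF that]])
  have VDu: "frechet_derivative u (at x) (V x) = 0" if x: "x \<in> ?N" for x
  proof -
    \<comment> \<open>Applying du to \<open>V\<close> gives the squared norm of b up to a nonzero
      factor.\<close>
    have "form_normsq M a b c x = 0" using null c(1) Nc[OF x] by blast
    then have "form_raised M a b c x \<bullet> form_comp M b c x = 0" unfolding form_normsq_def raised[OF x] .
    then show ?thesis by (simp add: Du[OF x] V_def flat_form_def inner_commute)
  qed
  have qN: "?q \<in> ?N" using r by simp
  have \<beta>q: "?\<beta> ?q \<noteq> 0" using K.b_ne[OF Nc[OF qN]] by (simp add: flat_form_def)
  have Vq: "V ?q \<noteq> 0" using aV[OF qN] \<beta>q by auto
  obtain W X Y where W: "open W" "?q \<in> W" "W \<subseteq> ?N" and X: "smooth_on X W" "open (X ` W)" "convex (X ` W)"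
    and hom: "homeomorphism W (X ` W) X Y" and Y: "smooth_on Y (X ` W)"
    and Xu: "\<And>x. x \<in> W \<Longrightarrow> X x $ iu = u x" and XV: "\<And>x. x \<in> W \<Longrightarrow> frechet_derivative X (at x) (V x) = axis iv 1"
    using straighten_vector_field[OF open_ball qN V_smooth u_smooth VDu Vq Du[OF qN] \<beta>q i] by metis
  define d where "d = (fst c \<inter> snd c -` W, X \<circ> snd c)"
  have Wc: "W \<subseteq> chart_image c" using W(3) Nc by blast
  note new = new_chart[OF c(1) W(1) Wc X(1,2) hom Y, folded d_def]
  have d1: "fst d = fst c \<inter> snd c -` W" by (simp add: d_def)
  have pd: "p \<in> fst d" using c(2) W(2) by (simp add: d1)
  have dM: "d \<in> M" by (rule new(1))
  have in_d: "p' \<in> fst c" "snd c p' \<in> W" "p' \<in> U" if "p' \<in> fst d" for p'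
  proof -
    show pc: "p' \<in> fst c" and pW: "snd c p' \<in> W" using that by (simp_all add: d1)
    have "snd c p' \<in> ?S" using pW W(3) r(2) by blast
    then obtain p'' where p'': "p'' \<in> U" "p'' \<in> fst c" "snd c p' = snd c p''" by blast
    then have "p' = p''" using inj_onD[OF chart_inj[OF c(1)] p''(3) pc] by blast
    then show "p' \<in> U" using p''(1) by simp
  qed
  have dS: "chart_image d = snd d ` (U \<inter> fst d)" using in_d(3) by blast
  have DX: "Dtr c d p' = frechet_derivative X (at (snd c p'))" if p': "p' \<in> fst d" for p'
  proof (rule frechet_derivative_cong_open[OF W(1) in_d(2)[OF p']])
    fix x assume "x \<in> W"
    then obtain p'' where "p'' \<in> fst c" "x = snd c p''" using Wc by blast
    then show "transition c d x = X x" using transition_apply[OF c(1)] by (simp add: d_def)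
  qed
  have Diu: "Dtr c d p' v $ iu = ?\<beta> (snd c p') \<bullet> v" if p': "p' \<in> fst d" for p' v
  proof -
    have x: "snd c p' \<in> W" "snd c p' \<in> ?N" using in_d(2)[OF p'] W(3) by blast+
    have "Dtr c d p' v $ iu = frechet_derivative (\<lambda>x. X x $ iu) (at (snd c p')) v"
      unfolding DX[OF p'] by (rule frechet_nth[OF smooth_on_differentiable[OF X(1) x(1)]])
    also have "\<dots> = frechet_derivative u (at (snd c p')) v"
      by (rule fun_cong[OF frechet_derivative_cong_open[OF W(1) x(1)]]) (rule Xu)
    finally show ?thesis by (simp add: Du[OF x(2)])
  qed
  have pot: "potential g d (snd d p') = ?\<psi> (snd c p')" if p': "p' \<in> fst d" for p'
    unfolding potential_def
    by (simp only: ln_det_ratio_invariant[OF pseudo_riemannian_on_subset[OF a metric_open[OF g] subset_UNIV] g dM p' c(1) in_d(1)[OF p'] in_d(3)[OF p']])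
  \<comment> \<open>The coordinate \<open>iu\<close> is the potential \<open>u\<close>, so in the
    new chart the closed form is du.\<close>
  have \<beta>d: "flat_form g d z = axis iu 1" if z: "z \<in> chart_image d" for z
  proof -
    obtain p' where p': "p' \<in> fst d" "z = snd d p'" using z by blast
    have "flat_form g d z \<bullet> y = axis iu 1 \<bullet> y" for y
    proof -
      have "flat_form g d z \<bullet> y = flat_form g c (snd c p') \<bullet> Dtr d c p' y"
        using form_pullback[OF b dM p'(1) c(1) in_d(1)[OF p'(1)], of y] by (simp add: flat_form_def pot p')
      also have "\<dots> = Dtr c d p' (Dtr d c p' y) $ iu" by (simp add: Diu[OF p'(1)])
      also have "\<dots> = y $ iu" using Dtr_inverse[OF dM c(1) p'(1) in_d(1)[OF p'(1)]] by simp
      finally show ?thesis by (simp add: inner_axis')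
    qed
    then show ?thesis using vector_eq_rdot by blast
  qed
  have ad_sym: "flat_metric g d z $ i $ j = flat_metric g d z $ j $ i" if z: "z \<in> chart_image d" for z i j
  proof -
    obtain p' where p': "p' \<in> fst d" "z = snd d p'" using z by blast
    show ?thesis using transpose_eq_nth[OF metric_transpose[OF a dM UNIV_I p'(1)], of i j] by (simp add: flat_metric_def p'(2))
  qed
  have ad_row: "flat_metric g d z $ iv $ j = - axis iu 1 $ j" if z: "z \<in> chart_image d" for z j
  proof -
    obtain p' where p': "p' \<in> fst d" "z = snd d p'" using z by blast
    have x: "snd c p' \<in> ?N" using in_d(2)[OF p'(1)] W(3) by blast
    \<comment> \<open>The tangent vector with components \<open>axis iv 1\<close> in the new chart
      is \<open>V\<close>. Since \<open>V\<close> is the negative dual of the closed form, row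
      \<open>iv\<close> of the metric consists of the components of -du.\<close>
    have J: "Dtr d c p' (axis iv 1) = V (snd c p')"
      using Dtr_inverse[OF c(1) dM in_d(1)[OF p'(1)] p'(1), of "V (snd c p')"] XV[OF in_d(2)[OF p'(1)]] by (simp add: DX[OF p'(1)])
    have "flat_metric g d z $ j $ iv = axis j 1 \<bullet> (flat_metric g d z *v axis iv 1)"
      by (simp add: matrix_vector_mult_basis column_def inner_axis')
    also have "\<dots> = Dtr d c p' (axis j 1) \<bullet> (flat_metric g c (snd c p') *v Dtr d c p' (axis iv 1))"
      using metric_pullback[OF a dM p'(1) c(1) in_d(1)[OF p'(1)] UNIV_I, of "axis j 1" "axis iv 1"]
      by (simp add: flat_metric_def pot p' matrix_scaleR_vector)
    also have "\<dots> = - (?\<beta> (snd c p') \<bullet> Dtr d c p' (axis j 1))" by (simp add: J aV[OF x] inner_commute)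
    also have "\<dots> = - (Dtr c d p' (Dtr d c p' (axis j 1)) $ iu)" by (simp add: Diu[OF p'(1)])
    also have "\<dots> = - (axis j 1 $ iu)" using Dtr_inverse[OF dM c(1) p'(1) in_d(1)[OF p'(1)]] by simp
    finally show ?thesis using ad_sym[OF z, of iv j] by (simp add: axis_def)
  qed
  have im_open: "open (chart_image d)" by (rule chart_image_open[OF dM])
  interpret G: symmetric_metric "flat_metric g d" "chart_image d"
    by standard (rule im_open, rule ad_sym)
  have ad_smooth: "smooth_on (\<lambda>x. flat_metric g d x $ i $ j) (chart_image d)" for i j
    using flat_smooth(1)[OF g dM] dS by simp
  \<comment> \<open>In this chart \<open>flat_metric\<close> and du are parallel, so
    \<partial>/\<partial>v is a Killing field and no entry varies with v; the convex image turns
    this into independence of v on the whole chart.\<close>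
  have indep: "independent_of_on iv (chart_image d) (\<lambda>x. flat_metric g d x $ i $ j)" for i j
  proof (rule pd_zero_imp_independent[OF im_open])
    show "convex (chart_image d)" unfolding new(2) by (rule X(3))
    fix z assume z: "z \<in> chart_image d"
    then have zS: "z \<in> snd d ` (U \<inter> fst d)" using dS by simp
    show "(\<lambda>x. flat_metric g d x $ i $ j) differentiable (at z)" by (rule smooth_on_differentiable[OF ad_smooth z])
    note fp = flat_parallel[OF g \<Gamma> lc n dM zS]
    have "cov_form (\<Gamma> d z) (\<lambda>x. axis iu 1) k z = 0" for k
      using fp(2)[of k] cov_form_cong_open[OF im_open z \<beta>d] by simp
    from G.parallel_imp_killing[OF ad_row z fp(3) fp(1) this]
    show "pd iv (\<lambda>x. flat_metric g d x $ i $ j) z = 0" .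
  qed
  have "adapted_coordinates M a b m iu iv d (potential g d) (\<lambda>x. flat_metric g d x $ iu $ iu)
     (\<lambda>x j. flat_metric g d x $ iu $ j) (\<lambda>x i j. flat_metric g d x $ i $ j)"
    unfolding adapted_coordinates_def
  proof (intro conjI ballI dM ad_smooth indep)
    show "smooth_on (potential g d) (chart_image d)" using potential_smooth[OF g dM] dS by simp
    show "flat_metric g d x $ i $ j = flat_metric g d x $ j $ i" if "x \<in> chart_image d" for i j x by (rule ad_sym[OF that])
    fix p' assume p': "p' \<in> fst d"
    then have z: "snd d p' \<in> chart_image d" by blast
    show "a p' v w = exp (2 * m * potential g d (snd d p')) * wave_metric iu iv (\<lambda>x. flat_metric g d x $ iu $ iu)
      (\<lambda>x j. flat_metric g d x $ iu $ j) (\<lambda>x i j. flat_metric g d x $ i $ j) (snd d p') (v d) (w d)"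
      if vw: "v \<in> tangent_space M p'" "w \<in> tangent_space M p'" for v w
    proof -
      have "wave_metric iu iv (\<lambda>x. flat_metric g d x $ iu $ iu) (\<lambda>x j. flat_metric g d x $ iu $ j)
          (\<lambda>x i j. flat_metric g d x $ i $ j) (snd d p') (v d) (w d) = v d \<bullet> (flat_metric g d (snd d p') *v w d)"
        using wave_metric_matrix[of iu iv "flat_metric g d (snd d p')" "snd d p'" "v d" "w d", OF i ad_sym[OF z] ad_row[OF z]]
        by (simp add: wave_metric_def)
      moreover have "a p' v w = v d \<bullet> (metric_comp M a d (snd d p') *v w d)"
        by (rule metric_apply[OF a dM UNIV_I p' vw])
      ultimately show ?thesis
        by (simp add: flat_metric_def matrix_scaleR_vector mult.assoc[symmetric] exp_add[symmetric])
    qed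
    show "b p' w = exp ((1 + m) * potential g d (snd d p')) * w d $ iu" if w: "w \<in> tangent_space M p'" for w
    proof -
      have "b p' w = form_comp M b d (snd d p') \<bullet> w d" using b dM p' w unfolding one_form_def by blast
      also have "form_comp M b d (snd d p') = exp ((1 + m) * potential g d (snd d p')) *\<^sub>R flat_form g d (snd d p')"
      proof -
        have "(1 + m) * t + - (1 + m) * t = 0" for t by (simp add: algebra_simps)
        then have "exp ((1 + m) * t) * exp (- (1 + m) * t) = 1" for t by (metis exp_add exp_zero)
        then show ?thesis by (simp only: flat_form_def scaleR_scaleR scaleR_one)
      qed
      finally show ?thesis by (simp add: \<beta>d[OF z] inner_axis')
    qed
  qed
  then show ?thesis using pd by blast
qed

section \<open>From adapted coordinates to a local metrization\<close>

text \<open>The affine connection \<open>\<Gamma>\<close> exists by the Berwald condition and has to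
  be recognized as the Levi-Civita connection of the wave metric. Uniqueness does this in the
  adapted chart only; \<open>levi_civita_on\<close> asks for every chart meeting it, which is why
  the transformation results are used.\<close>

lemma adapted_imp_metrization:
  fixes iu iv :: 'n
  assumes i: "iu \<noteq> iv" and berwald: "berwald M A F" and ad: "adapted_coordinates M a b m iu iv c \<psi> H W h"
  shows "local_metrization M A F (fst c) (\<lambda>p v w. wave_metric iu iv H W h (snd c p) (v c) (w c))"
proof -
  define g where "g = (\<lambda>p v w. wave_metric iu iv H W h (snd c p) (v c) (w (c :: ('m, 'n) chart)))"
  note ad' = ad[unfolded adapted_coordinates_def]
  have c: "c \<in> M" and \<psi>: "smooth_on \<psi> (chart_image c)" using ad' by blast+
  have indH: "independent_of_on iv (chart_image c) H"
    and indW: "\<And>i. i \<in> -{iu, iv} \<Longrightarrow> independent_of_on iv (chart_image c) (\<lambda>x. W x i)"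
    and indh: "\<And>i j. i \<in> -{iu, iv} \<Longrightarrow> j \<in> -{iu, iv} \<Longrightarrow> independent_of_on iv (chart_image c) (\<lambda>x. h x i j)"
    using ad' by blast+
  have a_ad: "a p v w = exp (2 * m * \<psi> (snd c p)) * g p v w"
    if "p \<in> fst c" "v \<in> tangent_space M p" "w \<in> tangent_space M p" for p v w
    using ad' that unfolding g_def by blast
  have b_ad: "b p w = exp ((1 + m) * \<psi> (snd c p)) * w c $ iu" if "p \<in> fst c" "w \<in> tangent_space M p" for p w
    using ad' that by blast
  have g_eq: "g p v w = exp (- (2 * m * \<psi> (snd c p))) * a p v w"
    if "p \<in> fst c" "v \<in> tangent_space M p" "w \<in> tangent_space M p" for p v w
    using a_ad[OF that] by (simp add: exp_minus field_simps)
  \<comment> \<open>The wave metric is a positive multiple of \<open>a\<close> over the chart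
    domain. Smoothness, symmetry and invertibility in all charts are inherited from \<open>a\<close>
    and need not be extracted from \<open>H\<close>, \<open>W\<close> and \<open>h\<close>.\<close>
  have g_comp: "metric_comp M g d (snd d p) = exp (- (2 * m * \<psi> (snd c p))) *\<^sub>R metric_comp M a d (snd d p)"
    if "d \<in> M" "p \<in> fst c" "p \<in> fst d" for d p
    using that g_eq[OF that(2) tvec_in tvec_in, OF that(1,3) that(1,3)] by (simp add: metric_comp_def vec_eq_iff)
  have g_pr: "pseudo_riemannian_on M (fst c) g"
    unfolding pseudo_riemannian_on_def
  proof (intro conjI ballI)
    show "open (fst c)" by (rule chart_open[OF c])
    fix d assume d: "d \<in> M"
    let ?S = "snd d ` (fst c \<inter> fst d)"
    have S: "open ?S" by (rule chart_image_Int_open[OF d chart_open[OF c]])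
    have S2: "?S = snd d ` (fst d \<inter> fst c)" by blast
    have tr: "transition d c ` ?S \<subseteq> chart_image c"
    proof (rule image_subsetI)
      fix x assume "x \<in> ?S"
      then obtain p where "p \<in> fst c" "p \<in> fst d" "x = snd d p" by blast
      then show "transition d c x \<in> chart_image c" using transition_apply[OF d] by simp
    qed
    have "smooth_on (\<lambda>x. \<psi> (transition d c x)) ?S"
      by (rule smooth_on_compose[OF S _ \<psi> tr]) (use transition_smooth[OF d c] S2 in simp)
    then have e: "smooth_on (\<lambda>x. exp (- (2 * m * \<psi> (transition d c x)))) ?S"
      by (intro smooth_on_exp_compose smooth_on_minus smooth_on_mult smooth_on_const S)
    have "smooth_on (metric_comp M a d) ?S"
      by (rule smooth_on_subset[OF metric_smooth[OF a d]]) blast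
    from smooth_on_scaleR[OF S e this]
    have "smooth_on (\<lambda>x. exp (- (2 * m * \<psi> (transition d c x))) *\<^sub>R metric_comp M a d x) ?S" .
    moreover have "exp (- (2 * m * \<psi> (transition d c x))) *\<^sub>R metric_comp M a d x = metric_comp M g d x" if x: "x \<in> ?S" for x
    proof -
      obtain p where p: "p \<in> fst c" "p \<in> fst d" "x = snd d p" using x by blast
      then show ?thesis using g_comp[OF d p(1,2)] transition_apply[OF d p(2)] by simp
    qed
    ultimately show "smooth_on (metric_comp M g d) ?S" by (rule smooth_on_cong[OF S, rotated])
    fix p assume "p \<in> fst c \<inter> fst d"
    then have p: "p \<in> fst c" "p \<in> fst d" by blast+
    show "g p v w = v d \<bullet> (metric_comp M g d (snd d p) *v w d)"
      if "v \<in> tangent_space M p" "w \<in> tangent_space M p" for v w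
      using g_eq[OF p(1) that] metric_apply[OF a d UNIV_I p(2) that] by (simp add: g_comp[OF d p] matrix_scaleR_vector)
    show "transpose (metric_comp M g d (snd d p)) = metric_comp M g d (snd d p)"
      using transpose_eq_nth[OF metric_transpose[OF a d UNIV_I p(2)]] by (simp add: g_comp[OF d p] vec_eq_iff transpose_def)
    show "invertible (metric_comp M g d (snd d p))"
      unfolding g_comp[OF d p] by (rule invertible_scaleR[OF metric_invertible[OF a d UNIV_I p(2)]]) simp
  qed
  obtain \<Gamma> where \<Gamma>: "affine_connection_of M A F \<Gamma>" using berwald unfolding berwald_def by blast
  have \<Gamma>_sym: "\<Gamma> d x k i j = \<Gamma> d x k j i" and \<Gamma>_hor: "\<And>e y. (x, y) \<in> TM_coords d A \<Longrightarrow> frechet_derivative (coord_rep M d L) (at (x, y)) (e, - conn (\<Gamma> d x) e y) = 0"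
    if d: "d \<in> M" "x \<in> chart_image d" for d x k i j
  proof -
    interpret D: kropina_lagrangian "coord_rep M d L" "TM_coords d A" "chart_image d" "metric_comp M a d" "form_comp M b d" m
      by (rule chart_kropina[OF d(1)])
    obtain y where y: "(x, y) \<in> TM_coords d A" using D.fibre_ne[OF d(2)] by blast
    show "\<Gamma> d x k i j = \<Gamma> d x k j i"
      using D.connection_symmetric[of "\<Gamma> d", OF affine_connection_chart[OF \<Gamma> d(1)] y] by simp
    show "frechet_derivative (coord_rep M d L) (at (x, y)) (e, - conn (\<Gamma> d x) e y) = 0" if "(x, y) \<in> TM_coords d A" for e y
      by (rule D.horizontal_conn[of "\<Gamma> d", OF affine_connection_chart[OF \<Gamma> d(1)] that])
  qed
  let ?Lc = "coord_rep M c L" and ?\<Omega>c = "TM_coords c A" and ?g = "metric_comp M g c"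
  interpret K: kropina_lagrangian ?Lc ?\<Omega>c "chart_image c" "metric_comp M a c" "form_comp M b c" m
    by (rule chart_kropina[OF c])
  have a_g: "metric_comp M a c x = exp (2 * m * \<psi> x) *\<^sub>R ?g x" and b_du: "form_comp M b c x = exp ((1 + m) * \<psi> x) *\<^sub>R axis iu 1"
    if x: "x \<in> chart_image c" for x
  proof -
    obtain p where p: "p \<in> fst c" "x = snd c p" using x by blast
    show "metric_comp M a c x = exp (2 * m * \<psi> x) *\<^sub>R ?g x"
      using g_comp[OF c p(1,1)] by (simp add: p(2) exp_add[symmetric])
    show "form_comp M b c x = exp ((1 + m) * \<psi> x) *\<^sub>R axis iu 1"
    proof -
      have "form_comp M b c (snd c p) $ i = exp ((1 + m) * \<psi> (snd c p)) * axis i 1 $ iu" for i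
        using b_ad[OF p(1) tvec_in[OF c p(1)], of "axis i 1"] c p(1) by (simp add: form_comp_def)
      moreover have "axis i 1 $ iu = (axis iu 1 :: real^'n) $ i" for i by (simp add: axis_def)
      ultimately show ?thesis by (simp add: vec_eq_iff p(2))
    qed
  qed
  have gc_nth: "?g x $ i $ j = wave_metric iu iv H W h x (axis i 1) (axis j 1)" if x: "x \<in> chart_image c" for x i j
  proof -
    obtain p where p: "p \<in> fst c" "x = snd c p" using x by blast
    show ?thesis using c p by (simp add: metric_comp_def g_def)
  qed
  have im_open: "open (chart_image c)" by (rule chart_image_open[OF c])
  have g_smooth: "smooth_on (\<lambda>x. ?g x $ i $ j) (chart_image c)" for i j
    using metric_smooth_nth[OF g_pr c] by simp
  have g_sym: "?g x $ i $ j = ?g x $ j $ i" and g_tr: "transpose (?g x) = ?g x" and g_inv: "invertible (?g x)" if x: "x \<in> chart_image c" for x i j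
  proof -
    obtain p where p: "p \<in> fst c" "x = snd c p" using x by blast
    show tr: "transpose (?g x) = ?g x" using metric_transpose[OF g_pr c p(1,1)] by (simp add: p(2))
    show "?g x $ i $ j = ?g x $ j $ i" by (rule transpose_eq_nth[OF tr])
    show "invertible (?g x)" using metric_invertible[OF g_pr c p(1,1)] by (simp add: p(2))
  qed
  \<comment> \<open>The same \<open>L\<close> is also the Kropina Lagrangian of the wave metric and
    du. Reading it in this second way shows that a connection preserving these two preserves
    \<open>L\<close>.\<close>
  interpret G: kropina_lagrangian ?Lc ?\<Omega>c "chart_image c" ?g "\<lambda>x. axis iu 1" m
  proof
    show "y \<bullet> (?g x *v y) \<noteq> 0" "axis iu 1 \<bullet> y > 0" "?Lc (x, y) = \<bar>y \<bullet> (?g x *v y)\<bar> powr (1 + m) * (axis iu 1 \<bullet> y) powr (- 2 * m)"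
      if z: "(x, y) \<in> ?\<Omega>c" for x y
    proof -
      have x: "x \<in> chart_image c" using K.fst_\<Omega>[OF z] by simp
      have Q: "y \<bullet> (metric_comp M a c x *v y) = exp (2 * m * \<psi> x) * (y \<bullet> (?g x *v y))"
        and \<beta>: "form_comp M b c x \<bullet> y = exp ((1 + m) * \<psi> x) * (axis iu 1 \<bullet> y)"
        by (simp_all add: a_g[OF x] b_du[OF x] matrix_scaleR_vector)
      show "y \<bullet> (?g x *v y) \<noteq> 0" using K.a_ne[OF z] Q by auto
      show pos: "axis iu 1 \<bullet> y > 0" using K.b_pos[OF z] \<beta> by (simp add: zero_less_mult_iff)
      have "?Lc (x, y) = exp (2 * m * \<psi> x) powr (1 + m) * \<bar>y \<bullet> (?g x *v y)\<bar> powr (1 + m)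
          * (exp ((1 + m) * \<psi> x) powr (- 2 * m) * (axis iu 1 \<bullet> y) powr (- 2 * m))"
        using K.L_eq[OF z] pos by (simp add: Q \<beta> abs_mult powr_mult)
      \<comment> \<open>The exponents 2m (1 + m) \<psi> and -2m (1 + m) \<psi> cancel; this is why
        the conformal factors of \<open>a\<close> and \<open>b\<close> have this form.\<close>
      moreover have "exp (2 * m * \<psi> x) powr (1 + m) * exp ((1 + m) * \<psi> x) powr (- 2 * m) = 1"
        by (simp add: exp_powr_real exp_add[symmetric] algebra_simps)
      ultimately show "?Lc (x, y) = \<bar>y \<bullet> (?g x *v y)\<bar> powr (1 + m) * (axis iu 1 \<bullet> y) powr (- 2 * m)"
        by (metis (no_types, lifting) mult.assoc mult.left_commute mult_1)
    qed
  qed (use im_open K.fst_\<Omega> K.fibre_ne g_smooth g_tr g_inv in auto)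
  interpret S: symmetric_metric ?g "chart_image c" by standard (rule im_open, rule g_sym)
  have par_c: "cov_metric (\<Gamma> c x) ?g k x = 0" if x: "x \<in> chart_image c" for x k
  proof -
    let ?\<Gamma> = "levi_civita_symbol ?g x"
    obtain y0 where y0: "(x, y0) \<in> ?\<Omega>c" using K.fibre_ne[OF x] by blast
    have row: "?g x $ iv $ j = - axis iu 1 $ j" if "x \<in> chart_image c" for x j
      unfolding gc_nth[OF that] by (rule wave_metric_row[OF i])
    have killing: "pd iv (\<lambda>x. ?g x $ i $ j) x = 0" for i j
    proof (rule independent_imp_pd_zero[OF _ im_open x G.a_diff[OF x]])
      show "independent_of_on iv (chart_image c) (\<lambda>x. ?g x $ i $ j)"
        unfolding independent_of_on_def
      proof (intro ballI impI)
        fix x x' assume xx: "x \<in> chart_image c" "x' \<in> chart_image c" "\<forall>j. j \<noteq> iv \<longrightarrow> x $ j = x' $ j"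
        have eqH: "H x = H x'" using indH xx unfolding independent_of_on_def by blast
        have eqW: "W x i = W x' i" if "i \<in> -{iu, iv}" for i
          using indW[OF that] xx unfolding independent_of_on_def by blast
        have eqh: "h x i j = h x' i j" if "i \<in> -{iu, iv}" "j \<in> -{iu, iv}" for i j
          using indh[OF that] xx unfolding independent_of_on_def by blast
        have "(\<Sum>a\<in>-{iu, iv}. W x a * D a) = (\<Sum>a\<in>-{iu, iv}. W x' a * D a)" for D
          by (intro sum.cong refl) (simp only: eqW)
        moreover have "(\<Sum>a\<in>-{iu, iv}. \<Sum>b\<in>-{iu, iv}. h x a b * E a b) = (\<Sum>a\<in>-{iu, iv}. \<Sum>b\<in>-{iu, iv}. h x' a b * E a b)" for E
          by (intro sum.cong refl) (simp only: eqh)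
        ultimately show "?g x $ i $ j = ?g x' $ i $ j"
          unfolding gc_nth[OF xx(1)] gc_nth[OF xx(2)] wave_metric_def by (simp only: eqH)
      qed
    qed
    have lcp: "cov_metric ?\<Gamma> ?g k x = 0" for k by (rule S.levi_civita_parallel[OF x g_inv[OF x]])
    have lcf: "cov_form ?\<Gamma> (\<lambda>x. axis iu 1) k x = 0" for k
      by (rule S.killing_imp_parallel[OF row x g_inv[OF x] killing])
    \<comment> \<open>Both connections are symmetric and preserve \<open>L\<close>: the first
      because it comes from the nonlinear connection, the second because it preserves the wave
      metric and du.\<close>
    have "conn (\<Gamma> c x) e y = conn ?\<Gamma> e y" for e y
      by (rule K.bilinear_connection_unique[OF linear_conn conn_sym[of "\<Gamma> c x", OF \<Gamma>_sym[OF c x]] \<Gamma>_hor[OF c x]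
          linear_conn conn_sym[of ?\<Gamma>, OF S.levi_civita_symbol_sym[OF x]] G.parallel_imp_horizontal[OF lcp lcf] y0])
    then show ?thesis
      using parallel_metric_iff[of ?g x "\<Gamma> c x", OF G.a_diff[OF x]] parallel_metric_iff[of ?g x ?\<Gamma>, OF G.a_diff[OF x]] lcp by auto
  qed
  have "levi_civita_on M (fst c) g \<Gamma>"
    unfolding levi_civita_on_def
  proof (intro ballI allI conjI)
    fix d x i j k assume d: "d \<in> M" and x: "x \<in> snd d ` (fst c \<inter> fst d)"
    obtain p where p: "p \<in> fst c" "p \<in> fst d" "x = snd d p" using x by blast
    have xd: "x \<in> chart_image d" using p by blast
    show "\<Gamma> d x k i j = \<Gamma> d x k j i" by (rule \<Gamma>_sym[OF d xd])
    let ?T = "snd d ` (fst d \<inter> fst c)" and ?\<tau> = "transition d c"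
    have xT: "x \<in> ?T" using x by blast
    have \<tau>x: "?\<tau> x = snd c p" using transition_apply[OF d p(2)] by (simp add: p(3))
    interpret T: coordinate_change ?\<tau> ?T
    proof
      show "open ?T" by (rule overlap_open[OF d c])
      show "smooth_on ?\<tau> ?T" by (rule transition_smooth[OF d c])
      show "bij (frechet_derivative ?\<tau> (at x))" if "x \<in> ?T" for x
        using that Dtr_bij[OF d c] by blast
    qed
    interpret D: kropina_lagrangian "coord_rep M d L" "TM_coords d A" "chart_image d" "metric_comp M a d" "form_comp M b d" m
      by (rule chart_kropina[OF d])
    have rel: "(?\<tau> x', T.D\<tau> x' y) \<in> ?\<Omega>c \<and> coord_rep M d L (x', y) = ?Lc (?\<tau> x', T.D\<tau> x' y)"
      if z: "(x', y) \<in> TM_coords d A" and x': "x' \<in> ?T" for x' y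
    proof -
      obtain p' where p': "p' \<in> fst d" "p' \<in> fst c" "x' = snd d p'" using x' by blast
      have w: "(p', tvec M d p' y) \<in> A" using TM_coords_iff[OF A_tangent d p'(1)] z p'(3) by simp
      have t: "tvec M d p' y \<in> tangent_space M p'" by (rule tvec_in[OF d p'(1)])
      have wc: "tvec M d p' y c = T.D\<tau> x' y" using tvec_apply[OF c p'(2)] by (simp add: p'(3))
      have \<tau>: "?\<tau> x' = snd c p'" using transition_apply[OF d p'(1)] by (simp add: p'(3))
      have "(snd c p', tvec M d p' y c) \<in> ?\<Omega>c"
        unfolding TM_coords_def using w p'(2) by blast
      moreover have "coord_rep M d L (x', y) = ?Lc (snd c p', tvec M d p' y c)"
        by (simp only: coord_rep_apply[OF c p'(2) t] p'(3) coord_rep_tvec[OF d p'(1)])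
      ultimately show ?thesis by (simp add: wc \<tau>)
    qed
    obtain y0 where y0: "(x, y0) \<in> TM_coords d A" using D.fibre_ne[OF xd] by blast
    have \<tau>c: "?\<tau> x \<in> chart_image c" using p(1) \<tau>x by simp
    \<comment> \<open>\<open>rel\<close> says that the representations of \<open>L\<close> in the
      two charts correspond under the tangent map, which is the input for the transformation
      law.\<close>
    have trans: "T.D\<tau> x (conn (\<Gamma> d x) e y) = T.D2\<tau> x e y + conn (\<Gamma> c (?\<tau> x)) (T.D\<tau> x e) (T.D\<tau> x y)" for e y
      by (rule T.connection_transformation[OF K.finsler_lagrangian_axioms D.finsler_lagrangian_axioms xT
          conjunct1[OF rel] conjunct2[OF rel] \<Gamma>_sym[OF c \<tau>c] \<Gamma>_hor[OF c \<tau>c] \<Gamma>_sym[OF d xd] \<Gamma>_hor[OF d xd] y0])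
    have "cov_metric (\<Gamma> d x) (metric_comp M g d) k x = 0"
    proof (rule T.parallel_transformation[OF xT trans _ _ _ par_c[OF \<tau>c]])
      show "(\<lambda>x. metric_comp M g c x $ i $ j) differentiable (at (?\<tau> x))" for i j by (rule G.a_diff[OF \<tau>c])
      show "(\<lambda>x. metric_comp M g d x $ i $ j) differentiable (at x)" for i j
        by (rule smooth_on_differentiable[OF metric_smooth_nth[OF g_pr d] x])
      show "y \<bullet> (metric_comp M g d x' *v z) = T.D\<tau> x' y \<bullet> (?g (?\<tau> x') *v T.D\<tau> x' z)" if x': "x' \<in> ?T" for x' y z
      proof -
        obtain p' where p': "p' \<in> fst d" "p' \<in> fst c" "x' = snd d p'" using x' by blast
        show ?thesis
          using metric_pullback[OF g_pr d p'(1) c p'(2) p'(2), of y z] transition_apply[OF d p'(1)] by (simp add: p'(3))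
      qed
    qed
    then have "cov_metric (\<Gamma> d x) (metric_comp M g d) k x $ i $ j = 0" by simp
    then show "pd k (\<lambda>x'. metric_comp M g d x' $ i $ j) x
       - (\<Sum>l\<in>UNIV. \<Gamma> d x l k i * metric_comp M g d x $ l $ j)
       - (\<Sum>l\<in>UNIV. \<Gamma> d x l k j * metric_comp M g d x $ i $ l) = 0"
      by (simp only: cov_metric_nth)
  qed
  then show ?thesis using g_pr \<Gamma> unfolding local_metrization_def g_def by blast
qed

lemma adapted_formula:
  fixes iu iv :: 'n
  assumes ad: "adapted_coordinates M a b m iu iv c \<psi> H W h" and z: "(p, w) \<in> A" and p: "p \<in> fst c"
  shows "F (p, w) = \<bar>wave_metric iu iv H W h (snd c p) (w c) (w c)\<bar> powr ((1 + m) / 2) * (w c $ iu) powr (- m)"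
proof -
  let ?Q = "wave_metric iu iv H W h (snd c p) (w c) (w c)" and ?t = "\<psi> (snd c p)"
  have w: "w \<in> tangent_space M p" by (rule A_tangent_space[OF z])
  have Q: "a p w w = exp (2 * m * ?t) * ?Q" and \<beta>: "b p w = exp ((1 + m) * ?t) * w c $ iu"
    using ad w p unfolding adapted_coordinates_def by blast+
  have pos: "w c $ iu > 0" using kropinaD(2)[OF z] by (simp add: \<beta> zero_less_mult_iff)
  have "sqrt \<bar>a p w w\<bar> = \<bar>a p w w\<bar> powr (1 / 2)" by (simp add: powr_half_sqrt)
  then have "sqrt \<bar>a p w w\<bar> powr (1 + m) = \<bar>a p w w\<bar> powr ((1 + m) / 2)" by (simp add: powr_powr)
  then have "F (p, w) = exp (2 * m * ?t) powr ((1 + m) / 2) * \<bar>?Q\<bar> powr ((1 + m) / 2)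
      * (exp ((1 + m) * ?t) powr (- m) * (w c $ iu) powr (- m))"
    using kropinaD(3)[OF z] pos by (simp add: Q \<beta> abs_mult powr_mult)
  \<comment> \<open>The same cancellation as for \<open>L\<close>, with halved exponents.\<close>
  moreover have "exp (2 * m * ?t) powr ((1 + m) / 2) * exp ((1 + m) * ?t) powr (- m) = 1"
    by (simp add: exp_powr_real exp_add[symmetric] algebra_simps)
  ultimately show ?thesis by (metis (no_types, lifting) mult.assoc mult.left_commute mult_1)
qed

end

theorem proposition6p3p4:
  fixes M :: "('m::{t2_space, second_countable_topology}, 'n::finite) chart set"
    and A :: "('m \<times> ('m, 'n) tangent) set"
    and F :: "'m \<times> ('m, 'n) tangent \<Rightarrow> real"
    and a :: "'m \<Rightarrow> ('m, 'n) tangent \<Rightarrow> ('m, 'n) tangent \<Rightarrow> real"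
    and b :: "'m \<Rightarrow> ('m, 'n) tangent \<Rightarrow> real"
    and m :: real
    and iu iv :: 'n
  assumes "smooth_structure M" and "CARD('n) > 2" and "iu \<noteq> iv"
    and "pseudo_riemannian_on M UNIV a" and "one_form M b"
    and "m_kropina M A a b m F"
    and "properly_finslerian M A F"
    and "berwald M A F"
    and "\<forall>c\<in>M. \<forall>x \<in> snd c ` fst c. form_normsq M a b c x = 0"
  shows "(locally_metrizable M A F \<longleftrightarrow>
            (\<forall>p. \<exists>c \<psi> H W h. p \<in> fst c \<and> adapted_coordinates M a b m iu iv c \<psi> H W h)) \<and>
         (locally_metrizable M A F \<longrightarrow>
            (\<forall>c \<psi> H W h. adapted_coordinates M a b m iu iv c \<psi> H W h \<longrightarrow>
               (\<forall>(p, w)\<in>A. p \<in> fst c \<longrightarrow>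
                  F (p, w) = \<bar>wave_metric iu iv H W h (snd c p) (w c) (w c)\<bar> powr ((1 + m) / 2)
                               * (w c $ iu) powr (- m)) \<and>
               local_metrization M A F (fst c)
                 (\<lambda>p v w. wave_metric iu iv H W h (snd c p) (v c) (w c))))"
proof -
  interpret kropina_space M A F a b m
    by standard (rule assms)+
  note metrization = adapted_imp_metrization[OF assms(3,8)]
  have "locally_metrizable M A F \<longleftrightarrow>
      (\<forall>p. \<exists>c \<psi> H W h. p \<in> fst c \<and> adapted_coordinates M a b m iu iv c \<psi> H W h)" (is "?l \<longleftrightarrow> ?r")
  proof
    assume l: ?l
    show ?r
    proof
      fix p
      obtain U g where "p \<in> U" "local_metrization M A F U g" using l unfolding locally_metrizable_def by blast
      then show "\<exists>c \<psi> H W h. p \<in> fst c \<and> adapted_coordinates M a b m iu iv c \<psi> H W h"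
        by (intro metrizable_imp_adapted[OF assms(2,3,9)])
    qed
  next
    assume r: ?r
    show ?l
      unfolding locally_metrizable_def
    proof
      fix p
      obtain c \<psi> H W h where p: "p \<in> fst c" and ad: "adapted_coordinates M a b m iu iv c \<psi> H W h"
        using r by blast
      show "\<exists>U g. p \<in> U \<and> local_metrization M A F U g"
        by (intro exI conjI, rule p, rule metrization[OF ad])
    qed
  qed
  then show ?thesis
  proof (intro conjI impI allI)
    fix c \<psi> H W h assume ad: "adapted_coordinates M a b m iu iv c \<psi> H W h"
    show "\<forall>(p, w)\<in>A. p \<in> fst c \<longrightarrow>
        F (p, w) = \<bar>wave_metric iu iv H W h (snd c p) (w c) (w c)\<bar> powr ((1 + m) / 2) * (w c $ iu) powr (- m)"
      by (intro ballI case_prodI2 impI adapted_formula[OF ad]) simp_all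
    show "local_metrization M A F (fst c) (\<lambda>p v w. wave_metric iu iv H W h (snd c p) (v c) (w c))"
      by (rule metrization[OF ad])
  qed
qed

end
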